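(* Let $M$ be a closed smooth manifold with a fixed Riemannian metric, and let $v$ be a smooth vector field on $M$. Assume that: (1) for any $\delta>0$ there exists $0<\epsilon<\delta$ such that the set $U_\epsilon\subset M$ is a Euclidean Neighbourhood Retract, where $U_\epsilon$ is the set of all points $m\in M$ such that $d(m\cdot t,p)>\epsilon$ for all $t\in\mathbf{R}$ and all zeros $p$ of $v$; (2) $v$ admits a Lyapunov 1-form; (3) the zeros of $v$ are isolated points of the chain recurrent set $R_v$. Then the number of zeros of $v$ is at least $\mathrm{Cat}(M,\xi)$, where $\xi\in H^1(M;\mathbf{R})$ is any cohomology class which can be realized by a smooth Lyapunov 1-form for $v$.
   Context: Notation: $d(\cdot,\cdot)$ is the distance on $M$ induced by the Riemannian metric and $t\mapsto m\cdot t$ is the flow of $v$. A topological space is a Euclidean Neighbourhood Retract (ENR) if it is homeomorphic to a subset $Y\subset\mathbf{R}^n$ which is a retract of some open neighbourhood of $Y$ in $\mathbf{R}^n$. Chain recurrence: a point $m\in M$ is chain-recurrent if for any $\delta>0$, $T>0$ there exist points $y_0,\dots,y_k\in M$ and numbers $s_0,\dots,s_k$ such that $s_j>T$ for all $j$, $d(m,y_0)<\delta$, $d(y_k\cdot s_k,m)<\delta$, and $d(y_j\cdot s_j,y_{j+1})<\delta$ for $j=0,\dots,k-1$. $R_v$ is the set of all chain-recurrent points. Lyapunov 1-form: a Lyapunov 1-form for $v$ is a smooth closed 1-form $\omega$ on $M$ such that (a) $\omega(v)>0$ on the complement of the set of zeros of $v$; (b) for any zero $p\in M$ of $v$ there exists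 a neighbourhood $U$ of $p$ such that $\omega|_U=df$ and the field $v|_U$ coincides with the gradient of the smooth function $f:U\to\mathbf{R}$ with respect to a Riemannian metric. Continuous closed 1-forms. A continuous closed 1-form $\omega$ on a topological space $X$ is given by a collection $\{f_U\}_{U\in\mathcal U}$ of continuous functions $f_U:U\to\mathbf{R}$, where $\mathcal U$ is an open cover of $X$, such that for all $U,V\in\mathcal U$ the difference $f_U|_{U\cap V}-f_V|_{U\cap V}$ is locally constant. Two such collections $\{f_U\}_{U\in\mathcal U}$, $\{g_V\}_{V\in\mathcal V}$ define the same closed 1-form if $f_U-g_V$ is locally constant on $U\cap V$ for all $U\in\mathcal U$, $V\in\mathcal V$. For a continuous path $\gamma:[\alpha,\beta]\to X$ the line integral is $\int_\gamma\omega=\sum_{i=0}^{N-1}[f_{U_i}(\gamma(t_{i+1}))-f_{U_i}(\gamma(t_i))]$, where $\alpha=t_0<t_1<\dots<t_N=\beta$ is a subdivision with $\gamma([t_i,t_{i+1}])\subset U_i\in\mathcal U$; it is independent of the choices. The cohomology class $[\omega]\in H^1(X;\mathbf{R})=\mathrm{Hom}(H_1(X),\mathbf{R})$ is the homomorphism of periods $[\gamma]\mapsto\int_\gamma\omega$ on closed loops. A smooth closed 1-form on a manifold is a special case (take local primitives $f_U$). Definition of $\mathrm{Cat}(X,\xi)$. Let $X$ be a finite CW-complex (for instance a closed smooth manifold), $\xi\in H^1(X;\mathbf{R})$, and fix a continuous closed 1-form $\omega$ on $X$ representing $\xi$. $\mathrm{Cat}(X,\xi)$ is the least integer $k\ge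 0$ such that there exists an open cover $X=F\cup F_1\cup\dots\cup F_k$ (where $F$ may be empty) with: (a) each inclusion $F_j\to X$, $j=1,\dots,k$, is null-homotopic; (b) there exists a homotopy $h_t:F\to X$, $t\in(-\infty,+\infty)$, such that $h_0$ is the inclusion $F\to X$ and for any integer $n>0$ there exists $N>0$ such that for all $x\in F$: $\int_x^{h_t(x)}\omega>n$ whenever $t>N$, and $\int_x^{h_t(x)}\omega<-n$ whenever $t<-N$. Here, for $t>0$, $\int_x^{h_t(x)}\omega$ is the integral along the curve $[0,t]\to X$, $\tau\mapsto h_\tau(x)$, and for $t<0$ it is the integral along the curve $[0,-t]\to X$, $\tau\mapsto h_{-\tau}(x)$. The number $\mathrm{Cat}(X,\xi)$ does not depend on the choice of $\omega$ representing $\xi$. *)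

theory Defs
  imports "HOL-Analysis.Analysis" "HOL-Homology.Homology"
begin

section \<open>Smooth manifolds given by an atlas\<close>

text \<open>A chart is a pair of its domain and its coordinate map. The model space is a finite-dimensional
  normed space \<open>'e\<close>; this class (rather than \<^class>\<open>euclidean_space\<close>) also admits dimension 0.\<close>

type_synonym ('a, 'e) chart = "'a set \<times> ('a \<Rightarrow> 'e)"

abbreviation chart_dom :: "('a, 'e) chart \<Rightarrow> 'a set" where "chart_dom c \<equiv> fst c"
abbreviation coord :: "('a, 'e) chart \<Rightarrow> 'a \<Rightarrow> 'e" where "coord c \<equiv> snd c"

definition chart_inv :: "('a, 'e) chart \<Rightarrow> 'e \<Rightarrow> 'a" where
  "chart_inv c = inv_into (chart_dom c) (coord c)"

text \<open>\<open>C_k k S f\<close>, for an open set \<open>S\<close>: all iterated directional derivatives up to order \<open>k\<close> exist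
  and are continuous on \<open>S\<close>. As the domain is finite-dimensional, this is the usual class \<open>C\<^sup>k\<close>.\<close>

primrec C_k :: "nat \<Rightarrow> 'e::real_normed_vector set \<Rightarrow> ('e \<Rightarrow> 'f::real_normed_vector) \<Rightarrow> bool" where
  "C_k 0 S f \<longleftrightarrow> continuous_on S f"
| "C_k (Suc k) S f \<longleftrightarrow> (\<forall>x\<in>S. f differentiable (at x)) \<and>
     (\<forall>w. C_k k S (\<lambda>x. frechet_derivative f (at x) w))"

definition smooth_on :: "'e::real_normed_vector set \<Rightarrow> ('e \<Rightarrow> 'f::real_normed_vector) \<Rightarrow> bool" where
  "smooth_on S f \<longleftrightarrow> (\<forall>k. C_k k S f)"

definition smooth_atlas :: "'a topology \<Rightarrow> ('a, 'e::real_normed_vector) chart set \<Rightarrow> bool" where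
  "smooth_atlas X A \<longleftrightarrow>
     (\<forall>c\<in>A. openin X (chart_dom c) \<and> open (coord c ` chart_dom c) \<and>
        homeomorphic_map (subtopology X (chart_dom c)) (top_of_set (coord c ` chart_dom c)) (coord c)) \<and>
     (\<Union>c\<in>A. chart_dom c) = topspace X \<and>
     (\<forall>c\<in>A. \<forall>c'\<in>A. smooth_on (coord c ` (chart_dom c \<inter> chart_dom c')) (coord c' \<circ> chart_inv c))"

definition closed_smooth_manifold ::
  "'a topology \<Rightarrow> ('a, 'e::real_normed_vector) chart set \<Rightarrow> bool" where
  "closed_smooth_manifold X A \<longleftrightarrow>
     (\<exists>B::'e set. finite B \<and> span B = UNIV) \<and>
     Hausdorff_space X \<and> compact_space X \<and> smooth_atlas X A"

definition transition_deriv ::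
  "('a, 'e::real_normed_vector) chart \<Rightarrow> ('a, 'e) chart \<Rightarrow> 'a \<Rightarrow> 'e \<Rightarrow> 'e" where
  "transition_deriv c c' m = frechet_derivative (coord c' \<circ> chart_inv c) (at (coord c m))"

definition smooth_function_on ::
  "('a, 'e::real_normed_vector) chart set \<Rightarrow> 'a set \<Rightarrow> ('a \<Rightarrow> real) \<Rightarrow> bool" where
  "smooth_function_on A W f \<longleftrightarrow> (\<forall>c\<in>A. smooth_on (coord c ` (chart_dom c \<inter> W)) (f \<circ> chart_inv c))"

definition differential ::
  "('a \<Rightarrow> real) \<Rightarrow> ('a, 'e::real_normed_vector) chart \<Rightarrow> 'a \<Rightarrow> 'e \<Rightarrow> real" where
  "differential f c m = frechet_derivative (f \<circ> chart_inv c) (at (coord c m))"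


section \<open>Tensor fields\<close>

text \<open>Tensor fields are given by their local expressions: one expression for each chart \<open>c\<close> of the
  atlas, meaningful at the points \<open>m\<close> of the domain of \<open>c\<close>, subject to the transformation law under
  change of charts. A tangent vector at \<open>m\<close> is thus represented by a vector of \<open>'e\<close> in each chart
  around \<open>m\<close>.\<close>

type_synonym ('a, 'e) vfield = "('a, 'e) chart \<Rightarrow> 'a \<Rightarrow> 'e"
type_synonym ('a, 'e) one_form = "('a, 'e) chart \<Rightarrow> 'a \<Rightarrow> 'e \<Rightarrow> real"
type_synonym ('a, 'e) metric_tensor = "('a, 'e) chart \<Rightarrow> 'a \<Rightarrow> 'e \<Rightarrow> 'e \<Rightarrow> real"

definition smooth_vector_field ::
  "('a, 'e::real_normed_vector) chart set \<Rightarrow> ('a, 'e) vfield \<Rightarrow> bool" where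
  "smooth_vector_field A v \<longleftrightarrow>
     (\<forall>c\<in>A. smooth_on (coord c ` chart_dom c) (\<lambda>x. v c (chart_inv c x))) \<and>
     (\<forall>c\<in>A. \<forall>c'\<in>A. \<forall>m\<in>chart_dom c \<inter> chart_dom c'. v c' m = transition_deriv c c' m (v c m))"

definition smooth_one_form ::
  "('a, 'e::real_normed_vector) chart set \<Rightarrow> ('a, 'e) one_form \<Rightarrow> bool" where
  "smooth_one_form A \<omega> \<longleftrightarrow>
     (\<forall>c\<in>A. \<forall>m\<in>chart_dom c. linear (\<omega> c m)) \<and>
     (\<forall>c\<in>A. \<forall>w. smooth_on (coord c ` chart_dom c) (\<lambda>x. \<omega> c (chart_inv c x) w)) \<and>
     (\<forall>c\<in>A. \<forall>c'\<in>A. \<forall>m\<in>chart_dom c \<inter> chart_dom c'. \<forall>w. \<omega> c m w = \<omega> c' m (transition_deriv c c' m w))"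

text \<open>\<open>d\<omega> = 0\<close> in coordinates: \<open>d\<omega>(u, w) = \<partial>\<^sub>u \<omega>(w) - \<partial>\<^sub>w \<omega>(u)\<close> for constant fields \<open>u\<close>, \<open>w\<close>.\<close>

definition smooth_closed_one_form ::
  "('a, 'e::real_normed_vector) chart set \<Rightarrow> ('a, 'e) one_form \<Rightarrow> bool" where
  "smooth_closed_one_form A \<omega> \<longleftrightarrow> smooth_one_form A \<omega> \<and>
     (\<forall>c\<in>A. \<forall>x\<in>coord c ` chart_dom c. \<forall>u w.
        frechet_derivative (\<lambda>y. \<omega> c (chart_inv c y) w) (at x) u =
        frechet_derivative (\<lambda>y. \<omega> c (chart_inv c y) u) (at x) w)"

definition riemannian_metric_on ::
  "('a, 'e::real_normed_vector) chart set \<Rightarrow> 'a set \<Rightarrow> ('a, 'e) metric_tensor \<Rightarrow> bool" where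
  "riemannian_metric_on A W g \<longleftrightarrow>
     (\<forall>c\<in>A. \<forall>m\<in>chart_dom c \<inter> W. bilinear (g c m) \<and> (\<forall>u w. g c m u w = g c m w u) \<and>
        (\<forall>w. w \<noteq> 0 \<longrightarrow> g c m w w > 0)) \<and>
     (\<forall>c\<in>A. \<forall>u w. smooth_on (coord c ` (chart_dom c \<inter> W)) (\<lambda>x. g c (chart_inv c x) u w)) \<and>
     (\<forall>c\<in>A. \<forall>c'\<in>A. \<forall>m\<in>chart_dom c \<inter> chart_dom c' \<inter> W. \<forall>u w.
        g c m u w = g c' m (transition_deriv c c' m u) (transition_deriv c c' m w))"

definition zeros ::
  "'a topology \<Rightarrow> ('a, 'e::real_normed_vector) chart set \<Rightarrow> ('a, 'e) vfield \<Rightarrow> 'a set" where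
  "zeros X A v = {p \<in> topspace X. \<forall>c\<in>A. p \<in> chart_dom c \<longrightarrow> v c p = 0}"


section \<open>Riemannian distance\<close>

definition C1_curve_on :: "'a topology \<Rightarrow> ('a, 'e::real_normed_vector) chart set \<Rightarrow>
    (real \<Rightarrow> 'a) \<Rightarrow> real \<Rightarrow> real \<Rightarrow> bool" where
  "C1_curve_on X A \<gamma> a b \<longleftrightarrow> continuous_map (top_of_set {a..b}) X \<gamma> \<and>
     (\<forall>c\<in>A. (\<forall>t\<in>{a..b}. \<gamma> t \<in> chart_dom c \<longrightarrow> (coord c \<circ> \<gamma>) differentiable (at t within {a..b})) \<and>
        continuous_on {t\<in>{a..b}. \<gamma> t \<in> chart_dom c}
          (\<lambda>t. vector_derivative (coord c \<circ> \<gamma>) (at t within {a..b})))"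

text \<open>The choice of the chart is immaterial, by the transformation law of \<open>g\<close>.\<close>

definition speed :: "('a, 'e::real_normed_vector) chart set \<Rightarrow> ('a, 'e) metric_tensor \<Rightarrow>
    (real \<Rightarrow> 'a) \<Rightarrow> real \<Rightarrow> real \<Rightarrow> real \<Rightarrow> real" where
  "speed A g \<gamma> a b t =
     (let c = (SOME c. c \<in> A \<and> \<gamma> t \<in> chart_dom c);
          w = vector_derivative (coord c \<circ> \<gamma>) (at t within {a..b})
      in sqrt (g c (\<gamma> t) w w))"

definition curve_length :: "('a, 'e::real_normed_vector) chart set \<Rightarrow> ('a, 'e) metric_tensor \<Rightarrow>
    (real \<Rightarrow> 'a) \<Rightarrow> real \<Rightarrow> real \<Rightarrow> real" where
  "curve_length A g \<gamma> a b = integral {a..b} (speed A g \<gamma> a b)"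

text \<open>Infimum of the lengths of the piecewise \<open>C\<^sup>1\<close> curves from \<open>p\<close> to \<open>q\<close>; it is \<open>\<infinity>\<close> for points in
  different components. Each smooth piece uses one-sided derivatives at the break points.\<close>

definition riem_dist :: "'a topology \<Rightarrow> ('a, 'e::real_normed_vector) chart set \<Rightarrow>
    ('a, 'e) metric_tensor \<Rightarrow> 'a \<Rightarrow> 'a \<Rightarrow> ereal" where
  "riem_dist X A g p q =
     Inf {ereal (\<Sum>i<N. curve_length A g \<gamma> (t i) (t (Suc i))) | N (t::nat \<Rightarrow> real) \<gamma>.
        \<gamma> (t 0) = p \<and> \<gamma> (t N) = q \<and>
        (\<forall>i<N. t i < t (Suc i) \<and> C1_curve_on X A \<gamma> (t i) (t (Suc i)))}"


section \<open>Flow and chain recurrence\<close>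

definition integral_curve :: "'a topology \<Rightarrow> ('a, 'e::real_normed_vector) chart set \<Rightarrow>
    ('a, 'e) vfield \<Rightarrow> (real \<Rightarrow> 'a) \<Rightarrow> bool" where
  "integral_curve X A v \<gamma> \<longleftrightarrow> continuous_map euclideanreal X \<gamma> \<and>
     (\<forall>t. \<forall>c\<in>A. \<gamma> t \<in> chart_dom c \<longrightarrow> ((coord c \<circ> \<gamma>) has_vector_derivative v c (\<gamma> t)) (at t))"

text \<open>On a closed manifold, the maximal integral curves are defined on all of \<open>\<real>\<close> and unique.\<close>

definition flow :: "'a topology \<Rightarrow> ('a, 'e::real_normed_vector) chart set \<Rightarrow>
    ('a, 'e) vfield \<Rightarrow> 'a \<Rightarrow> real \<Rightarrow> 'a" where
  "flow X A v m = (THE \<gamma>. integral_curve X A v \<gamma> \<and> \<gamma> 0 = m)"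

definition chain_recurrent_set :: "'a topology \<Rightarrow> ('a, 'e::real_normed_vector) chart set \<Rightarrow>
    ('a, 'e) metric_tensor \<Rightarrow> ('a, 'e) vfield \<Rightarrow> 'a set" where
  "chain_recurrent_set X A g v = {m \<in> topspace X. \<forall>\<delta>>0. \<forall>T>0. \<exists>k (y::nat \<Rightarrow> 'a) (s::nat \<Rightarrow> real).
     (\<forall>j\<le>k. y j \<in> topspace X \<and> s j > T) \<and>
     riem_dist X A g m (y 0) < ereal \<delta> \<and>
     riem_dist X A g (flow X A v (y k) (s k)) m < ereal \<delta> \<and>
     (\<forall>j<k. riem_dist X A g (flow X A v (y j) (s j)) (y (Suc j)) < ereal \<delta>)}"

definition away_set :: "'a topology \<Rightarrow> ('a, 'e::real_normed_vector) chart set \<Rightarrow>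
    ('a, 'e) metric_tensor \<Rightarrow> ('a, 'e) vfield \<Rightarrow> real \<Rightarrow> 'a set" where
  "away_set X A g v \<epsilon> = {m \<in> topspace X. \<forall>t. \<forall>p\<in>zeros X A v.
     riem_dist X A g (flow X A v m t) p > ereal \<epsilon>}"

text \<open>The library's \<^const>\<open>ENR\<close> is for subsets of a fixed Euclidean space; this is its version
  for abstract topological spaces.\<close>

definition ENR_space :: "'a topology \<Rightarrow> bool" where
  "ENR_space X \<longleftrightarrow> (\<exists>n Y U. openin (Euclidean_space n) U \<and>
     Y retract_of_space (subtopology (Euclidean_space n) U) \<and>
     X homeomorphic_space (subtopology (Euclidean_space n) Y))"


section \<open>Lyapunov 1-forms\<close>

definition lyapunov_one_form :: "'a topology \<Rightarrow> ('a, 'e::real_normed_vector) chart set \<Rightarrow>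
    ('a, 'e) vfield \<Rightarrow> ('a, 'e) one_form \<Rightarrow> bool" where
  "lyapunov_one_form X A v \<omega> \<longleftrightarrow> smooth_closed_one_form A \<omega> \<and>
     (\<forall>m\<in>topspace X - zeros X A v. \<forall>c\<in>A. m \<in> chart_dom c \<longrightarrow> \<omega> c m (v c m) > 0) \<and>
     (\<forall>p\<in>zeros X A v. \<exists>U f h. openin X U \<and> p \<in> U \<and> smooth_function_on A U f \<and>
        riemannian_metric_on A U h \<and>
        (\<forall>c\<in>A. \<forall>m\<in>chart_dom c \<inter> U. \<forall>w. \<omega> c m w = differential f c m w \<and>
           h c m (v c m) w = differential f c m w))"


section \<open>Continuous closed 1-forms and their cohomology classes\<close>

text \<open>A pair of an open cover and a family of functions indexed by it.\<close>

type_synonym 'a cform = "'a set set \<times> ('a set \<Rightarrow> 'a \<Rightarrow> real)"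

definition locally_constant_on :: "'a topology \<Rightarrow> 'a set \<Rightarrow> ('a \<Rightarrow> real) \<Rightarrow> bool" where
  "locally_constant_on X W h \<longleftrightarrow>
     (\<forall>x\<in>W. \<exists>N. openin (subtopology X W) N \<and> x \<in> N \<and> (\<forall>y\<in>N. h y = h x))"

definition continuous_closed_one_form :: "'a topology \<Rightarrow> 'a cform \<Rightarrow> bool" where
  "continuous_closed_one_form X = (\<lambda>(\<U>, f).
     (\<forall>U\<in>\<U>. openin X U \<and> continuous_map (subtopology X U) euclideanreal (f U)) \<and>
     \<Union>\<U> = topspace X \<and>
     (\<forall>U\<in>\<U>. \<forall>V\<in>\<U>. locally_constant_on X (U \<inter> V) (\<lambda>x. f U x - f V x)))"

definition is_line_integral :: "'a cform \<Rightarrow> real \<Rightarrow> real \<Rightarrow> (real \<Rightarrow> 'a) \<Rightarrow> real \<Rightarrow> bool" where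
  "is_line_integral = (\<lambda>(\<U>, f) a b \<gamma> I. \<exists>N (t::nat \<Rightarrow> real) U.
     t 0 = a \<and> t N = b \<and>
     (\<forall>i<N. t i < t (Suc i) \<and> U i \<in> \<U> \<and> \<gamma> ` {t i..t (Suc i)} \<subseteq> U i) \<and>
     I = (\<Sum>i<N. f (U i) (\<gamma> (t (Suc i))) - f (U i) (\<gamma> (t i))))"

definition line_integral :: "'a cform \<Rightarrow> real \<Rightarrow> real \<Rightarrow> (real \<Rightarrow> 'a) \<Rightarrow> real" where
  "line_integral \<theta> a b \<gamma> = (THE I. is_line_integral \<theta> a b \<gamma> I)"

definition real_add_group :: "real monoid" where
  "real_add_group = \<lparr>carrier = UNIV, monoid.mult = (+), one = 0\<rparr>"

text \<open>\<open>H\<^sup>1(X; \<real>) = Hom(H\<^sub>1(X), \<real>)\<close>.\<close>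

definition H1_real :: "'a topology \<Rightarrow> ('a chain set \<Rightarrow> real) set" where
  "H1_real X = hom (homology_group 1 X) real_add_group"

text \<open>The homology class of a loop \<open>\<gamma> : [0, 1] \<rightarrow> X\<close>, seen as a singular 1-simplex by means of the
  barycentric coordinate of the second vertex.\<close>

definition loop_class :: "'a topology \<Rightarrow> (real \<Rightarrow> 'a) \<Rightarrow> 'a chain set" where
  "loop_class X \<gamma> = homologous_rel_set 1 X {}
     (frag_of (restrict (\<lambda>x. \<gamma> (x 1)) (standard_simplex 1)))"

definition represents :: "'a topology \<Rightarrow> 'a cform \<Rightarrow> ('a chain set \<Rightarrow> real) \<Rightarrow> bool" where
  "represents X \<theta> \<xi> \<longleftrightarrow> continuous_closed_one_form X \<theta> \<and> \<xi> \<in> H1_real X \<and>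
     (\<forall>\<gamma>. pathin X \<gamma> \<and> \<gamma> 0 = \<gamma> 1 \<longrightarrow> \<xi> (loop_class X \<gamma>) = line_integral \<theta> 0 1 \<gamma>)"

text \<open>A smooth closed 1-form is viewed as a continuous one by taking local primitives.\<close>

definition local_primitives :: "'a topology \<Rightarrow> ('a, 'e::real_normed_vector) chart set \<Rightarrow>
    ('a, 'e) one_form \<Rightarrow> 'a cform \<Rightarrow> bool" where
  "local_primitives X A \<omega> = (\<lambda>(\<U>, f). \<Union>\<U> = topspace X \<and>
     (\<forall>U\<in>\<U>. openin X U \<and> smooth_function_on A U (f U) \<and>
        (\<forall>c\<in>A. \<forall>m\<in>chart_dom c \<inter> U. \<forall>w. \<omega> c m w = differential (f U) c m w)))"

definition smooth_represents :: "'a topology \<Rightarrow> ('a, 'e::real_normed_vector) chart set \<Rightarrow>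
    ('a, 'e) one_form \<Rightarrow> ('a chain set \<Rightarrow> real) \<Rightarrow> bool" where
  "smooth_represents X A \<omega> \<xi> \<longleftrightarrow> (\<exists>\<theta>. local_primitives X A \<omega> \<theta> \<and> represents X \<theta> \<xi>)"


section \<open>The category of a space with respect to a cohomology class\<close>

definition null_homotopic_in :: "'a topology \<Rightarrow> 'a set \<Rightarrow> bool" where
  "null_homotopic_in X F \<longleftrightarrow>
     (\<exists>a. homotopic_with (\<lambda>_. True) (subtopology X F) X (\<lambda>x. x) (\<lambda>_. a))"

definition movable :: "'a topology \<Rightarrow> 'a cform \<Rightarrow> 'a set \<Rightarrow> bool" where
  "movable X \<theta> F \<longleftrightarrow> (\<exists>h :: real \<Rightarrow> 'a \<Rightarrow> 'a.
     continuous_map (prod_topology euclideanreal (subtopology X F)) X (\<lambda>(t, x). h t x) \<and>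
     (\<forall>x\<in>F. h 0 x = x) \<and>
     (\<forall>n::nat. n > 0 \<longrightarrow> (\<exists>N>0. \<forall>x\<in>F.
        (\<forall>t>N. line_integral \<theta> 0 t (\<lambda>\<tau>. h \<tau> x) > real n) \<and>
        (\<forall>t. t < - N \<longrightarrow> line_integral \<theta> 0 (-t) (\<lambda>\<tau>. h (-\<tau>) x) < - real n))))"

definition cat_cover :: "'a topology \<Rightarrow> 'a cform \<Rightarrow> nat \<Rightarrow> bool" where
  "cat_cover X \<theta> k \<longleftrightarrow> (\<exists>F G. openin X F \<and> (\<forall>j\<in>{1..k}. openin X (G j)) \<and>
     topspace X = F \<union> (\<Union>j\<in>{1..k}. G j) \<and>
     (\<forall>j\<in>{1..k}. null_homotopic_in X (G j)) \<and> movable X \<theta> F)"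

text \<open>The least \<open>k\<close> for a fixed representative of \<open>\<xi>\<close>; it does not depend on the representative when
  \<open>X\<close> is a finite CW-complex. The value would be \<open>\<infinity>\<close> if there were no such \<open>k\<close>.\<close>

definition Cat :: "'a topology \<Rightarrow> ('a chain set \<Rightarrow> real) \<Rightarrow> enat" where
  "Cat X \<xi> = (let \<theta> = (SOME \<theta>. represents X \<theta> \<xi>) in Inf {enat k | k. cat_cover X \<theta> k})"

definition number_of_elements :: "'a set \<Rightarrow> enat" where
  "number_of_elements Z = (if finite Z then enat (card Z) else \<infinity>)"

end

theory Submission
  imports Defs
begin

text \<open>The manifold is covered by the basins of the zeros and by a neighbourhood of the compact
  invariant set \<open>C\<close> of points whose trajectories avoid small balls around the zeros. Since a zero \<open>p\<close>
  is isolated in the chain recurrent set, a trajectory that passes close to \<open>p\<close> and leaves a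
  coordinate ball around \<open>p\<close> never comes back close to \<open>p\<close>. Hence the times spent near \<open>p\<close> form an interval up to
  staying inside a coordinate ball, averaging them moves the basin of \<open>p\<close> into this ball
  continuously, and the basin is contractible in \<open>M\<close>. The set \<open>C\<close> lies in an ENR \<open>U\<^sub>\<epsilon>\<close>, so a neighbourhood
  of \<open>C\<close> is deformed into \<open>U\<^sub>\<epsilon>\<close> by a homotopy along which the integrals of the Lyapunov form are
  bounded; from there the flow makes the integrals grow at least linearly, because \<open>\<omega>(v)\<close> is
  bounded below away from the zeros. Replacing the Lyapunov form by another representative of its
  class changes all path integrals by a bounded amount only.\<close>

section \<open>Finite-dimensional normed spaces\<close>

text \<open>Two obstacles come from the definitions. The model space is only a real normed space
  with a finite spanning set, so compact balls and solutions of differential equations have to be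
  drawn from a basis. And \<open>chain_recurrent_set\<close> and \<open>away_set\<close> are phrased
  through \<open>riem_dist\<close> and the descriptively defined \<open>flow\<close>; before the
  hypotheses become usable, the flow has to be constructed for all times and the distance compared
  with the topology of \<open>M\<close> in both directions. Each zero gets two radii, because a mean
  of visiting times need not be a visiting time: the return property then only places the trajectory
  in the larger ball, which still is a chart ball and can be shrunk to a point. The cover needs an
  open movable set, while \<open>C\<close> is merely closed and points arbitrarily close to it may
  run into zeros. So the flow alone cannot move a neighbourhood of \<open>C\<close>; a deformation
  with controlled integrals has to precede it.\<close>

lemma compact_coefficient_box:
  fixes B :: "'e::real_normed_vector set"
  assumes "finite B"
  shows "compact {\<Sum>b\<in>B. c b *\<^sub>R b | c. \<forall>b\<in>B. \<bar>c b\<bar> \<le> R}"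
  using assms
proof (induction B)
  case empty
  then show ?case by simp
next
  case (insert a B)
  let ?K = "{\<Sum>b\<in>B. c b *\<^sub>R b | c. \<forall>b\<in>B. \<bar>c b\<bar> \<le> R}"
  let ?L = "(\<lambda>t. t *\<^sub>R a) ` {-R..R}"
  have "compact ?L"
    by (intro compact_continuous_image continuous_intros compact_Icc)
  \<comment> \<open>Adjoining \<open>a\<close> adds the segment \<open>?L\<close> as a Minkowski
    sum, and a sum of compact sets is compact.\<close>
  moreover have "{\<Sum>b\<in>insert a B. c b *\<^sub>R b | c. \<forall>b\<in>insert a B. \<bar>c b\<bar> \<le> R} = {x + y | x y. x \<in> ?L \<and> y \<in> ?K}"
  proof (intro equalityI subsetI)
    fix z assume "z \<in> {\<Sum>b\<in>insert a B. c b *\<^sub>R b | c. \<forall>b\<in>insert a B. \<bar>c b\<bar> \<le> R}"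
    then obtain c where c: "z = (\<Sum>b\<in>insert a B. c b *\<^sub>R b)" "\<forall>b\<in>insert a B. \<bar>c b\<bar> \<le> R" by blast
    have "z = c a *\<^sub>R a + (\<Sum>b\<in>B. c b *\<^sub>R b)" using c insert by simp
    moreover have "c a *\<^sub>R a \<in> ?L" using c by (auto simp: abs_le_iff)
    moreover have "(\<Sum>b\<in>B. c b *\<^sub>R b) \<in> ?K" using c by auto
    ultimately show "z \<in> {x + y | x y. x \<in> ?L \<and> y \<in> ?K}" by blast
  next
    fix z assume "z \<in> {x + y | x y. x \<in> ?L \<and> y \<in> ?K}"
    then obtain t c where t: "z = t *\<^sub>R a + (\<Sum>b\<in>B. c b *\<^sub>R b)" "-R \<le> t" "t \<le> R" "\<forall>b\<in>B. \<bar>c b\<bar> \<le> R"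
      by auto
    define c' where "c' = c(a := t)"
    have "(\<Sum>b\<in>B. c b *\<^sub>R b) = (\<Sum>b\<in>B. c' b *\<^sub>R b)"
      by (rule sum.cong) (use insert in \<open>auto simp: c'_def\<close>)
    then have "z = (\<Sum>b\<in>insert a B. c' b *\<^sub>R b)" using t insert by (simp add: c'_def)
    moreover have "\<forall>b\<in>insert a B. \<bar>c' b\<bar> \<le> R" using t by (auto simp: c'_def)
    ultimately show "z \<in> {\<Sum>b\<in>insert a B. c b *\<^sub>R b | c. \<forall>b\<in>insert a B. \<bar>c b\<bar> \<le> R}" by blast
  qed
  ultimately show ?case using compact_sums[OF _ insert.IH] by simp
qed

text \<open>Induction on the basis. When \<open>a\<close> is adjoined, \<open>- a\<close> has
  positive distance from a compact box of combinations of \<open>B\<close>, which bounds the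
  coefficient of \<open>a\<close>; subtracting that term bounds the others by the induction
  hypothesis.\<close>

lemma coefficients_bounded:
  fixes B :: "'e::real_normed_vector set"
  assumes "finite B" "independent B"
  shows "\<exists>C\<ge>0. \<forall>c. \<forall>b\<in>B. \<bar>c b\<bar> \<le> C * norm (\<Sum>b\<in>B. c b *\<^sub>R b)"
  using assms
proof (induction B)
  case empty
  then show ?case by auto
next
  case (insert a B)
  then have indB: "independent B" and na: "a \<notin> span B"
    by (auto simp: independent_insert)
  then obtain C where C: "C \<ge> 0" "\<And>c b. b \<in> B \<Longrightarrow> \<bar>c b\<bar> \<le> C * norm (\<Sum>b\<in>B. c b *\<^sub>R b)"
    using insert by blast
  \<comment> \<open>By the induction hypothesis this box contains every combination of
    \<open>B\<close> of norm at most \<open>norm a + 1\<close>, hence every one within distance 1 of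
    \<open>- a\<close>; that is why \<open>e\<close> is capped at 1.\<close>
  define K where "K = {\<Sum>b\<in>B. c b *\<^sub>R b | c. \<forall>b\<in>B. \<bar>c b\<bar> \<le> C * (norm a + 1)}"
  have "closed K"
    using compact_coefficient_box[OF insert.hyps(1)] compact_imp_closed unfolding K_def by blast
  moreover have "- a \<notin> K"
  proof
    assume "- a \<in> K"
    then have "- a \<in> span B" unfolding K_def by (auto intro!: span_sum span_scale intro: span_base)
    then show False using na span_neg by fastforce
  qed
  ultimately obtain d where "d > 0" "ball (-a) d \<subseteq> - K"
    using openE[OF open_Compl ComplI] by metis
  then have d: "d > 0" "ball (-a) d \<inter> K = {}" by (auto simp only: disjoint_eq_subset_Compl)
  define e where "e = min d 1"
  have e: "0 < e" "e \<le> 1" "e \<le> d" using d by (auto simp: e_def)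
  have far: "norm (a + (\<Sum>b\<in>B. c b *\<^sub>R b)) \<ge> e" for c
  proof (rule ccontr)
    let ?y = "\<Sum>b\<in>B. c b *\<^sub>R b"
    assume "\<not> ?thesis"
    then have lt: "norm (a + ?y) < e" by simp
    have "norm ?y \<le> norm a + norm (a + ?y)"
      using norm_triangle_ineq4[of "a + ?y" a] by simp
    then have "norm ?y \<le> norm a + 1" using lt e by linarith
    then have "\<forall>b\<in>B. \<bar>c b\<bar> \<le> C * (norm a + 1)"
      using C(2)[of _ c] mult_left_mono[of "norm ?y" "norm a + 1" C] C(1) order_trans by blast
    then have "?y \<in> K" unfolding K_def by blast
    moreover have "?y \<in> ball (-a) d"
      using lt e by (simp add: dist_norm norm_minus_commute[of "-a"] add.commute)
    ultimately show False using d by blast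
  qed
  have ca: "\<bar>c a\<bar> \<le> (1/e) * norm (\<Sum>b\<in>insert a B. c b *\<^sub>R b)" for c
  proof (cases "c a = 0")
    case True
    then show ?thesis using e by simp
  next
    case False
    have "(\<Sum>b\<in>insert a B. c b *\<^sub>R b) = c a *\<^sub>R (a + (\<Sum>b\<in>B. (c b / c a) *\<^sub>R b))"
      using insert False by (simp add: scaleR_right_distrib scaleR_sum_right)
    then have "norm (\<Sum>b\<in>insert a B. c b *\<^sub>R b) \<ge> \<bar>c a\<bar> * e"
      using far[of "\<lambda>b. c b / c a"] by (simp add: mult_left_mono)
    then show ?thesis using e by (simp add: field_simps)
  qed
  \<comment> \<open>\<open>1/e\<close> serves the vector \<open>a\<close>. For a vector of
    \<open>B\<close>, the constant \<open>C\<close> acts on the sum without its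
    \<open>a\<close>-term, whose norm grows by at most the factor
    \<open>1 + norm a / e\<close>.\<close>
  define D where "D = 1/e + C * (1 + norm a / e)"
  have "\<bar>c b\<bar> \<le> D * norm (\<Sum>b\<in>insert a B. c b *\<^sub>R b)" if "b \<in> insert a B" for c b
  proof -
    let ?S = "\<Sum>b\<in>insert a B. c b *\<^sub>R b"
    have e': "1/e \<ge> 0" "C * (1 + norm a / e) \<ge> 0" using e C by auto
    show ?thesis
    proof (cases "b = a")
      case True
      have "(1/e) * norm ?S \<le> D * norm ?S" using e' unfolding D_def by (intro mult_right_mono) auto
      then show ?thesis using ca[of c] unfolding True by linarith
    next
      case False
      then have "\<bar>c b\<bar> \<le> C * norm (\<Sum>b\<in>B. c b *\<^sub>R b)" using C(2) that by blast
      also have "(\<Sum>b\<in>B. c b *\<^sub>R b) = ?S - c a *\<^sub>R a" using insert by simp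
      also have "norm (?S - c a *\<^sub>R a) \<le> norm ?S + \<bar>c a\<bar> * norm a"
        by (metis norm_scaleR norm_triangle_ineq4)
      also have "\<dots> \<le> norm ?S + ((1/e) * norm ?S) * norm a"
        by (intro add_left_mono mult_right_mono ca) auto
      also have "\<dots> = (1 + norm a / e) * norm ?S" by (simp add: algebra_simps)
      finally have "\<bar>c b\<bar> \<le> C * ((1 + norm a / e) * norm ?S)"
        using C(1) by (simp add: mult_left_mono)
      also have "\<dots> \<le> D * norm ?S" using e' unfolding D_def mult.assoc[symmetric] by (intro mult_right_mono) auto
      finally show ?thesis .
    qed
  qed
  moreover have "D \<ge> 0" using e C by (simp add: D_def)
  ultimately show ?case by blast
qed

text \<open>The class of the model space leaves the dimension open, so finiteness is carried by a
  locale; a manifold later provides the spanning set.\<close>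

locale finite_dimensional =
  fixes B0 :: "'e::real_normed_vector set"
  assumes finite_B0: "finite B0" and span_B0: "span B0 = (UNIV :: 'e set)"
begin

section \<open>Coordinates with respect to a basis\<close>

definition basis :: "'e set" where
  "basis = (SOME B. B \<subseteq> B0 \<and> independent B \<and> B0 \<subseteq> span B)"

lemma basis: "basis \<subseteq> B0" "independent basis" "B0 \<subseteq> span basis"
proof -
  obtain B where "B \<subseteq> B0" "independent B" "B0 \<subseteq> span B"
    using maximal_independent_subset[of B0] by blast
  then have "basis \<subseteq> B0 \<and> independent basis \<and> B0 \<subseteq> span basis"
    unfolding basis_def
    using someI[of "\<lambda>B. B \<subseteq> B0 \<and> independent B \<and> B0 \<subseteq> span B" B] by blast
  then show "basis \<subseteq> B0" "independent basis" "B0 \<subseteq> span basis" by auto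
qed

lemma finite_basis: "finite basis"
  using basis(1) finite_B0 finite_subset by blast

lemma span_basis: "span basis = UNIV"
  using span_mono[OF basis(3)] span_B0 by (auto simp: span_span)

definition coef :: "'e \<Rightarrow> 'e \<Rightarrow> real" where
  "coef b x = representation basis x b"

lemma sum_coef: "(\<Sum>b\<in>basis. coef b x *\<^sub>R b) = x"
  unfolding coef_def
  by (rule sum_representation_eq) (auto simp: basis span_basis finite_basis)

lemma coef_add: "coef b (x + y) = coef b x + coef b y"
  unfolding coef_def using representation_add[OF basis(2)] span_basis by auto

lemma coef_scale: "coef b (r *\<^sub>R x) = r * coef b x"
  unfolding coef_def using representation_scale[OF basis(2)] span_basis by auto

lemma coef_bound: "\<exists>C>0. \<forall>x. \<forall>b\<in>basis. \<bar>coef b x\<bar> \<le> C * norm x"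
proof -
  obtain C where C: "C \<ge> 0" "\<And>c b. b \<in> basis \<Longrightarrow> \<bar>c b\<bar> \<le> C * norm (\<Sum>b\<in>basis. c b *\<^sub>R b)"
    using coefficients_bounded[OF finite_basis basis(2)] by blast
  have "\<bar>coef b x\<bar> \<le> (C + 1) * norm x" if "b \<in> basis" for b x
    using C(2)[OF that, of "\<lambda>b. coef b x"]
    unfolding sum_coef by (simp add: distrib_right add_increasing2)
  then show ?thesis using C(1) by (intro exI[of _ "C + 1"]) auto
qed

lemma bounded_linear_coef: "b \<in> basis \<Longrightarrow> bounded_linear (coef b)"
proof -
  assume "b \<in> basis"
  then obtain C where "\<forall>x. \<bar>coef b x\<bar> \<le> C * norm x" using coef_bound by blast
  then show ?thesis
    by (intro bounded_linear_intro[where K = C]) (auto simp: coef_add coef_scale mult.commute)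
qed

lemma linear_expand: "linear f \<Longrightarrow> f x = (\<Sum>b\<in>basis. coef b x *\<^sub>R f b)"
  by (subst sum_coef[of x, symmetric]) (simp add: linear_sum linear_scale)

text \<open>A closed ball is a closed subset of a coefficient box, by the bound on the
  coordinates.\<close>

lemma fd_compact_cball: "compact (cball (x::'e) r)"
proof -
  obtain C where C: "C > 0" "\<And>x b. b \<in> basis \<Longrightarrow> \<bar>coef b x\<bar> \<le> C * norm x"
    using coef_bound by blast
  let ?K = "{\<Sum>b\<in>basis. c b *\<^sub>R b | c. \<forall>b\<in>basis. \<bar>c b\<bar> \<le> C * (norm x + \<bar>r\<bar>)}"
  have "compact ?K" by (rule compact_coefficient_box[OF finite_basis])
  moreover have "cball x r \<subseteq> ?K"
  proof
    fix y assume "y \<in> cball x r"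
    then have "norm y \<le> norm x + \<bar>r\<bar>"
      using norm_triangle_ineq3[of y x] by (auto simp: dist_norm norm_minus_commute)
    then have "\<bar>coef b y\<bar> \<le> C * (norm x + \<bar>r\<bar>)" if "b \<in> basis" for b
      using C(2)[OF that, of y] mult_left_mono[of "norm y" "norm x + \<bar>r\<bar>" C] C(1) by linarith
    then have "\<forall>b\<in>basis. \<bar>coef b y\<bar> \<le> C * (norm x + \<bar>r\<bar>)" by blast
    then show "y \<in> ?K" using sum_coef[of y, symmetric]
      by (intro CollectI exI[of _ "\<lambda>b. coef b y"] conjI)
  qed
  ultimately have "compact (?K \<inter> cball x r)" "?K \<inter> cball x r = cball x r"
    using compact_Int_closed[OF _ closed_cball] by blast+
  then show ?thesis by simp
qed

text \<open>Smoothness of forms and metrics is required for constant arguments only. Expanding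
  \<open>u y\<close> in the basis reduces a varying argument to finitely many constant ones.\<close>

lemma continuous_on_linear_apply:
  fixes h :: "'x::topological_space \<Rightarrow> 'e \<Rightarrow> 'f::real_normed_vector"
  assumes "\<And>y. y \<in> T \<Longrightarrow> linear (h y)" "\<And>w. continuous_on T (\<lambda>y. h y w)" "continuous_on T u"
  shows "continuous_on T (\<lambda>y. h y (u y))"
proof -
  have "continuous_on T (\<lambda>y. \<Sum>b\<in>basis. coef b (u y) *\<^sub>R h y b)"
    by (intro continuous_intros assms bounded_linear.continuous_on[OF bounded_linear_coef])
  then show ?thesis
    by (rule continuous_on_eq) (rule linear_expand[OF assms(1), symmetric])
qed

text \<open>A real normed space that is finite-dimensional need not live in a Banach type; it is a
  retract of the Banach space \<^typ>\<open>real \<Rightarrow>\<^sub>C real\<close>, where Picard iteration is available.\<close>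

lemma banach_embedding:
  obtains \<iota> :: "'e \<Rightarrow> (real \<Rightarrow>\<^sub>C real)" and \<pi> :: "(real \<Rightarrow>\<^sub>C real) \<Rightarrow> 'e"
  where "bounded_linear \<iota>" "bounded_linear \<pi>" "\<And>x. \<pi> (\<iota> x) = x"
proof -
  obtain e :: "'e \<Rightarrow> nat" where e: "inj_on e basis"
    using finite_imp_inj_to_nat_seg[OF finite_basis] by blast
  \<comment> \<open>Tent functions centred at the integers. At an integer they give the Kronecker
    delta, so evaluation at \<open>e b\<close> recovers the coordinate along \<open>b\<close>; they
    are bounded and continuous, as \<open>bcontfun\<close> demands.\<close>
  define hat where "hat n t = max 0 (1 - \<bar>t - real n\<bar>)" for n and t :: real
  have hat: "0 \<le> hat n t" "hat n t \<le> 1" "hat n (real m) = (if n = m then 1 else 0)" for n t m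
    by (auto simp: hat_def)
  define s where "s x t = (\<Sum>b\<in>basis. coef b x * hat (e b) t)" for x t
  obtain C where C: "C > 0" "\<And>x b. b \<in> basis \<Longrightarrow> \<bar>coef b x\<bar> \<le> C * norm x"
    using coef_bound by blast
  let ?D = "real (card basis) * C"
  have sb: "\<bar>s x i\<bar> \<le> norm x * ?D" for x i
  proof -
    have "\<bar>s x i\<bar> \<le> (\<Sum>b\<in>basis. \<bar>coef b x * hat (e b) i\<bar>)"
      unfolding s_def by (rule sum_abs)
    also have "\<dots> \<le> (\<Sum>b\<in>basis. C * norm x)"
    proof (intro sum_mono)
      fix b assume "b \<in> basis"
      then have "\<bar>coef b x\<bar> * hat (e b) i \<le> (C * norm x) * 1"
        using C hat by (intro mult_mono) auto
      then show "\<bar>coef b x * hat (e b) i\<bar> \<le> C * norm x"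
        using hat(1)[of "e b" i] by (simp add: abs_mult)
    qed
    finally show ?thesis by (simp add: algebra_simps)
  qed
  have sbc: "s x \<in> bcontfun" for x
    using sb[of x] by (auto simp: bcontfun_def bounded_iff s_def hat_def intro!: continuous_intros)
  define \<iota> where "\<iota> x = Bcontfun (s x)" for x
  have ap: "apply_bcontfun (\<iota> x) = s x" for x
    unfolding \<iota>_def using sbc by (rule Bcontfun_inverse)
  define \<pi> :: "(real \<Rightarrow>\<^sub>C real) \<Rightarrow> 'e" where "\<pi> f = (\<Sum>b\<in>basis. apply_bcontfun f (real (e b)) *\<^sub>R b)" for f
  have ev: "bounded_linear (\<lambda>f::real \<Rightarrow>\<^sub>C real. apply_bcontfun f i)" for i
    by (rule bounded_linear_intro[where K = 1]) (use norm_bounded in \<open>auto simp: norm_bounded[where 'b=real, unfolded real_norm_def]\<close>)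
  have "bounded_linear \<iota>"
  proof (rule bounded_linear_intro[where K = ?D])
    show "\<iota> (x + y) = \<iota> x + \<iota> y" for x y
      by (rule bcontfun_eqI) (auto simp: ap s_def coef_add sum.distrib[symmetric] distrib_right intro!: sum.cong)
    show "\<iota> (r *\<^sub>R x) = r *\<^sub>R \<iota> x" for r x
      by (rule bcontfun_eqI) (auto simp: ap s_def coef_scale sum_distrib_left mult.assoc intro!: sum.cong)
    show "norm (\<iota> x) \<le> norm x * ?D" for x
      by (rule norm_bound) (use sb in \<open>auto simp: ap\<close>)
  qed
  moreover have "bounded_linear \<pi>"
    unfolding \<pi>_def by (intro bounded_linear_sum bounded_linear_scaleR_const ev)
  moreover have "\<pi> (\<iota> x) = x" for x
  proof -
    have "s x (real (e b)) = coef b x" if "b \<in> basis" for b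
    proof -
      have "s x (real (e b)) = (\<Sum>b'\<in>basis. if b = b' then coef b' x else 0)"
        unfolding s_def by (rule sum.cong) (use e that in \<open>auto simp: inj_on_def hat\<close>)
      then show ?thesis using that finite_basis by simp
    qed
    then show ?thesis by (simp add: \<pi>_def ap sum_coef)
  qed
  ultimately show ?thesis using that by blast
qed

section \<open>First-order consequences of smoothness\<close>

lemma smooth_on_imp_derivative:
  assumes "smooth_on S f" "x \<in> S"
  shows "(f has_derivative frechet_derivative f (at x)) (at x)"
proof -
  have "C_k (Suc 0) S f" using assms smooth_on_def by blast
  then show ?thesis using assms(2) by (simp add: frechet_derivative_works)
qed

lemma smooth_on_imp_continuous_on: "smooth_on S f \<Longrightarrow> continuous_on S f"
  unfolding smooth_on_def using C_k.simps(1) by blast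

lemma smooth_on_imp_continuous_derivative:
  assumes "smooth_on S (f :: 'e \<Rightarrow> 'f::real_normed_vector)"
  shows "continuous_on S (\<lambda>x. frechet_derivative f (at x) w)"
proof -
  have "C_k (Suc 0) S f" using assms smooth_on_def by blast
  then show ?thesis by simp
qed

lemma smooth_on_imp_linear_derivative:
  "smooth_on S (f :: 'e \<Rightarrow> 'f::real_normed_vector) \<Longrightarrow> x \<in> S \<Longrightarrow> linear (frechet_derivative f (at x))"
  using smooth_on_imp_derivative has_derivative_linear by blast

text \<open>Mean value inequality on a convex ball. The operator norm of the derivative is bounded
  there, since its values on the finitely many basis vectors are continuous on a compact
  set.\<close>

lemma smooth_on_imp_lipschitz_cball:
  fixes f :: "'e \<Rightarrow> 'f::real_normed_vector"
  assumes "smooth_on S f" "cball x r \<subseteq> S"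
  shows "\<exists>L>0. \<forall>y\<in>cball x r. \<forall>z\<in>cball x r. norm (f y - f z) \<le> L * norm (y - z)"
proof -
  obtain C where C: "C > 0" "\<And>x b. b \<in> basis \<Longrightarrow> \<bar>coef b x\<bar> \<le> C * norm x"
    using coef_bound by blast
  have "\<exists>D. \<forall>y\<in>cball x r. norm (frechet_derivative f (at y) b) \<le> D" for b
  proof -
    have "continuous_on (cball x r) (\<lambda>y. frechet_derivative f (at y) b)"
      using smooth_on_imp_continuous_derivative[OF assms(1)] assms(2) continuous_on_subset by blast
    then have "compact ((\<lambda>y. frechet_derivative f (at y) b) ` cball x r)"
      using fd_compact_cball compact_continuous_image by blast
    then have "bounded ((\<lambda>y. frechet_derivative f (at y) b) ` cball x r)"
      by (rule compact_imp_bounded)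
    then show ?thesis unfolding bounded_iff by blast
  qed
  then obtain D where D: "\<And>b y. y \<in> cball x r \<Longrightarrow> norm (frechet_derivative f (at y) b) \<le> D b"
    by metis
  \<comment> \<open>The summand 1 keeps \<open>L\<close> positive even when the basis is empty or
    all the bounds \<open>D b\<close> vanish.\<close>
  define L where "L = (\<Sum>b\<in>basis. C * \<bar>D b\<bar>) + 1"
  have "L > 0" using C(1) unfolding L_def by (intro add_nonneg_pos sum_nonneg) auto
  have onL: "onorm (frechet_derivative f (at y)) \<le> L" if y: "y \<in> cball x r" for y
  proof (rule onorm_bound)
    show "0 \<le> L" using \<open>L > 0\<close> by simp
    fix w
    have "linear (frechet_derivative f (at y))"
      using smooth_on_imp_linear_derivative[OF assms(1)] assms(2) y by blast
    then have "norm (frechet_derivative f (at y) w) = norm (\<Sum>b\<in>basis. coef b w *\<^sub>R frechet_derivative f (at y) b)"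
      using linear_expand by metis
    also have "\<dots> \<le> (\<Sum>b\<in>basis. norm (coef b w *\<^sub>R frechet_derivative f (at y) b))"
      by (rule norm_sum)
    also have "\<dots> \<le> (\<Sum>b\<in>basis. (C * norm w) * \<bar>D b\<bar>)"
    proof (intro sum_mono)
      fix b assume "b \<in> basis"
      then show "norm (coef b w *\<^sub>R frechet_derivative f (at y) b) \<le> (C * norm w) * \<bar>D b\<bar>"
        using C(2)[of b w] D[OF y, of b] C(1) by (auto intro!: mult_mono)
    qed
    also have "\<dots> = (L - 1) * norm w"
      unfolding L_def by (simp add: sum_distrib_left sum_distrib_right ac_simps)
    also have "\<dots> \<le> L * norm w"
      by (simp add: mult_right_mono)
    finally show "norm (frechet_derivative f (at y) w) \<le> L * norm w" .
  qed
  have "norm (f y - f z) \<le> L * norm (y - z)" if "y \<in> cball x r" "z \<in> cball x r" for y z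
  proof (rule differentiable_bound[where S = "cball x r" and f' = "\<lambda>y. frechet_derivative f (at y)"])
    show "convex (cball x r)" by simp
    fix u assume u: "u \<in> cball x r"
    show "(f has_derivative frechet_derivative f (at u)) (at u within cball x r)"
      using smooth_on_imp_derivative[OF assms(1)] u assms(2) has_derivative_at_withinI by blast
    show "onorm (frechet_derivative f (at u)) \<le> L" using onL[OF u] .
  qed (use that in auto)
  then show ?thesis using \<open>L > 0\<close> by blast
qed

end

section \<open>Ordinary differential equations\<close>

text \<open>Makes \<open>picard_lindeloef\<close> applicable in the space into which
  \<open>banach_embedding\<close> maps.\<close>

instance bcontfun :: (metric_space, banach) banach ..

lemma has_vector_derivative_imp_lipschitz:
  fixes f :: "real \<Rightarrow> 'b::real_normed_vector"
  assumes "convex S" "\<And>t. t \<in> S \<Longrightarrow> (f has_vector_derivative f' t) (at t within S)"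
    and "\<And>t. t \<in> S \<Longrightarrow> norm (f' t) \<le> B" "x \<in> S" "y \<in> S"
  shows "norm (f x - f y) \<le> B * \<bar>x - y\<bar>"
proof -
  have "norm (f x - f y) \<le> B * norm (x - y)"
  proof (rule differentiable_bound[where S = S and f' = "\<lambda>t h. h *\<^sub>R f' t"])
    fix t assume t: "t \<in> S"
    show "(f has_derivative (\<lambda>h. h *\<^sub>R f' t)) (at t within S)"
      using assms(2)[OF t] by (simp add: has_vector_derivative_def)
    show "onorm (\<lambda>h. h *\<^sub>R f' t) \<le> B"
    proof (rule onorm_bound)
      show "0 \<le> B" using assms(3)[OF t] norm_ge_zero order_trans by blast
      show "norm (h *\<^sub>R f' t) \<le> B * norm h" for h
        using mult_left_mono[OF assms(3)[OF t], of "\<bar>h\<bar>"] by (simp add: mult.commute)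
    qed
  qed (use assms in auto)
  then show ?thesis by simp
qed

text \<open>At a point where the difference attains its maximum \<open>?m\<close> between
  \<open>t0\<close> and \<open>t\<close>, the Lipschitz bound and the length
  \<open>1 / (2 * L)\<close> give \<open>?m \<le> ?m / 2\<close>.\<close>

lemma ode_unique:
  fixes u w :: "real \<Rightarrow> 'b::real_normed_vector"
  assumes L: "L > 0" "\<And>y z. y \<in> T \<Longrightarrow> z \<in> T \<Longrightarrow> norm (F y - F z) \<le> L * norm (y - z)"
    and I: "open I" "convex I" "t0 \<in> I" "t \<in> I"
    and u: "\<And>s. s \<in> I \<Longrightarrow> u s \<in> T \<and> (u has_vector_derivative F (u s)) (at s)"
    and w: "\<And>s. s \<in> I \<Longrightarrow> w s \<in> T \<and> (w has_vector_derivative F (w s)) (at s)"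
    and eq: "u t0 = w t0" and t: "\<bar>t - t0\<bar> \<le> 1 / (2 * L)"
  shows "u t = w t"
proof -
  let ?J = "{min t t0..max t t0}"
  have JI: "?J \<subseteq> I"
    using I by (metis closed_segment_eq_real_ivl closed_segment_subset max.commute max_def min.commute min_def)
  have d: "((\<lambda>s. u s - w s) has_vector_derivative F (u s) - F (w s)) (at s within ?J)" if "s \<in> ?J" for s
    using u[of s] w[of s] that JI
    by (intro has_vector_derivative_diff) (meson has_vector_derivative_at_within subsetD)+
  then have cont: "continuous_on ?J (\<lambda>s. norm (u s - w s))"
    by (intro continuous_on_norm) (meson differentiableI_vector differentiable_imp_continuous_on differentiable_on_def)
  obtain s where s: "s \<in> ?J" "\<And>r. r \<in> ?J \<Longrightarrow> norm (u r - w r) \<le> norm (u s - w s)"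
    using continuous_attains_sup[OF compact_Icc _ cont] by (metis atLeastatMost_empty_iff2 empty_iff max.cobounded1 min.coboundedI1)
  let ?m = "norm (u s - w s)"
  have "norm ((u s - w s) - (u t0 - w t0)) \<le> (L * ?m) * \<bar>s - t0\<bar>"
  proof (rule has_vector_derivative_imp_lipschitz[where S = ?J, OF _ d])
    fix r assume r: "r \<in> ?J"
    then have "norm (F (u r) - F (w r)) \<le> L * norm (u r - w r)"
      using L(2) u w JI by blast
    also have "\<dots> \<le> L * ?m" using s(2)[OF r] L(1) by simp
    finally show "norm (F (u r) - F (w r)) \<le> L * ?m" .
  qed (use s(1) in auto)
  also have "\<dots> \<le> (L * ?m) * (1 / (2 * L))"
    using s(1) t L(1) by (intro mult_left_mono) auto
  also have "\<dots> = ?m / 2" using L(1) by simp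
  finally have "?m = 0" using eq by simp
  then show ?thesis using s(2)[of t] by auto
qed

text \<open>The Picard operator acts on bounded continuous functions on the whole line, a complete
  space, and contracts by 1/2. The last conclusion gives continuous dependence on the initial
  value.\<close>

lemma picard_lindeloef:
  fixes F :: "'b::banach \<Rightarrow> 'b"
  assumes L: "L > 0" "\<And>y z. norm (F y - F z) \<le> L * norm (y - z)"
    and K: "\<And>y. norm (F y) \<le> K"
  obtains u :: "'b \<Rightarrow> real \<Rightarrow> 'b"
  where "\<And>x. u x 0 = x"
    and "\<And>x t. \<bar>t\<bar> < 1 / (2 * L) \<Longrightarrow> (u x has_vector_derivative F (u x t)) (at t)"
    and "\<And>x y t. norm (u x t - u y t) \<le> 2 * norm (x - y)"
proof -
  \<comment> \<open>On an interval of this half-length, integrating \<open>F\<close> contracts by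
    \<open>L * \<tau> = 1/2\<close>.\<close>
  define \<tau> where "\<tau> = 1 / (2 * L)"
  have tau: "\<tau> > 0" using L by (simp add: \<tau>_def)
  have cF: "continuous_on S F" for S
    by (rule lipschitz_on_continuous_on[where L = L])
       (use L in \<open>auto simp: lipschitz_on_def dist_norm\<close>)
  \<comment> \<open>The integral from 0 to \<open>t\<close>, written as a difference so that
    negative \<open>t\<close> are covered.\<close>
  define G where "G g t = integral {-\<tau>..t} g - integral {-\<tau>..0} g" for g :: "real \<Rightarrow> 'b" and t
  \<comment> \<open>Clamping the time to \<open>{-\<tau>..\<tau>}\<close> turns a local iterate into
    a bounded continuous function on the whole line.\<close>
  define c where "c t = max (-\<tau>) (min \<tau> t)" for t
  have c: "c t \<in> {-\<tau>..\<tau>}" "\<bar>t\<bar> \<le> \<tau> \<Longrightarrow> c t = t" for t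
    using tau by (auto simp: c_def)
  have Gd: "(G g has_vector_derivative g t) (at t within {-\<tau>..\<tau>})"
    if "continuous_on UNIV g" "t \<in> {-\<tau>..\<tau>}" for g t
    unfolding G_def
    using integral_has_vector_derivative[OF continuous_on_subset[OF that(1)] that(2)]
    by (auto intro!: derivative_eq_intros)
  have Gdiff: "norm (G g t - G h t) \<le> B * \<tau>"
    if "continuous_on UNIV g" "continuous_on UNIV h" "\<And>s. norm (g s - h s) \<le> B" "t \<in> {-\<tau>..\<tau>}" for g h B t
  proof -
    have "norm ((G g t - G h t) - (G g 0 - G h 0)) \<le> B * \<bar>t - 0\<bar>"
      using that tau
      by (intro has_vector_derivative_imp_lipschitz[where S = "{-\<tau>..\<tau>}" and f' = "\<lambda>s. g s - h s"])
        (auto intro!: has_vector_derivative_diff Gd)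
    also have "\<dots> \<le> B * \<tau>"
      using that(4) order_trans[OF norm_ge_zero that(3)] by (intro mult_left_mono) auto
    finally show ?thesis by (simp add: G_def)
  qed
  have cFu: "continuous_on UNIV (\<lambda>s. F (apply_bcontfun u s))" for u :: "real \<Rightarrow>\<^sub>C 'b"
    by (rule continuous_on_compose2[OF cF[of UNIV]]) auto
  define P where "P x u = Bcontfun (\<lambda>t. x + G (\<lambda>s. F (apply_bcontfun u s)) (c t))" for x u
  have "(\<lambda>t. x + G (\<lambda>s. F (apply_bcontfun u s)) (c t)) \<in> bcontfun" for x u
  proof -
    let ?G = "G (\<lambda>s. F (apply_bcontfun u s))"
    have "continuous_on {-\<tau>..\<tau>} ?G"
      by (rule continuous_on_vector_derivative) (rule Gd[OF cFu])
    moreover have "continuous_on UNIV c" unfolding c_def by (intro continuous_intros)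
    ultimately have "continuous_on UNIV (\<lambda>t. ?G (c t))"
      using c(1) by (intro continuous_on_compose2[of "{-\<tau>..\<tau>}" ?G UNIV c]) auto
    moreover have "bounded (range (\<lambda>t. x + ?G (c t)))"
    proof -
      have "compact (?G ` {-\<tau>..\<tau>})"
        using \<open>continuous_on {-\<tau>..\<tau>} ?G\<close> compact_continuous_image by blast
      then have "bounded ((+) x ` ?G ` {-\<tau>..\<tau>})"
        by (intro bounded_translation compact_imp_bounded)
      then show ?thesis by (rule bounded_subset) (use c(1) in auto)
    qed
    ultimately show ?thesis by (auto simp: bcontfun_def intro!: continuous_intros)
  qed
  then have P: "apply_bcontfun (P x u) t = x + G (\<lambda>s. F (apply_bcontfun u s)) (c t)" for x u t
    unfolding P_def by (simp add: Bcontfun_inverse)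
  have contr: "norm (apply_bcontfun (P x u) t - apply_bcontfun (P x w) t) \<le> (1/2) * dist u w" for x u w t
  proof -
    have "norm (F (apply_bcontfun u s) - F (apply_bcontfun w s)) \<le> L * dist u w" for s
    proof -
      have "norm (F (apply_bcontfun u s) - F (apply_bcontfun w s))
          \<le> L * norm (apply_bcontfun u s - apply_bcontfun w s)" by (rule L)
      also have "norm (apply_bcontfun u s - apply_bcontfun w s) \<le> dist u w"
        using dist_bounded[of u s w] by (simp add: dist_norm)
      finally show ?thesis using L(1) by simp
    qed
    then have "norm (G (\<lambda>s. F (apply_bcontfun u s)) (c t) - G (\<lambda>s. F (apply_bcontfun w s)) (c t))
        \<le> (L * dist u w) * \<tau>"
      by (intro Gdiff cFu c)
    then show ?thesis using L(1) by (simp add: P \<tau>_def)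
  qed
  have "\<exists>!u. P x u = u" for x
  proof (rule banach_fix_type[of "1/2"])
    show "\<forall>u w. dist (P x u) (P x w) \<le> 1/2 * dist u w"
      using contr by (intro allI dist_bound) (auto simp: dist_norm)
  qed auto
  then obtain U where U: "\<And>x. P x (U x) = U x" by metis
  define u where "u x t = apply_bcontfun (U x) t" for x t
  have ueq: "u x t = x + G (\<lambda>s. F (u x s)) (c t)" for x t
    using P[of x "U x" t] by (simp add: U u_def)
  have cu: "continuous_on UNIV (\<lambda>s. F (u x s))" for x using cFu by (simp add: u_def)
  have "u x 0 = x" for x
    using ueq[of x 0] c(2)[of 0] tau by (simp add: G_def)
  moreover have "(u x has_vector_derivative F (u x t)) (at t)" if "\<bar>t\<bar> < 1 / (2 * L)" for x t
  proof -
    have t: "t \<in> {-\<tau><..<\<tau>}" using that by (auto simp: \<tau>_def abs_less_iff)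
    have "((\<lambda>t. x + G (\<lambda>s. F (u x s)) t) has_vector_derivative F (u x t)) (at t within {-\<tau>..\<tau>})"
      using Gd[OF cu, of t] t by (auto intro!: derivative_eq_intros)
    then have "((\<lambda>t. x + G (\<lambda>s. F (u x s)) t) has_vector_derivative F (u x t)) (at t)"
      using t by (simp add: at_within_Icc_at)
    then show ?thesis
    proof (rule has_vector_derivative_transform_within_open[of _ _ _ "{-\<tau><..<\<tau>}"])
      show "x + G (\<lambda>s. F (u x s)) s = u x s" if "s \<in> {-\<tau><..<\<tau>}" for s
      proof -
        have "c s = s" using that by (intro c(2)) auto
        then show ?thesis using ueq[of x s] by simp
      qed
    qed (use t in auto)
  qed
  moreover have "norm (u x t - u y t) \<le> 2 * norm (x - y)" for x y t
  proof -
    \<comment> \<open>Both fixed points are compared through \<open>P y\<close>: exchanging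
      \<open>x\<close> for \<open>y\<close> shifts by \<open>x - y\<close>, and the contraction
      accounts for the rest. Absorbing half of the distance gives the factor 2.\<close>
    have "norm (u x s - u y s) \<le> norm (x - y) + (1/2) * dist (U x) (U y)" for s
    proof -
      have "u x s - u y s = (x - y) + (apply_bcontfun (P y (U x)) s - apply_bcontfun (P y (U y)) s)"
        unfolding P by (subst ueq[of x], subst ueq[of y]) (simp add: u_def)
      then show ?thesis
        using norm_triangle_ineq[of "x - y"] contr[of y "U x" s "U y"]
        by (metis (no_types, opaque_lifting) add_left_mono order_trans)
    qed
    then have "dist (U x) (U y) \<le> norm (x - y) + (1/2) * dist (U x) (U y)"
      by (intro dist_bound) (simp add: u_def dist_norm)
    then have "dist (U x) (U y) \<le> 2 * norm (x - y)" by simp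
    moreover have "norm (u x t - u y t) \<le> dist (U x) (U y)"
      using dist_bounded[of "U x" t "U y"] by (simp add: u_def dist_norm)
    ultimately show ?thesis by linarith
  qed
  ultimately show ?thesis using that[of u] by blast
qed

context finite_dimensional begin

text \<open>The field is cut off to a globally Lipschitz bounded one, carried to a Banach space by
  \<open>banach_embedding\<close>, integrated there and projected back. For short times,
  trajectories from the small ball do not feel the cut-off.\<close>

lemma local_flow:
  fixes f :: "'e \<Rightarrow> 'e"
  assumes f: "smooth_on S f" and S: "open S" "x0 \<in> S"
  obtains r \<tau> \<phi> where "r > 0" "\<tau> > 0"
    and "continuous_on (ball x0 r \<times> {-\<tau><..<\<tau>}) (\<lambda>(x, t). \<phi> x t)"
    and "\<And>x. x \<in> ball x0 r \<Longrightarrow> \<phi> x 0 = x"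
    and "\<And>x t. x \<in> ball x0 r \<Longrightarrow> \<bar>t\<bar> < \<tau> \<Longrightarrow>
      \<phi> x t \<in> S \<and> (\<phi> x has_vector_derivative f (\<phi> x t)) (at t)"
proof -
  obtain R where R: "R > 0" "cball x0 R \<subseteq> S" using S open_contains_cball by blast
  \<comment> \<open>Trajectories start within \<open>r\<close> of \<open>x0\<close>, travel at most
    \<open>r\<close>, and so stay within \<open>2 * r\<close>, where \<open>cut\<close> is 1; it
    vanishes outside \<open>3 * r = R\<close>.\<close>
  define r where "r = R / 3"
  have r: "r > 0" using R by (simp add: r_def)
  obtain L where L: "L > 0" "\<And>y z. y \<in> cball x0 R \<Longrightarrow> z \<in> cball x0 R \<Longrightarrow> norm (f y - f z) \<le> L * norm (y - z)"
    using smooth_on_imp_lipschitz_cball[OF f R(2)] by blast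
  define K where "K = norm (f x0) + L * R"
  have K: "norm (f y) \<le> K" if "y \<in> cball x0 R" for y
  proof -
    have "norm (f y) \<le> norm (f x0) + norm (f y - f x0)" using norm_triangle_sub by blast
    also have "norm (f y - f x0) \<le> L * norm (y - x0)" using L(2) that R(1) by auto
    also have "\<dots> \<le> L * R" using that L(1) by (auto simp: dist_norm norm_minus_commute)
    finally show ?thesis by (simp add: K_def)
  qed
  have K0: "K \<ge> 0" using L R by (simp add: K_def)
  define cut where "cut x = max 0 (min 1 (3 - dist x0 x / r))" for x
  have chi01: "0 \<le> cut x" "cut x \<le> 1" for x by (auto simp: cut_def)
  have chi0: "cut x = 0" if "x \<notin> cball x0 R" for x using that r by (simp add: cut_def r_def field_simps)
  have chi1: "cut x = 1" if "dist x0 x \<le> 2 * r" for x using that r by (simp add: cut_def field_simps)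
  have chiL: "\<bar>cut x - cut y\<bar> \<le> norm (x - y) / r" for x y
  proof -
    have "\<bar>cut x - cut y\<bar> \<le> \<bar>dist x0 x / r - dist x0 y / r\<bar>" by (simp add: cut_def)
    also have "\<dots> = \<bar>dist x0 x - dist x0 y\<bar> / r" using r by (simp add: diff_divide_distrib[symmetric])
    also have "\<dots> \<le> dist x y / r" using r abs_dist_diff_le[of x x0 y] by (intro divide_right_mono) (auto simp: dist_commute)
    finally show ?thesis by (simp add: dist_norm)
  qed
  define F where "F x = cut x *\<^sub>R f x" for x
  \<comment> \<open>Only one of the two points has to lie in the ball where \<open>f\<close> is
    controlled: if \<open>x\<close> lies outside, then \<open>F x = 0\<close>, and the Lipschitz
    bound of \<open>cut\<close> with the bound of \<open>f\<close> at \<open>y\<close>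
    suffices.\<close>
  have Fin: "norm (F x - F y) \<le> (L + K / r) * norm (x - y)" if y: "y \<in> cball x0 R" for x y
  proof (cases "x \<in> cball x0 R")
    case True
    have "F x - F y = cut x *\<^sub>R (f x - f y) + (cut x - cut y) *\<^sub>R f y"
      by (simp add: F_def algebra_simps)
    then have "norm (F x - F y) \<le> cut x * norm (f x - f y) + \<bar>cut x - cut y\<bar> * norm (f y)"
      using norm_triangle_ineq[of "cut x *\<^sub>R (f x - f y)" "(cut x - cut y) *\<^sub>R f y"] chi01(1)[of x] by simp
    also have "\<dots> \<le> 1 * (L * norm (x - y)) + (norm (x - y) / r) * K"
      using chi01 chiL L True y K r L(1) by (intro add_mono mult_mono) auto
    finally show ?thesis by (simp add: algebra_simps)
  next
    case False
    then have "norm (F x - F y) = \<bar>cut x - cut y\<bar> * norm (f y)" by (simp add: F_def chi0)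
    also have "\<dots> \<le> (norm (x - y) / r) * K"
      using chiL y K r by (intro mult_mono) auto
    also have "\<dots> \<le> (L + K / r) * norm (x - y)" using L(1) by (simp add: algebra_simps)
    finally show ?thesis .
  qed
  have FL: "norm (F x - F y) \<le> (L + K / r) * norm (x - y)" for x y
  proof (cases "x \<in> cball x0 R \<or> y \<in> cball x0 R")
    case True
    then show ?thesis using Fin[of y x] Fin[of x y] by (metis norm_minus_commute)
  next
    case False
    then have "F x = 0" "F y = 0" by (auto simp: F_def chi0)
    then show ?thesis using L(1) K0 r by simp
  qed
  have FK: "norm (F x) \<le> K" for x
  proof (cases "x \<in> cball x0 R")
    case True
    then have "cut x * norm (f x) \<le> 1 * K" using chi01 K by (intro mult_mono) auto
    then show ?thesis using chi01(1)[of x] by (simp add: F_def)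
  qed (use K0 in \<open>simp add: F_def chi0\<close>)
  obtain \<iota> :: "'e \<Rightarrow> (real \<Rightarrow>\<^sub>C real)" and \<pi> where
    bl: "bounded_linear \<iota>" "bounded_linear \<pi>" and inv: "\<And>x. \<pi> (\<iota> x) = x"
    using banach_embedding by metis
  obtain Ci where Ci: "Ci > 0" "\<And>x. norm (\<iota> x) \<le> norm x * Ci"
    using bounded_linear.pos_bounded[OF bl(1)] by blast
  obtain Cp where Cp: "Cp > 0" "\<And>x. norm (\<pi> x) \<le> norm x * Cp"
    using bounded_linear.pos_bounded[OF bl(2)] by blast
  define H where "H y = \<iota> (F (\<pi> y))" for y
  define L' where "L' = Ci * (L + K / r) * Cp"
  have L'0: "L' > 0" using Ci Cp L(1) K0 r by (simp add: L'_def add_pos_nonneg)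
  have HL: "norm (H y - H z) \<le> L' * norm (y - z)" for y z
  proof -
    have "norm (H y - H z) = norm (\<iota> (F (\<pi> y) - F (\<pi> z)))"
      using linear_diff[OF bounded_linear.linear[OF bl(1)]] by (simp add: H_def)
    also have "\<dots> \<le> norm (F (\<pi> y) - F (\<pi> z)) * Ci" by (rule Ci)
    also have "\<dots> \<le> ((L + K / r) * norm (\<pi> y - \<pi> z)) * Ci" using Ci FL by simp
    also have "norm (\<pi> y - \<pi> z) = norm (\<pi> (y - z))"
      using linear_diff[OF bounded_linear.linear[OF bl(2)]] by simp
    also have "((L + K / r) * norm (\<pi> (y - z))) * Ci \<le> ((L + K / r) * (norm (y - z) * Cp)) * Ci"
      using Ci Cp L(1) K0 r by (intro mult_right_mono mult_left_mono) auto
    finally show ?thesis by (simp add: L'_def algebra_simps)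
  qed
  have HK: "norm (H y) \<le> K * Ci" for y
    unfolding H_def using Ci(2)[of "F (\<pi> y)"] FK[of "\<pi> y"] Ci(1) mult_right_mono order_trans by (metis less_imp_le)
  obtain u where u: "\<And>x. u x 0 = x"
    "\<And>x t. \<bar>t\<bar> < 1 / (2 * L') \<Longrightarrow> (u x has_vector_derivative H (u x t)) (at t)"
    "\<And>x y t. norm (u x t - u y t) \<le> 2 * norm (x - y)"
    using picard_lindeloef[OF L'0 HL HK] by blast
  define \<phi> where "\<phi> x t = \<pi> (u (\<iota> x) t)" for x t
  \<comment> \<open>The first bound is the Picard time, the second keeps the distance travelled
    below \<open>r\<close>; \<open>K + 1\<close> avoids a zero denominator.\<close>
  define \<tau> where "\<tau> = min (1 / (2 * L')) (r / (K + 1))"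
  have tau: "\<tau> > 0" "\<tau> \<le> 1 / (2 * L')" "\<tau> \<le> r / (K + 1)"
    using L'0 r K0 by (auto simp: \<tau>_def)
  have phi0: "\<phi> x 0 = x" for x by (simp add: \<phi>_def u inv)
  have phid: "(\<phi> x has_vector_derivative F (\<phi> x t)) (at t)" if "\<bar>t\<bar> < \<tau>" for x t
  proof -
    have "((\<lambda>t. \<pi> (u (\<iota> x) t)) has_vector_derivative \<pi> (H (u (\<iota> x) t))) (at t)"
      using u(2) that tau by (intro bounded_linear.has_vector_derivative[OF bl(2)]) auto
    then show ?thesis by (simp add: \<phi>_def[abs_def] H_def inv)
  qed
  have phiK: "norm (\<phi> x t - \<phi> x s) \<le> K * \<bar>t - s\<bar>" if "\<bar>t\<bar> < \<tau>" "\<bar>s\<bar> < \<tau>" for x t s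
    using that phid FK
    by (intro has_vector_derivative_imp_lipschitz[where S = "{-\<tau><..<\<tau>}" and f' = "\<lambda>s. F (\<phi> x s)"])
      (auto intro: has_vector_derivative_at_within)
  have phiL: "norm (\<phi> x t - \<phi> y t) \<le> (2 * Ci * Cp) * norm (x - y)" for x y t
  proof -
    have "norm (\<phi> x t - \<phi> y t) = norm (\<pi> (u (\<iota> x) t - u (\<iota> y) t))"
      using linear_diff[OF bounded_linear.linear[OF bl(2)]] by (simp add: \<phi>_def)
    also have "\<dots> \<le> norm (u (\<iota> x) t - u (\<iota> y) t) * Cp" by (rule Cp)
    also have "\<dots> \<le> (2 * norm (\<iota> x - \<iota> y)) * Cp" using Cp u(3) by simp
    also have "\<dots> = (2 * norm (\<iota> (x - y))) * Cp"
      using linear_diff[OF bounded_linear.linear[OF bl(1)]] by simp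
    also have "\<dots> \<le> (2 * (norm (x - y) * Ci)) * Cp" using Cp Ci by simp
    finally show ?thesis by (simp add: algebra_simps)
  qed
  have phi2r: "dist x0 (\<phi> x t) \<le> 2 * r" if "x \<in> ball x0 r" "\<bar>t\<bar> < \<tau>" for x t
  proof -
    have "norm (\<phi> x t - x) \<le> K * \<bar>t\<bar>" using phiK[of t 0 x] that tau by (simp add: phi0)
    also have "\<dots> \<le> K * (r / (K + 1))" using that tau K0 by (intro mult_left_mono) auto
    also have "\<dots> \<le> r" using K0 r by (simp add: field_simps)
    finally have "dist x (\<phi> x t) \<le> r" by (simp add: dist_norm norm_minus_commute)
    then show ?thesis using that(1) dist_triangle[of x0 "\<phi> x t" x] by simp
  qed
  have "continuous_on (ball x0 r \<times> {-\<tau><..<\<tau>}) (\<lambda>(x, t). \<phi> x t)"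
  proof (rule lipschitz_on_continuous_on[of "2 * Ci * Cp + K"], rule lipschitz_onI)
    show "0 \<le> 2 * Ci * Cp + K" using Ci Cp K0 by simp
    fix p q assume pq: "p \<in> ball x0 r \<times> {-\<tau><..<\<tau>}" "q \<in> ball x0 r \<times> {-\<tau><..<\<tau>}"
    obtain x t y s where [simp]: "p = (x, t)" "q = (y, s)" by fastforce
    have ts: "\<bar>t\<bar> < \<tau>" "\<bar>s\<bar> < \<tau>" using pq by auto
    have "dist (\<phi> x t) (\<phi> y s) \<le> norm (\<phi> x t - \<phi> y t) + norm (\<phi> y t - \<phi> y s)"
      by (metis dist_norm dist_triangle)
    also have "\<dots> \<le> (2 * Ci * Cp) * norm (x - y) + K * \<bar>t - s\<bar>"
      by (intro add_mono phiL phiK ts)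
    also have "\<dots> \<le> (2 * Ci * Cp) * dist p q + K * dist p q"
      using Ci Cp K0 dist_fst_le[of p q] dist_snd_le[of p q]
      by (intro add_mono mult_left_mono) (auto simp: dist_norm dist_real_def)
    finally show "dist (case p of (x, t) \<Rightarrow> \<phi> x t) (case q of (x, t) \<Rightarrow> \<phi> x t) \<le> (2 * Ci * Cp + K) * dist p q"
      by (simp add: algebra_simps)
  qed
  moreover have "\<phi> x t \<in> S \<and> (\<phi> x has_vector_derivative f (\<phi> x t)) (at t)"
    if "x \<in> ball x0 r" "\<bar>t\<bar> < \<tau>" for x t
  proof -
    have "F (\<phi> x t) = f (\<phi> x t)" using phi2r[OF that] chi1 by (simp add: F_def)
    moreover have "\<phi> x t \<in> cball x0 R" using phi2r[OF that] r by (simp add: r_def)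
    ultimately show ?thesis using phid[OF that(2), of x] R(2) by auto
  qed
  ultimately show ?thesis using that[of r \<tau> \<phi>] r tau(1) phi0 by blast
qed

end

section \<open>Charts\<close>

lemma continuous_map_locally:
  assumes "\<And>x. x \<in> topspace X \<Longrightarrow> \<exists>U. openin X U \<and> x \<in> U \<and> continuous_map (subtopology X U) Y g"
  shows "continuous_map X Y g"
proof -
  obtain U where U: "\<And>x. x \<in> topspace X \<Longrightarrow> openin X (U x) \<and> x \<in> U x \<and> continuous_map (subtopology X (U x)) Y g"
    using assms by metis
  show ?thesis
    by (rule pasting_lemma[where I = "topspace X" and T = U and f = "\<lambda>_. g"]) (use U in auto)
qed

lemma continuous_map_restrict_range:
  "continuous_map X (subtopology Y S) f \<Longrightarrow> continuous_map X Y f"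
  by (simp add: continuous_map_in_subtopology)

lemma continuous_map_Pair_left:
  "y \<in> topspace Y \<Longrightarrow> continuous_map (prod_topology X Y) Z f \<Longrightarrow> continuous_map X Z (\<lambda>x. f (x, y))"
  using continuous_map_compose[of X "prod_topology X Y" "\<lambda>x. (x, y)" Z f]
  by (simp add: o_def continuous_map_pairedI)

locale closed_manifold =
  fixes M :: "'a topology" and A :: "('a, 'e::real_normed_vector) chart set"
  assumes manifold: "closed_smooth_manifold M A"

sublocale closed_manifold \<subseteq> finite_dimensional "SOME B::'e set. finite B \<and> span B = UNIV"
proof
  have "\<exists>B::'e set. finite B \<and> span B = UNIV"
    using manifold unfolding closed_smooth_manifold_def by blast
  from someI_ex[OF this]
  show "finite (SOME B::'e set. finite B \<and> span B = UNIV)" "span (SOME B::'e set. finite B \<and> span B = UNIV) = UNIV"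
    by auto
qed

definition chart_preimage :: "('a, 'e) chart \<Rightarrow> 'e set \<Rightarrow> 'a set" where
  "chart_preimage c W = {m \<in> chart_dom c. coord c m \<in> W}"

abbreviation chart_im :: "('a, 'e) chart \<Rightarrow> 'e set" where "chart_im c \<equiv> coord c ` chart_dom c"

context closed_manifold begin

lemma hausdorff: "Hausdorff_space M" and compact: "compact_space M" and atlas: "smooth_atlas M A"
  using manifold by (auto simp: closed_smooth_manifold_def)

lemma chart_open: "c \<in> A \<Longrightarrow> openin M (chart_dom c)" "c \<in> A \<Longrightarrow> open (chart_im c)"
  and chart_homeo: "c \<in> A \<Longrightarrow> homeomorphic_map (subtopology M (chart_dom c)) (top_of_set (chart_im c)) (coord c)"
  and transition_smooth: "c \<in> A \<Longrightarrow> c' \<in> A \<Longrightarrow>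
    smooth_on (coord c ` (chart_dom c \<inter> chart_dom c')) (coord c' \<circ> chart_inv c)"
  using atlas by (auto simp: smooth_atlas_def)

lemma chart_subset: "c \<in> A \<Longrightarrow> chart_dom c \<subseteq> topspace M"
  using chart_open(1) openin_subset by blast

lemma chart_ex: "m \<in> topspace M \<Longrightarrow> \<exists>c\<in>A. m \<in> chart_dom c"
  using atlas by (auto simp: smooth_atlas_def)

lemma coord_inj: "c \<in> A \<Longrightarrow> inj_on (coord c) (chart_dom c)"
  using homeomorphic_imp_injective_map[OF chart_homeo] chart_subset by (fastforce simp: Int_absorb1)

lemma chart_inv_coord [simp]: "c \<in> A \<Longrightarrow> m \<in> chart_dom c \<Longrightarrow> chart_inv c (coord c m) = m"
  by (simp add: chart_inv_def coord_inj)

lemma coord_chart_inv [simp]: "x \<in> chart_im c \<Longrightarrow> coord c (chart_inv c x) = x"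
  by (simp add: chart_inv_def f_inv_into_f)

lemma chart_inv_in: "x \<in> chart_im c \<Longrightarrow> chart_inv c x \<in> chart_dom c"
  by (simp add: chart_inv_def inv_into_into)

lemma chart_maps:
  assumes "c \<in> A"
  shows "homeomorphic_maps (subtopology M (chart_dom c)) (top_of_set (chart_im c)) (coord c) (chart_inv c)"
proof -
  obtain g where g: "homeomorphic_maps (subtopology M (chart_dom c)) (top_of_set (chart_im c)) (coord c) g"
    using chart_homeo[OF assms] by (auto simp: homeomorphic_map_maps)
  then show ?thesis
  proof (rule homeomorphic_maps_eq)
    fix x assume "x \<in> topspace (top_of_set (chart_im c))"
    then obtain m where "m \<in> chart_dom c" "x = coord c m" by auto
    then show "g x = chart_inv c x"
      using g assms chart_subset[OF assms] by (auto simp: homeomorphic_maps_def)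
  qed auto
qed

lemma continuous_coord: "c \<in> A \<Longrightarrow> continuous_map (subtopology M (chart_dom c)) euclidean (coord c)"
  using homeomorphic_imp_continuous_map[OF chart_homeo] continuous_map_restrict_range by blast

lemma continuous_chart_inv: "c \<in> A \<Longrightarrow> continuous_map (top_of_set (chart_im c)) M (chart_inv c)"
  using chart_maps continuous_map_restrict_range unfolding homeomorphic_maps_def by blast

lemma continuous_coord_compose:
  assumes "c \<in> A" "continuous_map X M f" "\<And>x. x \<in> topspace X \<Longrightarrow> f x \<in> chart_dom c"
  shows "continuous_map X euclidean (\<lambda>x. coord c (f x))"
proof -
  have "continuous_map X (subtopology M (chart_dom c)) f"
    using assms by (auto simp: continuous_map_in_subtopology)
  from continuous_map_compose[OF this continuous_coord[OF assms(1)]] show ?thesis by (simp add: o_def)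
qed

lemma continuous_chart_inv_compose:
  assumes "c \<in> A" "continuous_map X euclidean f" "\<And>x. x \<in> topspace X \<Longrightarrow> f x \<in> chart_im c"
  shows "continuous_map X M (\<lambda>x. chart_inv c (f x))"
proof -
  have "continuous_map X (top_of_set (chart_im c)) f"
    using assms by (auto simp: continuous_map_in_subtopology)
  from continuous_map_compose[OF this continuous_chart_inv[OF assms(1)]] show ?thesis by (simp add: o_def)
qed

lemma chart_preimage_eq: "c \<in> A \<Longrightarrow> W \<subseteq> chart_im c \<Longrightarrow> chart_preimage c W = chart_inv c ` W"
  by (auto simp: chart_preimage_def chart_inv_in subset_eq image_iff) force

lemma openin_chart_preimage: "c \<in> A \<Longrightarrow> open W \<Longrightarrow> openin M (chart_preimage c W)"
proof -
  assume c: "c \<in> A" and W: "open W"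
  have "openin (subtopology M (chart_dom c)) {x \<in> topspace (subtopology M (chart_dom c)). coord c x \<in> W}"
    using openin_continuous_map_preimage[OF continuous_coord[OF c]] W by simp
  moreover have "{x \<in> topspace (subtopology M (chart_dom c)). coord c x \<in> W} = chart_preimage c W"
    using chart_subset[OF c] by (auto simp: chart_preimage_def)
  ultimately show ?thesis using openin_trans_full chart_open(1)[OF c] by metis
qed

lemma compactin_chart_preimage:
  assumes "c \<in> A" "compact K" "K \<subseteq> chart_im c"
  shows "compactin M (chart_preimage c K)"
proof -
  have "compactin (top_of_set (chart_im c)) K"
    using assms by (simp add: compactin_subtopology)
  then show ?thesis
    using image_compactin[OF _ continuous_chart_inv[OF assms(1)]] chart_preimage_eq assms by metis
qed

lemma closedin_chart_preimage:
  "c \<in> A \<Longrightarrow> compact K \<Longrightarrow> K \<subseteq> chart_im c \<Longrightarrow> closedin M (chart_preimage c K)"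
  using compactin_imp_closedin[OF hausdorff] compactin_chart_preimage by blast

lemma open_coord_image:
  assumes "c \<in> A" "openin M N"
  shows "open (coord c ` (chart_dom c \<inter> N))"
proof -
  have "openin (top_of_set (chart_im c)) {x \<in> topspace (top_of_set (chart_im c)). chart_inv c x \<in> N}"
    using openin_continuous_map_preimage[OF continuous_chart_inv] assms by blast
  moreover have "{x \<in> topspace (top_of_set (chart_im c)). chart_inv c x \<in> N} = coord c ` (chart_dom c \<inter> N)"
    using assms(1) by (auto simp: chart_inv_in)
  ultimately show ?thesis using chart_open(2)[OF assms(1)] openin_open_trans by metis
qed

lemma coordinate_ball:
  assumes "c \<in> A" "m \<in> chart_dom c" "openin M N" "m \<in> N"
  obtains r where "r > 0" "cball (coord c m) r \<subseteq> chart_im c" "chart_preimage c (cball (coord c m) r) \<subseteq> N"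
proof -
  have "coord c m \<in> coord c ` (chart_dom c \<inter> N)" using assms by blast
  then obtain r where r: "r > 0" "cball (coord c m) r \<subseteq> coord c ` (chart_dom c \<inter> N)"
    using open_coord_image[OF assms(1,3)] open_contains_cball by blast
  have "chart_preimage c (cball (coord c m) r) \<subseteq> N"
  proof
    fix q assume "q \<in> chart_preimage c (cball (coord c m) r)"
    then have "q \<in> chart_dom c" "coord c q \<in> coord c ` (chart_dom c \<inter> N)"
      using r by (auto simp: chart_preimage_def)
    then show "q \<in> N" using coord_inj[OF assms(1)] by (auto simp: inj_on_def)
  qed
  then show ?thesis using that r by blast
qed

lemma coordinate_ball_ex:
  assumes "openin M N" "m \<in> N"
  obtains c r where "c \<in> A" "m \<in> chart_dom c" "r > 0" "cball (coord c m) r \<subseteq> chart_im c"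
    "chart_preimage c (cball (coord c m) r) \<subseteq> N"
proof -
  obtain c where c: "c \<in> A" "m \<in> chart_dom c"
    using chart_ex openin_subset[OF assms(1)] assms(2) by blast
  from coordinate_ball[OF this assms] that c show ?thesis by metis
qed

section \<open>Derivatives of transition maps\<close>

lemma transition_derivative:
  assumes "c \<in> A" "c' \<in> A" "m \<in> chart_dom c \<inter> chart_dom c'"
  shows "(coord c' \<circ> chart_inv c has_derivative transition_deriv c c' m) (at (coord c m))"
  unfolding transition_deriv_def
  using smooth_on_imp_derivative[OF transition_smooth[OF assms(1,2)]] assms(3) by blast

lemma linear_transition_deriv:
  "c \<in> A \<Longrightarrow> c' \<in> A \<Longrightarrow> m \<in> chart_dom c \<inter> chart_dom c' \<Longrightarrow> linear (transition_deriv c c' m)"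
  using transition_derivative has_derivative_linear by blast

lemma continuous_on_transition_deriv:
  assumes "c \<in> A" "c' \<in> A"
  shows "continuous_on (coord c ` (chart_dom c \<inter> chart_dom c')) (\<lambda>x. transition_deriv c c' (chart_inv c x) w)"
proof -
  have "continuous_on (coord c ` (chart_dom c \<inter> chart_dom c')) (\<lambda>x. frechet_derivative (coord c' \<circ> chart_inv c) (at x) w)"
    by (rule smooth_on_imp_continuous_derivative[OF transition_smooth[OF assms]])
  then show ?thesis
    by (rule continuous_on_eq) (use assms in \<open>auto simp: transition_deriv_def\<close>)
qed

text \<open>Chain rule through the transition map. \<open>near\<close> enters because
  \<open>chart_inv c \<circ> coord c\<close> is the identity only on the chart domain; derivatives
  within \<open>S\<close> also cover the end points of curves.\<close>

lemma curve_derivative_change_chart: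
  assumes cc: "c \<in> A" "c' \<in> A" and m: "\<gamma> t \<in> chart_dom c \<inter> chart_dom c'" and t: "t \<in> S"
    and near: "\<forall>\<^sub>F s in at t within S. \<gamma> s \<in> chart_dom c"
    and d: "((coord c \<circ> \<gamma>) has_vector_derivative w) (at t within S)"
  shows "((coord c' \<circ> \<gamma>) has_vector_derivative transition_deriv c c' (\<gamma> t) w) (at t within S)"
proof -
  obtain e where e: "e > 0" "\<And>s. s \<in> S \<Longrightarrow> s \<noteq> t \<Longrightarrow> dist s t < e \<Longrightarrow> \<gamma> s \<in> chart_dom c"
    using near by (auto simp: eventually_at)
  let ?D = "transition_deriv c c' (\<gamma> t)"
  have "(coord c' \<circ> chart_inv c has_derivative ?D) (at ((coord c \<circ> \<gamma>) t) within (coord c \<circ> \<gamma>) ` S)"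
    using transition_derivative[OF cc m] by (simp add: has_derivative_at_withinI)
  from diff_chain_within[OF d[unfolded has_vector_derivative_def] this]
  have "((coord c' \<circ> chart_inv c) \<circ> (coord c \<circ> \<gamma>) has_vector_derivative ?D w) (at t within S)"
    unfolding has_vector_derivative_def o_def using linear_scale[OF linear_transition_deriv[OF cc m]] by simp
  then show ?thesis
  proof (rule has_vector_derivative_transform_within[OF _ e(1) t])
    fix s assume "s \<in> S" "dist s t < e"
    then have "\<gamma> s \<in> chart_dom c" using e(2) m by (cases "s = t") auto
    then show "((coord c' \<circ> chart_inv c) \<circ> (coord c \<circ> \<gamma>)) s = (coord c' \<circ> \<gamma>) s" using cc by simp
  qed
qed

end

section \<open>The flow of a vector field\<close>

lemma compactin_pointwise_cover:
  assumes "compactin X K" "\<And>x. x \<in> K \<Longrightarrow> openin X (N x) \<and> x \<in> N x"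
  obtains F where "finite F" "F \<subseteq> K" "K \<subseteq> (\<Union>x\<in>F. N x)"
proof -
  have "\<exists>\<F>. finite \<F> \<and> \<F> \<subseteq> N ` K \<and> K \<subseteq> \<Union>\<F>"
    using assms(1) assms(2) by (intro compactinD) auto
  then obtain F where "finite F" "F \<subseteq> K" "K \<subseteq> \<Union>(N ` F)"
    using finite_subset_image by metis
  then show ?thesis using that by blast
qed

locale manifold_field = closed_manifold M A
  for M :: "'a topology" and A :: "('a, 'e::real_normed_vector) chart set" +
  fixes v :: "('a, 'e) vfield"
  assumes field: "smooth_vector_field A v"
begin

text \<open>The condition on an integral curve at a single time, for total functions that are
  integral curves on part of the line only. The middle clause is continuity at \<open>t\<close>,
  stated so that it depends on the values near \<open>t\<close> alone.\<close>

definition icurve_at :: "(real \<Rightarrow> 'a) \<Rightarrow> real \<Rightarrow> bool" where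
  "icurve_at \<gamma> t \<longleftrightarrow> \<gamma> t \<in> topspace M \<and> (\<forall>U. openin M U \<and> \<gamma> t \<in> U \<longrightarrow> (\<forall>\<^sub>F s in nhds t. \<gamma> s \<in> U)) \<and>
     (\<forall>c\<in>A. \<gamma> t \<in> chart_dom c \<longrightarrow> ((coord c \<circ> \<gamma>) has_vector_derivative v c (\<gamma> t)) (at t))"

lemma icurve_at_nbhd: "icurve_at \<gamma> t \<Longrightarrow> openin M U \<Longrightarrow> \<gamma> t \<in> U \<Longrightarrow> \<forall>\<^sub>F s in nhds t. \<gamma> s \<in> U"
  unfolding icurve_at_def by blast

lemma integral_curve_iff: "integral_curve M A v \<gamma> \<longleftrightarrow> (\<forall>t. icurve_at \<gamma> t)"
proof
  assume g: "integral_curve M A v \<gamma>"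
  then have c: "continuous_map euclideanreal M \<gamma>" by (simp add: integral_curve_def)
  show "\<forall>t. icurve_at \<gamma> t"
    unfolding icurve_at_def
  proof (intro allI conjI impI)
    show "\<gamma> t \<in> topspace M" for t using continuous_map_image_subset_topspace[OF c] by auto
    fix t U assume U: "openin M U \<and> \<gamma> t \<in> U"
    then have "open {s. \<gamma> s \<in> U}" using openin_continuous_map_preimage[OF c, of U] by simp
    then show "\<forall>\<^sub>F s in nhds t. \<gamma> s \<in> U" using U eventually_nhds by blast
  qed (use g in \<open>auto simp: integral_curve_def\<close>)
next
  assume g: "\<forall>t. icurve_at \<gamma> t"
  have "open {s. \<gamma> s \<in> U}" if "openin M U" for U
  proof (subst open_subopen, clarify)
    fix t assume "\<gamma> t \<in> U"
    then have "\<forall>\<^sub>F s in nhds t. \<gamma> s \<in> U" using g that icurve_at_nbhd by blast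
    then show "\<exists>T. open T \<and> t \<in> T \<and> T \<subseteq> {s. \<gamma> s \<in> U}" by (auto simp: eventually_nhds)
  qed
  then have "continuous_map euclideanreal M \<gamma>"
    using g by (auto simp: continuous_map_def icurve_at_def)
  then show "integral_curve M A v \<gamma>" using g by (auto simp: integral_curve_def icurve_at_def)
qed

lemma icurve_at_cong:
  assumes "icurve_at \<gamma> t" "\<forall>\<^sub>F s in nhds t. \<gamma> s = \<delta> s"
  shows "icurve_at \<delta> t"
proof -
  have eq: "\<gamma> t = \<delta> t" using eventually_nhds_x_imp_x[OF assms(2)] by simp
  obtain S where S: "open S" "t \<in> S" "\<And>s. s \<in> S \<Longrightarrow> \<gamma> s = \<delta> s" using assms(2) by (auto simp: eventually_nhds)
  show ?thesis
    unfolding icurve_at_def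
  proof (intro conjI allI impI ballI)
    show "\<delta> t \<in> topspace M" using assms(1) eq by (simp add: icurve_at_def)
    fix U assume "openin M U \<and> \<delta> t \<in> U"
    then have "\<forall>\<^sub>F s in nhds t. \<gamma> s \<in> U" using assms(1) eq icurve_at_nbhd by metis
    then show "\<forall>\<^sub>F s in nhds t. \<delta> s \<in> U" using assms(2) by eventually_elim simp
  next
    fix c assume "c \<in> A" "\<delta> t \<in> chart_dom c"
    then have "((coord c \<circ> \<gamma>) has_vector_derivative v c (\<delta> t)) (at t)"
      using assms(1) eq by (simp add: icurve_at_def)
    then show "((coord c \<circ> \<delta>) has_vector_derivative v c (\<delta> t)) (at t)"
      by (rule has_vector_derivative_transform_within_open[OF _ S(1,2)]) (simp add: S(3))
  qed
qed

lemma icurve_at_shift: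
  assumes "icurve_at \<gamma> (t + a)"
  shows "icurve_at (\<lambda>s. \<gamma> (s + a)) t"
  unfolding icurve_at_def
proof (intro conjI allI impI ballI)
  show "\<gamma> (t + a) \<in> topspace M" using assms by (simp add: icurve_at_def)
  fix U assume "openin M U \<and> \<gamma> (t + a) \<in> U"
  then have "\<forall>\<^sub>F s in nhds (t + a). \<gamma> s \<in> U" using assms icurve_at_nbhd by blast
  moreover have "((\<lambda>s. s + a) \<longlongrightarrow> t + a) (nhds t)"
    by (intro tendsto_intros filterlim_ident)
  ultimately show "\<forall>\<^sub>F s in nhds t. \<gamma> (s + a) \<in> U"
    unfolding filterlim_iff by blast
next
  fix c assume "c \<in> A" "\<gamma> (t + a) \<in> chart_dom c"
  then have "((coord c \<circ> \<gamma>) has_vector_derivative v c (\<gamma> (t + a))) (at (t + a))"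
    using assms by (simp add: icurve_at_def)
  moreover have "((\<lambda>s. s + a) has_vector_derivative 1) (at t)"
    by (auto intro!: derivative_eq_intros)
  ultimately have "((coord c \<circ> \<gamma>) \<circ> (\<lambda>s. s + a) has_vector_derivative (1 *\<^sub>R v c (\<gamma> (t + a)))) (at t)"
    by (intro vector_diff_chain_at) auto
  then show "((coord c \<circ> (\<lambda>s. \<gamma> (s + a))) has_vector_derivative v c (\<gamma> (t + a))) (at t)"
    by (simp add: o_def)
qed

text \<open>One chart suffices: the transformation law of \<open>v\<close> is the one that the chain
  rule imposes on velocities. Continuity into \<open>M\<close> comes from that of the coordinate
  expression, as long as the curve stays in the chart domain.\<close>

lemma icurve_atI:
  assumes c: "c \<in> A" "\<gamma> t \<in> chart_dom c" and near: "\<forall>\<^sub>F s in nhds t. \<gamma> s \<in> chart_dom c"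
    and d: "((coord c \<circ> \<gamma>) has_vector_derivative v c (\<gamma> t)) (at t)"
  shows "icurve_at \<gamma> t"
  unfolding icurve_at_def
proof (intro conjI allI impI ballI)
  show "\<gamma> t \<in> topspace M" using c chart_subset by blast
  fix U assume U: "openin M U \<and> \<gamma> t \<in> U"
  have "isCont (coord c \<circ> \<gamma>) t" using d has_vector_derivative_continuous by blast
  then have "((coord c \<circ> \<gamma>) \<longlongrightarrow> (coord c \<circ> \<gamma>) t) (nhds t)"
    unfolding isCont_def using tendsto_at_iff_tendsto_nhds by blast
  moreover have "open (coord c ` (chart_dom c \<inter> U))" "(coord c \<circ> \<gamma>) t \<in> coord c ` (chart_dom c \<inter> U)"
    using open_coord_image[OF c(1)] U c by auto
  ultimately have "\<forall>\<^sub>F s in nhds t. (coord c \<circ> \<gamma>) s \<in> coord c ` (chart_dom c \<inter> U)"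
    by (rule topological_tendstoD)
  with near show "\<forall>\<^sub>F s in nhds t. \<gamma> s \<in> U"
  proof eventually_elim
    case (elim s)
    then obtain q where "q \<in> chart_dom c" "q \<in> U" "coord c (\<gamma> s) = coord c q" by auto
    then have "\<gamma> s = q" using inj_onD[OF coord_inj[OF c(1)]] elim(1) by metis
    then show ?case using \<open>q \<in> U\<close> by simp
  qed
next
  fix c' assume c': "c' \<in> A" "\<gamma> t \<in> chart_dom c'"
  have "((coord c' \<circ> \<gamma>) has_vector_derivative transition_deriv c c' (\<gamma> t) (v c (\<gamma> t))) (at t)"
    using c c' near d
    by (intro curve_derivative_change_chart) (auto simp: eventually_at_filter elim: eventually_mono)
  moreover have "v c' (\<gamma> t) = transition_deriv c c' (\<gamma> t) (v c (\<gamma> t))"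
    using field c c' unfolding smooth_vector_field_def by blast
  ultimately show "((coord c' \<circ> \<gamma>) has_vector_derivative v c' (\<gamma> t)) (at t)" by simp
qed

lemma smooth_local_field: "c \<in> A \<Longrightarrow> smooth_on (chart_im c) (\<lambda>x. v c (chart_inv c x))"
  using field unfolding smooth_vector_field_def by blast

text \<open>Read in a chart ball, both curves solve the same Lipschitz equation, so
  \<open>ode_unique\<close> applies for a short time.\<close>

lemma icurve_locally_unique:
  assumes g: "\<forall>\<^sub>F s in nhds t. icurve_at \<gamma> s" and d: "\<forall>\<^sub>F s in nhds t. icurve_at \<delta> s" and eq: "\<gamma> t = \<delta> t"
  shows "\<forall>\<^sub>F s in nhds t. \<gamma> s = \<delta> s"
proof -
  have gt: "icurve_at \<gamma> t" "icurve_at \<delta> t" using g d eventually_nhds_x_imp_x by blast+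
  then have "\<gamma> t \<in> topspace M" by (simp add: icurve_at_def)
  then obtain c where c: "c \<in> A" "\<gamma> t \<in> chart_dom c" using chart_ex by blast
  let ?x = "coord c (\<gamma> t)"
  obtain R where R: "R > 0" "cball ?x R \<subseteq> chart_im c"
    using coordinate_ball[OF c openin_topspace \<open>\<gamma> t \<in> topspace M\<close>] by metis
  let ?f = "\<lambda>x. v c (chart_inv c x)"
  obtain L where L: "L > 0" "\<And>y z. y \<in> cball ?x R \<Longrightarrow> z \<in> cball ?x R \<Longrightarrow> norm (?f y - ?f z) \<le> L * norm (y - z)"
    using smooth_on_imp_lipschitz_cball[OF smooth_local_field[OF c(1)] R(2)] by blast
  let ?N = "chart_preimage c (ball ?x R)"
  have "openin M ?N" "\<gamma> t \<in> ?N" using openin_chart_preimage[OF c(1) open_ball] c R by (auto simp: chart_preimage_def)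
  then have "\<forall>\<^sub>F s in nhds t. \<gamma> s \<in> ?N" "\<forall>\<^sub>F s in nhds t. \<delta> s \<in> ?N"
    using gt icurve_at_nbhd eq by metis+
  then have "\<forall>\<^sub>F s in nhds t. icurve_at \<gamma> s \<and> icurve_at \<delta> s \<and> \<gamma> s \<in> ?N \<and> \<delta> s \<in> ?N"
    using g d by eventually_elim simp
  then obtain e where e: "e > 0" "\<And>s. dist s t < e \<Longrightarrow> icurve_at \<gamma> s \<and> icurve_at \<delta> s \<and> \<gamma> s \<in> ?N \<and> \<delta> s \<in> ?N"
    by (auto simp: eventually_nhds_metric)
  have dom: "\<gamma> s \<in> chart_dom c" "\<delta> s \<in> chart_dom c" if "dist s t < e" for s
    using e(2)[OF that] by (auto simp: chart_preimage_def)
  have curve: "(coord c \<circ> \<kappa>) s \<in> cball ?x R \<and> ((coord c \<circ> \<kappa>) has_vector_derivative ?f ((coord c \<circ> \<kappa>) s)) (at s)"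
    if "icurve_at \<kappa> s" "\<kappa> s \<in> ?N" for \<kappa> s
  proof -
    have "\<kappa> s \<in> chart_dom c" "coord c (\<kappa> s) \<in> ball ?x R" using that(2) by (auto simp: chart_preimage_def)
    then show ?thesis using that(1) c by (auto simp: icurve_at_def)
  qed
  have "\<gamma> s = \<delta> s" if s: "dist s t < min e (1 / (2 * L))" for s
  proof -
    have "(coord c \<circ> \<gamma>) s = (coord c \<circ> \<delta>) s"
    proof (rule ode_unique[OF L(1), where T = "cball ?x R" and F = ?f and I = "ball t e" and ?t0.0 = t])
      show "norm (?f y - ?f z) \<le> L * norm (y - z)" if "y \<in> cball ?x R" "z \<in> cball ?x R" for y z
        using L(2) that by blast
      show "\<bar>s - t\<bar> \<le> 1 / (2 * L)" using s by (simp add: dist_real_def)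
      show "(coord c \<circ> \<gamma>) r \<in> cball ?x R \<and> ((coord c \<circ> \<gamma>) has_vector_derivative ?f ((coord c \<circ> \<gamma>) r)) (at r)"
        and "(coord c \<circ> \<delta>) r \<in> cball ?x R \<and> ((coord c \<circ> \<delta>) has_vector_derivative ?f ((coord c \<circ> \<delta>) r)) (at r)"
        if "r \<in> ball t e" for r
        using curve e(2)[of r] that by (simp_all only: mem_ball dist_commute)
      show "t \<in> ball t e" "s \<in> ball t e" using e(1) s by (auto simp: dist_commute)
      show "(coord c \<circ> \<gamma>) t = (coord c \<circ> \<delta>) t" using eq by simp
    qed auto
    then show ?thesis using coord_inj[OF c(1)] dom[of s] s by (auto simp: inj_on_def)
  qed
  then show ?thesis using e(1) L(1) unfolding eventually_nhds_metric
    by (intro exI[of _ "min e (1 / (2 * L))"]) auto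
qed

text \<open>Near every time of \<open>I\<close> the curves either agree or differ throughout: the
  first by local uniqueness, the second because \<open>M\<close> is Hausdorff. Connectedness of
  \<open>I\<close> leaves one alternative.\<close>

lemma icurve_unique:
  assumes I: "open I" "connected I" "t0 \<in> I" "t \<in> I"
    and g: "\<And>s. s \<in> I \<Longrightarrow> icurve_at \<gamma> s" and d: "\<And>s. s \<in> I \<Longrightarrow> icurve_at \<delta> s" and eq: "\<gamma> t0 = \<delta> t0"
  shows "\<gamma> t = \<delta> t"
proof -
  let ?U = "{s. \<forall>\<^sub>F r in nhds s. \<gamma> r = \<delta> r}" and ?V = "{s. \<forall>\<^sub>F r in nhds s. \<gamma> r \<noteq> \<delta> r}"
  have open_ev: "open {s::real. \<forall>\<^sub>F r in nhds s. P r}" for P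
  proof (subst open_subopen, intro ballI)
    fix s assume "s \<in> {s::real. \<forall>\<^sub>F r in nhds s. P r}"
    then obtain S where "open S" "s \<in> S" "\<forall>r\<in>S. P r" by (auto simp: eventually_nhds)
    then show "\<exists>T. open T \<and> s \<in> T \<and> T \<subseteq> {s. \<forall>\<^sub>F r in nhds s. P r}"
      unfolding eventually_nhds by blast
  qed
  have "I \<subseteq> ?U \<union> ?V"
  proof
    fix s assume s: "s \<in> I"
    then have "\<forall>\<^sub>F r in nhds s. r \<in> I" using I(1) eventually_nhds_in_open by blast
    then have ev: "\<forall>\<^sub>F r in nhds s. icurve_at \<gamma> r" "\<forall>\<^sub>F r in nhds s. icurve_at \<delta> r"
      using g d by (auto elim: eventually_mono)
    show "s \<in> ?U \<union> ?V"
    proof (cases "\<gamma> s = \<delta> s")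
      case True
      then show ?thesis using icurve_locally_unique ev by blast
    next
      case False
      have "\<gamma> s \<in> topspace M" "\<delta> s \<in> topspace M" using g d s by (auto simp: icurve_at_def)
      then obtain U V where UV: "openin M U" "openin M V" "\<gamma> s \<in> U" "\<delta> s \<in> V" "disjnt U V"
        using hausdorff False unfolding Hausdorff_space_def by blast
      have "\<forall>\<^sub>F r in nhds s. \<gamma> r \<in> U" "\<forall>\<^sub>F r in nhds s. \<delta> r \<in> V"
        using icurve_at_nbhd g d s UV by blast+
      then have "\<forall>\<^sub>F r in nhds s. \<gamma> r \<noteq> \<delta> r"
        by eventually_elim (use UV(5) in \<open>auto simp: disjnt_iff\<close>)
      then show ?thesis by blast
    qed
  qed
  moreover have "?U \<inter> ?V \<inter> I = {}"
    using eventually_nhds_x_imp_x by blast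
  ultimately have "?U \<inter> I = {} \<or> ?V \<inter> I = {}"
    using connectedD[OF I(2) open_ev open_ev] by blast
  moreover have "t0 \<in> ?U"
    using \<open>I \<subseteq> ?U \<union> ?V\<close> I(3) eq eventually_nhds_x_imp_x[of _ t0] by blast
  ultimately have "t \<in> ?U" using \<open>I \<subseteq> ?U \<union> ?V\<close> I(3,4) by blast
  then show ?thesis using eventually_nhds_x_imp_x by blast
qed

section \<open>Flow boxes and completeness\<close>

lemma flow_box:
  assumes "m \<in> topspace M"
  shows "\<exists>N \<tau> \<Phi>. openin M N \<and> m \<in> N \<and> \<tau> > 0 \<and>
    continuous_map (prod_topology (subtopology M N) (top_of_set {-\<tau><..<\<tau>})) M (\<lambda>(x, t). \<Phi> x t) \<and>
    (\<forall>x\<in>N. \<Phi> x 0 = x \<and> (\<forall>t. \<bar>t\<bar> < \<tau> \<longrightarrow> icurve_at (\<Phi> x) t))"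
proof -
  obtain c where c: "c \<in> A" "m \<in> chart_dom c" using chart_ex assms by blast
  let ?x = "coord c m"
  obtain r \<tau> \<phi> where r: "r > 0" "\<tau> > 0"
    and cont: "continuous_on (ball ?x r \<times> {-\<tau><..<\<tau>}) (\<lambda>(x, t). \<phi> x t)"
    and phi0: "\<And>x. x \<in> ball ?x r \<Longrightarrow> \<phi> x 0 = x"
    and phi: "\<And>x t. x \<in> ball ?x r \<Longrightarrow> \<bar>t\<bar> < \<tau> \<Longrightarrow> \<phi> x t \<in> chart_im c \<and>
      (\<phi> x has_vector_derivative v c (chart_inv c (\<phi> x t))) (at t)"
    by (rule local_flow[OF smooth_local_field[OF c(1)] chart_open(2)[OF c(1)] imageI[OF c(2)]]) (rule that; assumption)
  define N where "N = chart_preimage c (ball ?x r)"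
  define \<Phi> where "\<Phi> x t = chart_inv c (\<phi> (coord c x) t)" for x t
  have N: "openin M N" "m \<in> N"
    using openin_chart_preimage[OF c(1) open_ball] c r by (auto simp: N_def chart_preimage_def)
  have Nx: "x \<in> chart_dom c" "coord c x \<in> ball ?x r" if "x \<in> N" for x
    using that by (auto simp: N_def chart_preimage_def)
  have NM: "N \<subseteq> topspace M" using openin_subset N(1) by blast
  let ?X = "prod_topology (subtopology M N) (top_of_set {-\<tau><..<\<tau>})"
  have "continuous_map ?X M (\<lambda>p. chart_inv c ((\<lambda>(x, t). \<phi> x t) (coord c (fst p), snd p)))"
  proof (rule continuous_chart_inv_compose[OF c(1)])
    have "continuous_map ?X M fst"
      using continuous_map_restrict_range[of _ M N] continuous_map_fst[of "subtopology M N"] by blast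
    then have "continuous_map ?X euclidean (\<lambda>p. coord c (fst p))"
      by (rule continuous_coord_compose[OF c(1)]) (use Nx in auto)
    moreover have "continuous_map ?X euclidean snd"
      using continuous_map_restrict_range continuous_map_snd by blast
    ultimately have "continuous_map ?X euclidean (\<lambda>p. (coord c (fst p), snd p))"
      using continuous_map_pairedI[of ?X euclidean "\<lambda>p. coord c (fst p)" euclidean snd] by simp
    then have "continuous_map ?X (top_of_set (ball ?x r \<times> {-\<tau><..<\<tau>})) (\<lambda>p. (coord c (fst p), snd p))"
      using Nx by (auto simp: continuous_map_in_subtopology)
    moreover have "continuous_map (top_of_set (ball ?x r \<times> {-\<tau><..<\<tau>})) euclidean (\<lambda>(x, t). \<phi> x t)"
      using cont by simp
    ultimately show "continuous_map ?X euclidean (\<lambda>p. (\<lambda>(x, t). \<phi> x t) (coord c (fst p), snd p))"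
      using continuous_map_compose[unfolded o_def] by blast
    show "(\<lambda>(x, t). \<phi> x t) (coord c (fst p), snd p) \<in> chart_im c" if p: "p \<in> topspace ?X" for p
    proof -
      have "coord c (fst p) \<in> ball ?x r" "\<bar>snd p\<bar> < \<tau>" using p Nx by auto
      then show ?thesis using phi by simp
    qed
  qed
  then have C: "continuous_map ?X M (\<lambda>(x, t). \<Phi> x t)"
    by (simp add: \<Phi>_def case_prod_unfold)
  have P: "\<forall>x\<in>N. \<Phi> x 0 = x \<and> (\<forall>t. \<bar>t\<bar> < \<tau> \<longrightarrow> icurve_at (\<Phi> x) t)"
  proof (intro ballI conjI allI impI)
    fix x assume x: "x \<in> N"
    show "\<Phi> x 0 = x" using phi0[OF Nx(2)[OF x]] Nx(1)[OF x] c by (simp add: \<Phi>_def)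
    fix t assume t: "\<bar>t\<bar> < \<tau>"
    have dom: "\<Phi> x s \<in> chart_dom c" if "\<bar>s\<bar> < \<tau>" for s
      using phi[OF Nx(2)[OF x] that] by (simp add: \<Phi>_def chart_inv_in)
    show "icurve_at (\<Phi> x) t"
    proof (rule icurve_atI[where c = c and \<gamma> = "\<Phi> x" and t = t, OF c(1)])
      show "\<Phi> x t \<in> chart_dom c" by (rule dom[OF t])
      have "\<forall>\<^sub>F s in nhds t. s \<in> {-\<tau><..<\<tau>}" using t by (intro eventually_nhds_in_open) auto
      then show "\<forall>\<^sub>F s in nhds t. \<Phi> x s \<in> chart_dom c" by eventually_elim (use dom in auto)
      have "(\<phi> (coord c x) has_vector_derivative v c (\<Phi> x t)) (at t)"
        using phi[OF Nx(2)[OF x] t] by (simp add: \<Phi>_def)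
      then show "((coord c \<circ> \<Phi> x) has_vector_derivative v c (\<Phi> x t)) (at t)"
      proof (rule has_vector_derivative_transform_within_open[where S = "{-\<tau><..<\<tau>}"])
        fix s assume "s \<in> {-\<tau><..<\<tau>}"
        then have "\<phi> (coord c x) s \<in> chart_im c" using phi[OF Nx(2)[OF x], of s] by auto
        then show "\<phi> (coord c x) s = (coord c \<circ> \<Phi> x) s" by (simp add: \<Phi>_def)
      qed (use t in auto)
    qed
  qed
  show ?thesis
  proof (rule exI[of _ N], rule exI[of _ \<tau>], rule exI[of _ \<Phi>], intro conjI)
    show "openin M N" by (rule N)
    show "m \<in> N" by (rule N)
    show "0 < \<tau>" by (rule r)
    show "continuous_map ?X M (\<lambda>(x, t). \<Phi> x t)" by (rule C)
    show "\<forall>x\<in>N. \<Phi> x 0 = x \<and> (\<forall>t. \<bar>t\<bar> < \<tau> \<longrightarrow> icurve_at (\<Phi> x) t)" by (rule P)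
  qed
qed

text \<open>Compactness yields one time for all points; this is what makes the flow
  complete.\<close>

lemma uniform_flow_box:
  "\<exists>\<tau>>0. \<forall>m\<in>topspace M. \<exists>N \<Phi>. openin M N \<and> m \<in> N \<and>
    continuous_map (prod_topology (subtopology M N) (top_of_set {-\<tau><..<\<tau>})) M (\<lambda>(x, t). \<Phi> x t) \<and>
    (\<forall>x\<in>N. \<Phi> x 0 = x \<and> (\<forall>t. \<bar>t\<bar> < \<tau> \<longrightarrow> icurve_at (\<Phi> x) t))"
proof -
  define good where "good N \<tau> \<Phi> \<longleftrightarrow> openin M N \<and>
    continuous_map (prod_topology (subtopology M N) (top_of_set {-\<tau><..<\<tau>})) M (\<lambda>(x, t). \<Phi> x t) \<and>
    (\<forall>x\<in>N. \<Phi> x 0 = x \<and> (\<forall>t. \<bar>t\<bar> < \<tau> \<longrightarrow> icurve_at (\<Phi> x) t))" for N \<tau> \<Phi>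
  have "\<forall>m\<in>topspace M. \<exists>N \<tau> \<Phi>. m \<in> N \<and> \<tau> > 0 \<and> good N \<tau> \<Phi>"
  proof
    fix m assume "m \<in> topspace M"
    from flow_box[OF this] show "\<exists>N \<tau> \<Phi>. m \<in> N \<and> \<tau> > 0 \<and> good N \<tau> \<Phi>"
      unfolding good_def by (elim exE conjE) (intro exI conjI; assumption)
  qed
  then obtain N \<tau> \<Phi> where N: "\<And>m. m \<in> topspace M \<Longrightarrow> m \<in> N m \<and> \<tau> m > 0 \<and> good (N m) (\<tau> m) (\<Phi> m)"
    by metis
  obtain F where F: "finite F" "F \<subseteq> topspace M" "topspace M \<subseteq> (\<Union>x\<in>F. N x)"
    by (rule compactin_pointwise_cover[of M "topspace M" N])
      (use compact N in \<open>auto simp: compact_space_def good_def\<close>)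
  define t where "t = Min (insert 1 (\<tau> ` F))"
  have t: "t > 0" "\<And>m. m \<in> F \<Longrightarrow> t \<le> \<tau> m" using F N by (auto simp: t_def)
  have "good (N m) t (\<Phi> m)" if "m \<in> F" for m
  proof -
    have g: "good (N m) (\<tau> m) (\<Phi> m)" using N F that by blast
    then have "continuous_map (subtopology (prod_topology (subtopology M (N m)) (top_of_set {-\<tau> m<..<\<tau> m})) (UNIV \<times> {-t<..<t})) M (\<lambda>(x, t). \<Phi> m x t)"
      unfolding good_def by (simp add: continuous_map_from_subtopology)
    moreover have "{-\<tau> m<..<\<tau> m} \<inter> {-t<..<t} = {-t<..<t}" using t(2)[OF that] by auto
    ultimately have "continuous_map (prod_topology (subtopology M (N m)) (top_of_set {-t<..<t})) M (\<lambda>(x, t). \<Phi> m x t)"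
      by (simp add: subtopology_Times subtopology_subtopology)
    then show ?thesis using g t(2)[OF that] by (auto simp: good_def)
  qed
  then have "\<forall>m\<in>topspace M. \<exists>N \<Phi>. m \<in> N \<and> good N t \<Phi>"
    using F(3) by blast
  show ?thesis
  proof (intro exI[of _ t] conjI ballI t(1))
    fix m assume "m \<in> topspace M"
    then obtain N \<Phi> where "m \<in> N" "good N t \<Phi>"
      using \<open>\<forall>m\<in>topspace M. \<exists>N \<Phi>. m \<in> N \<and> good N t \<Phi>\<close> by blast
    then show "\<exists>N \<Phi>. openin M N \<and> m \<in> N \<and>
      continuous_map (prod_topology (subtopology M N) (top_of_set {-t<..<t})) M (\<lambda>(x, t). \<Phi> x t) \<and>
      (\<forall>x\<in>N. \<Phi> x 0 = x \<and> (\<forall>s. \<bar>s\<bar> < t \<longrightarrow> icurve_at (\<Phi> x) s))"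
      unfolding good_def by (elim conjE) (intro exI conjI; assumption)
  qed
qed

definition box_time :: real where
  "box_time = (SOME \<tau>. \<tau> > 0 \<and> (\<forall>m\<in>topspace M. \<exists>N \<Phi>. openin M N \<and> m \<in> N \<and>
    continuous_map (prod_topology (subtopology M N) (top_of_set {-\<tau><..<\<tau>})) M (\<lambda>(x, t). \<Phi> x t) \<and>
    (\<forall>x\<in>N. \<Phi> x 0 = x \<and> (\<forall>t. \<bar>t\<bar> < \<tau> \<longrightarrow> icurve_at (\<Phi> x) t))))"

lemma box_time: "box_time > 0"
  and flow_box': "m \<in> topspace M \<Longrightarrow> \<exists>N \<Phi>. openin M N \<and> m \<in> N \<and>
    continuous_map (prod_topology (subtopology M N) (top_of_set {-box_time<..<box_time})) M (\<lambda>(x, t). \<Phi> x t) \<and>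
    (\<forall>x\<in>N. \<Phi> x 0 = x \<and> (\<forall>t. \<bar>t\<bar> < box_time \<longrightarrow> icurve_at (\<Phi> x) t))"
proof -
  note ex = someI_ex[OF uniform_flow_box, folded box_time_def]
  show "box_time > 0" by (rule conjunct1[OF ex])
  show "m \<in> topspace M \<Longrightarrow> \<exists>N \<Phi>. openin M N \<and> m \<in> N \<and>
    continuous_map (prod_topology (subtopology M N) (top_of_set {-box_time<..<box_time})) M (\<lambda>(x, t). \<Phi> x t) \<and>
    (\<forall>x\<in>N. \<Phi> x 0 = x \<and> (\<forall>t. \<bar>t\<bar> < box_time \<longrightarrow> icurve_at (\<Phi> x) t))"
    by (rule bspec[OF conjunct2[OF ex]])
qed

text \<open>Because the guaranteed time \<open>box_time\<close> does not depend on the point, the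
  curve can be restarted near both ends and gains half of it on either side.\<close>

lemma icurve_extend:
  assumes x: "x \<in> topspace M" and T: "T \<ge> box_time"
    and g: "\<And>t. \<bar>t\<bar> < T \<Longrightarrow> icurve_at \<gamma> t" "\<gamma> 0 = x"
  shows "\<exists>\<delta>. \<delta> 0 = x \<and> (\<forall>t. \<bar>t\<bar> < T + box_time / 2 \<longrightarrow> icurve_at \<delta> t)"
proof -
  define b where "b = box_time"
  \<comment> \<open>Restarting at \<open>a\<close> rather than at the end \<open>T\<close> leaves
    the overlap from \<open>a\<close> to \<open>T\<close> for gluing, while the new curve lives up
    to \<open>a + b = T + b / 2\<close>.\<close>
  define a where "a = T - b / 2"
  have b: "b > 0" "T \<ge> b" using box_time T by (auto simp: b_def)
  have short: "\<exists>\<delta>. \<delta> s = \<gamma> s \<and> (\<forall>t. \<bar>t - s\<bar> < b \<longrightarrow> icurve_at \<delta> t)" if "\<bar>s\<bar> < T" for s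
  proof -
    have "\<gamma> s \<in> topspace M" using g(1)[OF that] by (simp add: icurve_at_def)
    then obtain \<Phi> where P: "\<Phi> (\<gamma> s) 0 = \<gamma> s" "\<And>t. \<bar>t\<bar> < b \<Longrightarrow> icurve_at (\<Phi> (\<gamma> s)) t"
      using flow_box'[OF \<open>\<gamma> s \<in> topspace M\<close>] unfolding b_def by blast
    show ?thesis
      using P icurve_at_shift[of "\<Phi> (\<gamma> s)" _ "- s"] by (intro exI[of _ "\<lambda>t. \<Phi> (\<gamma> s) (t + - s)"]) auto
  qed
  obtain p where p: "p a = \<gamma> a" "\<And>t. \<bar>t - a\<bar> < b \<Longrightarrow> icurve_at p t"
    using short[of a] b by (auto simp: a_def)
  obtain q where q: "q (- a) = \<gamma> (- a)" "\<And>t. \<bar>t + a\<bar> < b \<Longrightarrow> icurve_at q t"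
    using short[of "- a"] b by (auto simp: a_def)
  have pg: "p t = \<gamma> t" if "a - b / 2 < t" "t < T" for t
    by (rule icurve_unique[where I = "{a - b / 2<..<T}" and ?t0.0 = a])
      (use p g b that in \<open>auto simp: a_def abs_less_iff\<close>)
  have qg: "q t = \<gamma> t" if "- T < t" "t < - a + b / 2" for t
    by (rule icurve_unique[where I = "{- T<..<- a + b / 2}" and ?t0.0 = "- a"])
      (use q g b that in \<open>auto simp: a_def abs_less_iff\<close>)
  define \<delta> where "\<delta> t = (if t > a then p t else if t < - a then q t else \<gamma> t)" for t
  have dg: "\<delta> t = \<gamma> t" if "\<bar>t\<bar> < T" for t
    using that pg[of t] qg[of t] b by (auto simp: \<delta>_def a_def abs_less_iff)
  have "icurve_at \<delta> t" if t: "\<bar>t\<bar> < T + b / 2" for t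
  proof -
    consider "\<bar>t\<bar> < T" | "t > a" | "t < - a" using b unfolding a_def by linarith
    then show ?thesis
    proof cases
      case 1
      have "\<forall>\<^sub>F s in nhds t. s \<in> {-T<..<T}" using 1 by (intro eventually_nhds_in_open) auto
      then have "\<forall>\<^sub>F s in nhds t. \<gamma> s = \<delta> s" by eventually_elim (use dg in auto)
      then show ?thesis using icurve_at_cong g(1)[OF 1] by blast
    next
      case 2
      have "\<forall>\<^sub>F s in nhds t. s \<in> {a<..}" using 2 by (intro eventually_nhds_in_open) auto
      then have "\<forall>\<^sub>F s in nhds t. p s = \<delta> s" by eventually_elim (auto simp: \<delta>_def)
      moreover have "icurve_at p t" using p(2) 2 t b by (auto simp: a_def abs_less_iff)
      ultimately show ?thesis using icurve_at_cong by blast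
    next
      case 3
      have "\<forall>\<^sub>F s in nhds t. s \<in> {..<-a}" using 3 by (intro eventually_nhds_in_open) auto
      then have "\<forall>\<^sub>F s in nhds t. q s = \<delta> s" by eventually_elim (use b in \<open>auto simp: \<delta>_def a_def\<close>)
      moreover have "icurve_at q t" using q(2) 3 t b by (auto simp: a_def abs_less_iff)
      ultimately show ?thesis using icurve_at_cong by blast
    qed
  qed
  moreover have "\<delta> 0 = x" using dg[of 0] b g(2) by simp
  ultimately show ?thesis unfolding b_def by blast
qed

lemma global_integral_curve:
  assumes x: "x \<in> topspace M"
  shows "\<exists>\<gamma>. integral_curve M A v \<gamma> \<and> \<gamma> 0 = x"
proof -
  let ?b = "box_time"
  define T where "T n = ?b + real n * (?b / 2)" for n
  have b: "?b > 0" by (rule box_time)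
  have "\<exists>\<gamma>. \<gamma> 0 = x \<and> (\<forall>t. \<bar>t\<bar> < T n \<longrightarrow> icurve_at \<gamma> t)" for n
  proof (induction n)
    case 0
    then show ?case using flow_box'[OF x] by (auto simp: T_def)
  next
    case (Suc n)
    then obtain \<gamma> where "\<gamma> 0 = x" "\<forall>t. \<bar>t\<bar> < T n \<longrightarrow> icurve_at \<gamma> t" by blast
    moreover have "T n \<ge> ?b" using b by (simp add: T_def)
    moreover have "T (Suc n) = T n + ?b / 2" by (simp add: T_def algebra_simps add_divide_distrib)
    ultimately show ?case using icurve_extend[OF x] by metis
  qed
  then obtain G where G: "\<And>n. G n 0 = x" "\<And>n t. \<bar>t\<bar> < T n \<Longrightarrow> icurve_at (G n) t" by metis
  have Gu: "G n t = G k t" if "\<bar>t\<bar> < T n" "\<bar>t\<bar> < T k" for n k t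
    by (rule icurve_unique[where I = "{- min (T n) (T k)<..<min (T n) (T k)}" and ?t0.0 = 0])
      (use G that in \<open>auto simp: abs_less_iff\<close>)
  have ex: "\<exists>n. \<bar>t\<bar> < T n" for t
  proof -
    obtain n where "\<bar>t\<bar> / (?b / 2) < real n" using reals_Archimedean2 by blast
    then have "\<bar>t\<bar> < real n * (?b / 2)" using b by (simp add: field_simps)
    then have "\<bar>t\<bar> < T n" unfolding T_def using b by linarith
    then show ?thesis ..
  qed
  \<comment> \<open>Any admissible stage may be chosen, since \<open>Gu\<close> makes all stages
    agree; near \<open>t\<close> the curve therefore equals the single stage
    \<open>G (N t)\<close>.\<close>
  define N where "N t = (SOME n. \<bar>t\<bar> < T n)" for t
  have N: "\<bar>t\<bar> < T (N t)" for t using someI_ex[OF ex[of t]] by (simp add: N_def)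
  define \<gamma> where "\<gamma> t = G (N t) t" for t
  have "icurve_at \<gamma> t" for t
  proof -
    have "\<forall>\<^sub>F s in nhds t. s \<in> {- T (N t)<..<T (N t)}"
      using N[of t] by (intro eventually_nhds_in_open) (auto simp: abs_less_iff)
    then have "\<forall>\<^sub>F s in nhds t. G (N t) s = \<gamma> s"
      by eventually_elim (use Gu[OF _ N] in \<open>auto simp: \<gamma>_def abs_less_iff\<close>)
    then show ?thesis using icurve_at_cong G(2)[OF N] by blast
  qed
  then show ?thesis using G(1) by (auto simp: integral_curve_iff \<gamma>_def intro!: exI[of _ \<gamma>])
qed

section \<open>The global flow and its continuity\<close>

abbreviation fl :: "'a \<Rightarrow> real \<Rightarrow> 'a" where "fl \<equiv> flow M A v"

lemma flow_unique: "integral_curve M A v \<gamma> \<Longrightarrow> fl (\<gamma> 0) = \<gamma>"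
  unfolding flow_def
proof (rule the_equality)
  fix \<delta> assume "integral_curve M A v \<gamma>" "integral_curve M A v \<delta> \<and> \<delta> 0 = \<gamma> 0"
  then show "\<delta> = \<gamma>"
    using icurve_unique[of UNIV 0 _ \<delta> \<gamma>] by (auto simp: integral_curve_iff)
qed simp

lemma
  assumes "x \<in> topspace M"
  shows flow_curve: "integral_curve M A v (fl x)" and flow_0: "fl x 0 = x"
proof -
  obtain \<gamma> where "integral_curve M A v \<gamma>" "\<gamma> 0 = x" using global_integral_curve assms by blast
  then show "integral_curve M A v (fl x)" "fl x 0 = x" using flow_unique by metis+
qed

lemma flow_icurve: "x \<in> topspace M \<Longrightarrow> icurve_at (fl x) t"
  using flow_curve by (simp add: integral_curve_iff)

lemma flow_in: "x \<in> topspace M \<Longrightarrow> fl x t \<in> topspace M"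
  using flow_icurve by (simp add: icurve_at_def)

lemma flow_add: "x \<in> topspace M \<Longrightarrow> fl (fl x s) t = fl x (s + t)"
proof -
  assume x: "x \<in> topspace M"
  have "integral_curve M A v (\<lambda>t. fl x (t + s))"
    using flow_icurve[OF x] icurve_at_shift by (auto simp: integral_curve_iff)
  from flow_unique[OF this] have "fl (fl x s) = (\<lambda>t. fl x (t + s))" by simp
  then show ?thesis by (simp add: add.commute)
qed

lemma flow_zero: "p \<in> zeros M A v \<Longrightarrow> fl p t = p"
proof -
  assume p: "p \<in> zeros M A v"
  then have "p \<in> topspace M" and 0: "\<And>c. c \<in> A \<Longrightarrow> p \<in> chart_dom c \<Longrightarrow> v c p = 0"
    by (auto simp: zeros_def)
  then have "integral_curve M A v (\<lambda>_. p)"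
    by (auto simp: integral_curve_def o_def)
  from flow_unique[OF this] show ?thesis by simp
qed

lemma flow_continuous_short:
  "continuous_map (prod_topology M (top_of_set {-box_time<..<box_time})) M (\<lambda>(x, t). fl x t)"
proof (rule continuous_map_locally)
  let ?J = "{-box_time<..<box_time}"
  fix p assume "p \<in> topspace (prod_topology M (top_of_set ?J))"
  then obtain m t where p: "p = (m, t)" "m \<in> topspace M" "t \<in> ?J" by auto
  obtain N \<Phi> where N: "openin M N" "m \<in> N"
    and cont: "continuous_map (prod_topology (subtopology M N) (top_of_set ?J)) M (\<lambda>(x, t). \<Phi> x t)"
    and P: "\<And>x. x \<in> N \<Longrightarrow> \<Phi> x 0 = x \<and> (\<forall>t. \<bar>t\<bar> < box_time \<longrightarrow> icurve_at (\<Phi> x) t)"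
    using flow_box'[OF p(2)] by blast
  have NM: "N \<subseteq> topspace M" using N(1) openin_subset by blast
  have eq: "\<Phi> x t = fl x t" if "x \<in> N" "t \<in> ?J" for x t
    by (rule icurve_unique[where I = ?J and ?t0.0 = 0])
      (use P[OF that(1)] that NM flow_icurve flow_0 box_time in \<open>auto simp: abs_less_iff\<close>)
  have "continuous_map (prod_topology (subtopology M N) (top_of_set ?J)) M (\<lambda>(x, t). fl x t)"
    by (rule continuous_map_eq[OF cont]) (use eq in auto)
  then have "continuous_map (subtopology (prod_topology M (top_of_set ?J)) (N \<times> ?J)) M (\<lambda>(x, t). fl x t)"
    by (simp add: subtopology_Times subtopology_subtopology)
  then show "\<exists>U. openin (prod_topology M (top_of_set ?J)) U \<and> p \<in> U \<and>
      continuous_map (subtopology (prod_topology M (top_of_set ?J)) U) M (\<lambda>(x, t). fl x t)"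
    using N p by (intro exI[of _ "N \<times> ?J"]) (auto simp: openin_prod_Times_iff)
qed

text \<open>A long time is cut into \<open>n\<close> steps shorter than \<open>box_time\<close>, and
  the short-time maps are composed.\<close>

lemma flow_continuous_fixed_time: "continuous_map M M (\<lambda>x. fl x t)"
proof -
  have short: "continuous_map M M (\<lambda>x. fl x s)" if "\<bar>s\<bar> < box_time" for s
    using continuous_map_Pair_left[OF _ flow_continuous_short, of s] that by (auto simp: abs_less_iff)
  obtain n where n: "\<bar>t\<bar> / box_time < real n" using reals_Archimedean2 by blast
  then have n0: "n > 0" using box_time by (metis abs_ge_zero divide_nonneg_pos gr0I linorder_not_less of_nat_0)
  define s where "s = t / real n"
  have s: "\<bar>s\<bar> < box_time" using n n0 box_time by (simp add: s_def field_simps)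
  have "continuous_map M M (\<lambda>x. fl x (real k * s))" for k
  proof (induction k)
    case 0
    show ?case by (rule continuous_map_eq[of M M id]) (auto simp: flow_0)
  next
    case (Suc k)
    have "continuous_map M M (\<lambda>x. fl (fl x (real k * s)) s)"
      using continuous_map_compose[OF Suc short[OF s]] by (simp add: o_def)
    then show ?case
      by (rule continuous_map_eq) (simp add: flow_add algebra_simps)
  qed
  from this[of n] show ?thesis using n0 by (simp add: s_def)
qed

text \<open>Near time \<open>t0\<close> the flow factors through the time-\<open>t0\<close> map,
  which reduces joint continuity to short times.\<close>

lemma flow_continuous: "continuous_map (prod_topology M euclideanreal) M (\<lambda>(x, t). fl x t)"
proof (rule continuous_map_locally)
  fix p assume "p \<in> topspace (prod_topology M euclideanreal)"
  then obtain m t0 where p: "p = (m, t0)" "m \<in> topspace M" by auto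
  let ?b = box_time
  let ?J = "{t0 - ?b<..<t0 + ?b}"
  let ?X = "prod_topology M (top_of_set ?J)"
  have "continuous_map ?X M (\<lambda>p. fl (fst p) t0)"
    using continuous_map_compose[OF continuous_map_fst flow_continuous_fixed_time] by (simp add: o_def)
  moreover have "continuous_map ?X euclidean snd"
    using continuous_map_restrict_range continuous_map_snd by blast
  then have "continuous_map ?X (top_of_set {-?b<..<?b}) (\<lambda>p. snd p - t0)"
    by (auto simp: continuous_map_in_subtopology intro!: continuous_map_diff)
  ultimately have "continuous_map ?X (prod_topology M (top_of_set {-?b<..<?b})) (\<lambda>p. (fl (fst p) t0, snd p - t0))"
    by (rule continuous_map_pairedI)
  from continuous_map_compose[OF this flow_continuous_short]
  have "continuous_map ?X M (\<lambda>p. fl (fl (fst p) t0) (snd p - t0))" by (simp add: o_def)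
  then have "continuous_map ?X M (\<lambda>(x, t). fl x t)"
    by (rule continuous_map_eq) (auto simp: flow_add)
  then show "\<exists>U. openin (prod_topology M euclideanreal) U \<and> p \<in> U \<and>
      continuous_map (subtopology (prod_topology M euclideanreal) U) M (\<lambda>(x, t). fl x t)"
    using p box_time by (intro exI[of _ "topspace M \<times> ?J"]) (auto simp: openin_prod_Times_iff subtopology_Times)
qed

lemma continuous_flow_compose:
  assumes "continuous_map X M f" "continuous_map X euclideanreal \<tau>"
  shows "continuous_map X M (\<lambda>x. fl (f x) (\<tau> x))"
  using continuous_map_compose[OF continuous_map_pairedI[OF assms] flow_continuous] by (simp add: o_def)

end

section \<open>The topology of the Riemannian distance\<close>

locale riemannian_manifold = closed_manifold M A
  for M :: "'a topology" and A :: "('a, 'e::real_normed_vector) chart set" +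
  fixes g :: "('a, 'e) metric_tensor"
  assumes metric: "riemannian_metric_on A (topspace M) g"
begin

lemma dom_Int: "c \<in> A \<Longrightarrow> chart_dom c \<inter> topspace M = chart_dom c"
  using chart_subset by blast

lemmas metric_parts = metric[unfolded riemannian_metric_on_def]

lemma metric_local:
  assumes "c \<in> A" "m \<in> chart_dom c"
  shows "bilinear (g c m) \<and> (\<forall>u w. g c m u w = g c m w u) \<and> (\<forall>w. w \<noteq> 0 \<longrightarrow> g c m w w > 0)"
  using bspec[OF bspec[OF conjunct1[OF metric_parts] assms(1)], of m] assms dom_Int by auto

lemma metric_bilinear: "c \<in> A \<Longrightarrow> m \<in> chart_dom c \<Longrightarrow> bilinear (g c m)"
  by (rule conjunct1[OF metric_local])

lemma metric_pos: "c \<in> A \<Longrightarrow> m \<in> chart_dom c \<Longrightarrow> w \<noteq> 0 \<Longrightarrow> g c m w w > 0"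
  by (rule mp[OF spec[OF conjunct2[OF conjunct2[OF metric_local]]]])

lemma metric_smooth: "c \<in> A \<Longrightarrow> smooth_on (chart_im c) (\<lambda>x. g c (chart_inv c x) u w)"
  using spec[OF spec[OF bspec[OF conjunct1[OF conjunct2[OF metric_parts]]]], of c u w] by (simp add: dom_Int)

lemma metric_change:
  assumes "c \<in> A" "c' \<in> A" "m \<in> chart_dom c \<inter> chart_dom c'"
  shows "g c m u w = g c' m (transition_deriv c c' m u) (transition_deriv c c' m w)"
proof -
  have "m \<in> chart_dom c \<inter> chart_dom c' \<inter> topspace M" using assms chart_subset by blast
  note h = bspec[OF bspec[OF bspec[OF conjunct2[OF conjunct2[OF metric_parts]] assms(1)] assms(2)] this]
  show ?thesis by (rule spec[OF spec[OF h, of u], of w])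
qed

lemma metric_zero: "c \<in> A \<Longrightarrow> m \<in> chart_dom c \<Longrightarrow> g c m 0 w = 0"
  using metric_bilinear bilinear_lzero by blast

lemma metric_nonneg: "c \<in> A \<Longrightarrow> m \<in> chart_dom c \<Longrightarrow> g c m w w \<ge> 0"
  using metric_pos metric_zero by (cases "w = 0") (auto simp: less_imp_le)

lemma continuous_on_metric:
  assumes c: "c \<in> A" and p: "continuous_on T p" "\<And>x. x \<in> T \<Longrightarrow> p x \<in> chart_im c"
    and u: "continuous_on T u" and w: "continuous_on T w"
  shows "continuous_on T (\<lambda>x. g c (chart_inv c (p x)) (u x) (w x))"
proof -
  have lin: "linear (g c (chart_inv c (p x)) a)" "linear (\<lambda>b. g c (chart_inv c (p x)) b a)" if "x \<in> T" for x a
    using metric_bilinear[OF c chart_inv_in[OF p(2)[OF that]]] by (simp_all add: bilinear_def)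
  have fixed: "continuous_on T (\<lambda>x. g c (chart_inv c (p x)) a b)" for a b
  proof -
    from smooth_on_imp_continuous_on[OF metric_smooth[OF c]] show ?thesis
      by (rule continuous_on_compose2[OF _ p(1)]) (use p(2) in auto)
  qed
  have first: "continuous_on T (\<lambda>x. g c (chart_inv c (p x)) (u x) b)" for b
    by (rule continuous_on_linear_apply[where h = "\<lambda>x a. g c (chart_inv c (p x)) a b", OF lin(2) _ u]) (assumption | rule fixed)+
  show ?thesis
    by (rule continuous_on_linear_apply[where h = "\<lambda>x b. g c (chart_inv c (p x)) (u x) b", OF lin(1) _ w]) (assumption | rule first)+
qed

text \<open>The quadratic form attains a positive minimum and a maximum on the compact product of
  the ball and the unit sphere; homogeneity extends the bounds to all vectors.\<close>

lemma metric_bounds: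
  assumes c: "c \<in> A" and r: "cball x r \<subseteq> chart_im c"
  obtains \<kappa> K where "\<kappa> > 0" "K > 0"
    "\<And>m w. m \<in> chart_preimage c (cball x r) \<Longrightarrow> \<kappa> * norm w \<le> sqrt (g c m w w) \<and> sqrt (g c m w w) \<le> K * norm w"
proof -
  define T where "T = cball x r \<times> sphere (0::'e) 1"
  define q where "q z = g c (chart_inv c (fst z)) (snd z) (snd z)" for z
  have "closed {x::'e. norm x = 1}" by (intro closed_Collect_eq continuous_intros)
  then have "closed (sphere (0::'e) 1)" by (simp add: sphere_def dist_norm)
  then have "compact (cball 0 1 \<inter> sphere (0::'e) 1)"
    by (rule compact_Int_closed[OF fd_compact_cball])
  moreover have "cball 0 1 \<inter> sphere (0::'e) 1 = sphere 0 1" by auto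
  ultimately have cT: "compact T" unfolding T_def by (intro compact_Times fd_compact_cball) simp
  have cq: "continuous_on T q" unfolding q_def
    by (rule continuous_on_metric[OF c]) (use r in \<open>auto simp: T_def intro!: continuous_intros\<close>)
  have qpos: "q z > 0" if "z \<in> T" for z
  proof -
    have "chart_inv c (fst z) \<in> chart_dom c" using that r by (intro chart_inv_in) (auto simp: T_def)
    moreover have "snd z \<noteq> 0" using that by (auto simp: T_def)
    ultimately show ?thesis unfolding q_def by (rule metric_pos[OF c])
  qed
  \<comment> \<open>\<open>T\<close> is empty when the model space is zero-dimensional and has no
    unit vectors, or when \<open>r\<close> is negative; any positive constants do then.\<close>
  obtain l U where lU: "l > 0" "U > 0" "\<And>z. z \<in> T \<Longrightarrow> l \<le> q z \<and> q z \<le> U"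
  proof (cases "T = {}")
    case True
    then show ?thesis using that[of 1 1] by auto
  next
    case False
    obtain z1 z2 where "z1 \<in> T" "\<And>z. z \<in> T \<Longrightarrow> q z1 \<le> q z" "z2 \<in> T" "\<And>z. z \<in> T \<Longrightarrow> q z \<le> q z2"
      using continuous_attains_inf[OF cT False cq] continuous_attains_sup[OF cT False cq] by metis
    then show ?thesis using that[of "q z1" "q z2"] qpos by blast
  qed
  have "sqrt l * norm w \<le> sqrt (g c m w w) \<and> sqrt (g c m w w) \<le> sqrt U * norm w"
    if m: "m \<in> chart_preimage c (cball x r)" for m w
  proof (cases "w = 0")
    case True
    then show ?thesis using metric_zero[OF c, of m] m by (simp add: chart_preimage_def)
  next
    case False
    let ?w = "(1 / norm w) *\<^sub>R w"
    have m': "m \<in> chart_dom c" "coord c m \<in> cball x r" using m by (auto simp: chart_preimage_def)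
    have "(coord c m, ?w) \<in> T" using m' False by (simp add: T_def)
    from lU(3)[OF this] have b: "l \<le> g c m ?w ?w" "g c m ?w ?w \<le> U" using c m' by (simp_all add: q_def)
    have "g c m w w = g c m (norm w *\<^sub>R ?w) (norm w *\<^sub>R ?w)" using False by simp
    also have "\<dots> = (norm w)^2 * g c m ?w ?w"
      using bilinear_lmul[OF metric_bilinear[OF c m'(1)]] bilinear_rmul[OF metric_bilinear[OF c m'(1)]]
      by (simp add: power2_eq_square)
    finally have "sqrt (g c m w w) = norm w * sqrt (g c m ?w ?w)" by (simp add: real_sqrt_mult)
    moreover have "sqrt l * norm w \<le> norm w * sqrt (g c m ?w ?w)" "norm w * sqrt (g c m ?w ?w) \<le> sqrt U * norm w"
      using b mult_left_mono[of _ _ "norm w"] by (simp_all add: mult.commute[of _ "norm w"])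
    ultimately show ?thesis by simp
  qed
  then show ?thesis using that[of "sqrt l" "sqrt U"] lU(1,2) by simp
qed

section \<open>Speed and length of curves\<close>

lemma at_within_Icc_nontrivial: "a < b \<Longrightarrow> t \<in> {a..b} \<Longrightarrow> at t within {a..b::real} \<noteq> bot"
  by (simp add: islimpt_Icc trivial_limit_within)

lemma curve_near:
  assumes "continuous_map (top_of_set S) M \<gamma>" "t \<in> S" "openin M U" "\<gamma> t \<in> U"
  shows "\<forall>\<^sub>F s in at t within (S::real set). \<gamma> s \<in> U"
proof -
  have "openin (top_of_set S) {s \<in> S. \<gamma> s \<in> U}"
    using openin_continuous_map_preimage[OF assms(1,3)] by simp
  then obtain V where V: "open V" "{s \<in> S. \<gamma> s \<in> U} = S \<inter> V" by (auto simp: openin_open)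
  then have "t \<in> V" using assms(2,4) by blast
  then have "\<forall>\<^sub>F s in at t within S. s \<in> V" using V(1) by (rule_tac topological_tendstoD[OF tendsto_ident_at])
  moreover have "\<forall>\<^sub>F s in at t within S. s \<in> S" by (simp add: eventually_at_filter)
  ultimately show ?thesis by eventually_elim (use V(2) in blast)
qed

text \<open>The chart in \<open>speed\<close> is picked by \<open>SOME\<close>. The transformation
  laws of velocities and of the metric cancel, so any chart around the point computes the same
  value.\<close>

lemma speed_eq:
  assumes ab: "a < b" "t \<in> {a..b}" and cont: "continuous_map (top_of_set {a..b}) M \<gamma>"
    and c: "c \<in> A" "\<gamma> t \<in> chart_dom c" and d: "((coord c \<circ> \<gamma>) has_vector_derivative w) (at t within {a..b})"
  shows "speed A g \<gamma> a b t = sqrt (g c (\<gamma> t) w w)"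
proof -
  define c' where "c' = (SOME c. c \<in> A \<and> \<gamma> t \<in> chart_dom c)"
  have c': "c' \<in> A" "\<gamma> t \<in> chart_dom c'"
    using someI[of "\<lambda>c. c \<in> A \<and> \<gamma> t \<in> chart_dom c" c] c by (auto simp: c'_def)
  have "\<forall>\<^sub>F s in at t within {a..b}. \<gamma> s \<in> chart_dom c"
    by (rule curve_near[OF cont ab(2) chart_open(1)[OF c(1)] c(2)])
  from curve_derivative_change_chart[OF c(1) c'(1) _ ab(2) this d]
  have "((coord c' \<circ> \<gamma>) has_vector_derivative transition_deriv c c' (\<gamma> t) w) (at t within {a..b})"
    using c c' by blast
  from vector_derivative_within[OF at_within_Icc_nontrivial[OF ab] this]
  have "vector_derivative (coord c' \<circ> \<gamma>) (at t within {a..b}) = transition_deriv c c' (\<gamma> t) w" .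
  then have "speed A g \<gamma> a b t = sqrt (g c' (\<gamma> t) (transition_deriv c c' (\<gamma> t) w) (transition_deriv c c' (\<gamma> t) w))"
    by (simp add: speed_def Let_def flip: c'_def)
  then show ?thesis using metric_change[OF c(1) c'(1), of "\<gamma> t" w w] c c' by simp
qed

text \<open>The coordinate segment is smooth in its own chart, but \<open>C1_curve_on\<close> speaks
  of every chart that it meets; there the velocity is the image of \<open>y - x\<close> under the
  transition derivative.\<close>

lemma segment_C1:
  assumes c: "c \<in> A" and seg: "closed_segment x y \<subseteq> chart_im c"
  defines "\<gamma> \<equiv> \<lambda>t. chart_inv c (x + t *\<^sub>R (y - x))"
  shows "C1_curve_on M A \<gamma> 0 1"
    and "t \<in> {0..1} \<Longrightarrow> \<gamma> t \<in> chart_dom c"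
    and "t \<in> {0..1} \<Longrightarrow> ((coord c \<circ> \<gamma>) has_vector_derivative (y - x)) (at t within {0..1})"
proof -
  let ?l = "\<lambda>t. x + t *\<^sub>R (y - x)"
  have l: "?l t \<in> chart_im c" if "t \<in> {0..1}" for t
  proof -
    have "?l t = (1 - t) *\<^sub>R x + t *\<^sub>R y" by (simp add: algebra_simps)
    then show ?thesis using seg that by (auto simp: closed_segment_def)
  qed
  then show dom: "\<gamma> t \<in> chart_dom c" if "t \<in> {0..1}" for t
    using that by (simp add: \<gamma>_def chart_inv_in)
  have cont: "continuous_map (top_of_set {0..1}) M \<gamma>" unfolding \<gamma>_def
    by (rule continuous_chart_inv_compose[OF c]) (use l in \<open>auto intro!: continuous_intros\<close>)
  show d: "((coord c \<circ> \<gamma>) has_vector_derivative (y - x)) (at t within {0..1})" if "t \<in> {0..1}" for t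
  proof -
    have "(?l has_vector_derivative (y - x)) (at t within {0..1})"
      by (auto intro!: derivative_eq_intros)
    then show ?thesis
      by (rule has_vector_derivative_transform_within[where d = 1]) (use that l in \<open>auto simp: \<gamma>_def\<close>)
  qed
  have d': "((coord c' \<circ> \<gamma>) has_vector_derivative transition_deriv c c' (\<gamma> t) (y - x)) (at t within {0..1})"
    if "c' \<in> A" "t \<in> {0..1}" "\<gamma> t \<in> chart_dom c'" for c' t
    using curve_derivative_change_chart[OF c that(1) _ that(2) curve_near[OF cont that(2) chart_open(1)[OF c]] d[OF that(2)]]
      dom[OF that(2)] that(3) by blast
  show "C1_curve_on M A \<gamma> 0 1"
    unfolding C1_curve_on_def
  proof (intro conjI ballI impI cont)
    fix c' t assume "c' \<in> A" "t \<in> {0..1::real}" "\<gamma> t \<in> chart_dom c'"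
    from d'[OF this] show "(coord c' \<circ> \<gamma>) differentiable (at t within {0..1})"
      by (rule differentiableI_vector)
  next
    fix c' assume c': "c' \<in> A"
    let ?T = "{t \<in> {0..1}. \<gamma> t \<in> chart_dom c'}"
    have "?l t \<in> coord c ` (chart_dom c \<inter> chart_dom c')" if t: "t \<in> ?T" for t
    proof -
      have "coord c (\<gamma> t) = ?l t" using l[of t] t by (simp add: \<gamma>_def)
      then show ?thesis using dom[of t] t by (metis (no_types, lifting) IntI image_eqI mem_Collect_eq)
    qed
    moreover have "continuous_on ?T ?l" by (intro continuous_intros)
    ultimately have "continuous_on ?T (\<lambda>t. transition_deriv c c' (chart_inv c (?l t)) (y - x))"
      using continuous_on_compose2[OF continuous_on_transition_deriv[OF c c'], of ?T ?l] by blast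
    then show "continuous_on ?T (\<lambda>t. vector_derivative (coord c' \<circ> \<gamma>) (at t within {0..1}))"
    proof (rule continuous_on_eq)
      fix t assume t: "t \<in> ?T"
      then have "vector_derivative (coord c' \<circ> \<gamma>) (at t within {0..1}) = transition_deriv c c' (\<gamma> t) (y - x)"
        by (intro vector_derivative_within at_within_Icc_nontrivial d'[OF c']) auto
      then show "transition_deriv c c' (chart_inv c (?l t)) (y - x) = vector_derivative (coord c' \<circ> \<gamma>) (at t within {0..1})"
        by (simp add: \<gamma>_def)
    qed
  qed
qed

text \<open>Coordinate segments between nearby points are short. Hence the topology of
  \<open>M\<close> is at least as fine as that of the distance.\<close>

lemma riem_dist_small:
  assumes y: "y \<in> topspace M" and \<delta>: "\<delta> > 0"
  obtains N where "openin M N" "y \<in> N" "\<And>a b. a \<in> N \<Longrightarrow> b \<in> N \<Longrightarrow> riem_dist M A g a b < ereal \<delta>"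
proof -
  obtain c r where c: "c \<in> A" "y \<in> chart_dom c" "r > 0" "cball (coord c y) r \<subseteq> chart_im c"
    using coordinate_ball_ex[OF openin_topspace y] by metis
  obtain K where K: "K > 0" "\<And>m w. m \<in> chart_preimage c (cball (coord c y) r) \<Longrightarrow> sqrt (g c m w w) \<le> K * norm w"
    using metric_bounds[OF c(1,4)] by metis
  \<comment> \<open>Two points of the ball are less than \<open>2 * \<rho>\<close> apart, so the
    segment has length at most \<open>2 * K * \<rho> \<le> \<delta> / 2\<close>.\<close>
  define \<rho> where "\<rho> = min r (\<delta> / (4 * K))"
  have rho: "\<rho> > 0" "\<rho> \<le> r" "\<rho> \<le> \<delta> / (4 * K)" using c(3) \<delta> K(1) by (auto simp: \<rho>_def)
  define N where "N = chart_preimage c (ball (coord c y) \<rho>)"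
  have "riem_dist M A g a b < ereal \<delta>" if "a \<in> N" "b \<in> N" for a b
  proof -
    let ?x = "coord c a" and ?z = "coord c b"
    have ab: "a \<in> chart_dom c" "b \<in> chart_dom c" "?x \<in> ball (coord c y) \<rho>" "?z \<in> ball (coord c y) \<rho>"
      using that by (auto simp: N_def chart_preimage_def)
    have segb: "closed_segment ?x ?z \<subseteq> cball (coord c y) r"
      using closed_segment_subset[OF ab(3,4) convex_ball] rho by auto
    then have seg: "closed_segment ?x ?z \<subseteq> chart_im c" using c(4) by blast
    define \<gamma> where "\<gamma> = (\<lambda>t. chart_inv c (?x + t *\<^sub>R (?z - ?x)))"
    have C1: "C1_curve_on M A \<gamma> 0 1" "\<And>t. t \<in> {0..1} \<Longrightarrow> \<gamma> t \<in> chart_dom c"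
      "\<And>t. t \<in> {0..1} \<Longrightarrow> ((coord c \<circ> \<gamma>) has_vector_derivative (?z - ?x)) (at t within {0..1})"
      unfolding \<gamma>_def by (rule segment_C1[OF c(1) seg]; assumption)+
    have contg: "continuous_map (top_of_set {0..1}) M \<gamma>" using C1(1) by (simp add: C1_curve_on_def)
    have "norm (?z - ?x) \<le> dist (coord c y) ?z + dist (coord c y) ?x"
      using dist_triangle[of ?z ?x "coord c y"] by (simp add: dist_norm norm_minus_commute)
    then have nzx: "norm (?z - ?x) \<le> 2 * \<rho>" using ab by simp
    have sp: "speed A g \<gamma> 0 1 t \<le> K * (2 * \<rho>)" if t: "t \<in> {0..1}" for t
    proof -
      have "?x + t *\<^sub>R (?z - ?x) = (1 - t) *\<^sub>R ?x + t *\<^sub>R ?z" by (simp add: algebra_simps)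
      then have "?x + t *\<^sub>R (?z - ?x) \<in> closed_segment ?x ?z" using t by (auto simp: closed_segment_def)
      then have "coord c (\<gamma> t) \<in> cball (coord c y) r"
        using segb seg unfolding \<gamma>_def by (subst coord_chart_inv) blast+
      then have "\<gamma> t \<in> chart_preimage c (cball (coord c y) r)" using C1(2)[OF t] by (simp add: chart_preimage_def)
      moreover have "speed A g \<gamma> 0 1 t = sqrt (g c (\<gamma> t) (?z - ?x) (?z - ?x))"
        by (rule speed_eq[OF _ t contg c(1) C1(2)[OF t] C1(3)[OF t]]) simp
      ultimately have "speed A g \<gamma> 0 1 t \<le> K * norm (?z - ?x)" using K(2) by simp
      also have "\<dots> \<le> K * (2 * \<rho>)" using nzx K(1) by simp
      finally show ?thesis .
    qed
    have len: "curve_length A g \<gamma> 0 1 \<le> K * (2 * \<rho>)"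
    \<comment> \<open>A non-integrable speed would have integral 0 by convention, and this value
      satisfies the bound as well.\<close>
    proof (cases "speed A g \<gamma> 0 1 integrable_on {0..1}")
      case True
      then have "integral {0..1} (speed A g \<gamma> 0 1) \<le> integral {0..1::real} (\<lambda>_. K * (2 * \<rho>))"
        using sp by (intro integral_le) auto
      then show ?thesis by (simp add: curve_length_def)
    next
      case False
      then show ?thesis using K(1) rho(1) by (simp add: curve_length_def not_integrable_integral)
    qed
    have "K * (2 * \<rho>) \<le> \<delta> / 2" using rho(3) K(1) by (simp add: field_simps)
    then have len2: "curve_length A g \<gamma> 0 1 < \<delta>" using len \<delta> by linarith
    have "\<gamma> 0 = a" "\<gamma> 1 = b" using c(1) ab by (simp_all add: \<gamma>_def)
    \<comment> \<open>The segment is a single piece, with break points \<open>real 0\<close> and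
      \<open>real 1\<close>.\<close>
    then have "riem_dist M A g a b \<le> ereal (\<Sum>i<1. curve_length A g \<gamma> (real i) (real (Suc i)))"
      unfolding riem_dist_def using C1(1)
      by (intro Inf_lower CollectI exI[of _ "1::nat"] exI[of _ real] exI[of _ \<gamma>]) auto
    then show ?thesis using len2 by (simp add: le_less_trans)
  qed
  moreover have "openin M N" "y \<in> N"
    using openin_chart_preimage[OF c(1) open_ball] c(2) rho(1) by (auto simp: N_def chart_preimage_def)
  ultimately show ?thesis using that by blast
qed

text \<open>The chart chosen inside \<open>speed\<close> may jump with the point; locally one fixed
  chart computes it by \<open>speed_eq\<close>.\<close>

lemma speed_continuous:
  assumes ab: "a < b" and C1: "C1_curve_on M A \<gamma> a b"
  shows "continuous_on {a..b} (speed A g \<gamma> a b)"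
proof -
  have cont: "continuous_map (top_of_set {a..b}) M \<gamma>" using C1 by (simp add: C1_curve_on_def)
  have "continuous_map (top_of_set {a..b}) euclideanreal (speed A g \<gamma> a b)"
  proof (rule continuous_map_locally)
    fix t assume "t \<in> topspace (top_of_set {a..b})"
    then have t: "t \<in> {a..b}" by simp
    then have "\<gamma> t \<in> topspace M" using continuous_map_image_subset_topspace[OF cont] by auto
    then obtain c where c: "c \<in> A" "\<gamma> t \<in> chart_dom c" using chart_ex by blast
    let ?T = "{s \<in> {a..b}. \<gamma> s \<in> chart_dom c}"
    let ?w = "\<lambda>s. vector_derivative (coord c \<circ> \<gamma>) (at s within {a..b})"
    have op: "openin (top_of_set {a..b}) ?T"
      using openin_continuous_map_preimage[OF cont chart_open(1)[OF c(1)]] by simp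
    have cT: "continuous_map (top_of_set ?T) M \<gamma>"
      using continuous_map_from_subtopology[OF cont, of ?T] by (simp add: subtopology_subtopology inf_absorb2 subset_eq)
    have "continuous_map (top_of_set ?T) euclidean (\<lambda>s. coord c (\<gamma> s))"
      by (rule continuous_coord_compose[OF c(1) cT]) auto
    then have cc: "continuous_on ?T (\<lambda>s. coord c (\<gamma> s))" by simp
    have wc: "continuous_on ?T ?w" using C1 c(1) by (simp add: C1_curve_on_def)
    have "continuous_on ?T (\<lambda>s. sqrt (g c (chart_inv c (coord c (\<gamma> s))) (?w s) (?w s)))"
      by (intro continuous_on_real_sqrt continuous_on_metric[OF c(1) cc] wc) auto
    then have "continuous_on ?T (speed A g \<gamma> a b)"
    proof (rule continuous_on_eq)
      fix s assume s: "s \<in> ?T"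
      then have "(coord c \<circ> \<gamma>) differentiable (at s within {a..b})" using C1 c(1) by (simp add: C1_curve_on_def)
      then have "((coord c \<circ> \<gamma>) has_vector_derivative ?w s) (at s within {a..b})"
        by (metis vector_derivative_works)
      from speed_eq[OF ab _ cont c(1) _ this] s
      show "sqrt (g c (chart_inv c (coord c (\<gamma> s))) (?w s) (?w s)) = speed A g \<gamma> a b s"
        using c(1) by simp
    qed
    then show "\<exists>U. openin (top_of_set {a..b}) U \<and> t \<in> U \<and>
        continuous_map (subtopology (top_of_set {a..b}) U) euclideanreal (speed A g \<gamma> a b)"
      using op t c(2) by (intro exI[of _ ?T]) (auto simp: subtopology_subtopology inf_absorb2 subset_eq)
  qed
  then show ?thesis by simp
qed

lemma speed_nonneg: "speed A g \<gamma> a b t \<ge> 0" if "\<gamma> t \<in> topspace M"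
proof -
  define c where "c = (SOME c. c \<in> A \<and> \<gamma> t \<in> chart_dom c)"
  have "c \<in> A \<and> \<gamma> t \<in> chart_dom c"
    unfolding c_def using chart_ex[OF that] by (intro someI_ex[of "\<lambda>c. c \<in> A \<and> \<gamma> t \<in> chart_dom c"]) blast
  then show ?thesis using metric_nonneg by (simp add: speed_def Let_def flip: c_def)
qed

text \<open>\<open>u\<close> is \<kappa> times the coordinate distance to \<open>x\<close>,
  truncated at \<open>r\<close> and continued by its largest value; along a curve it drops by at
  most the length. Only the stretch after the last time outside the open ball needs an estimate,
  because \<open>u\<close> never exceeds \<open>\<kappa> * r\<close>.\<close>

lemma curve_length_lower:
  assumes c: "c \<in> A" and r: "cball x r \<subseteq> chart_im c" "r > 0" and \<kappa>: "\<kappa> > 0"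
    "\<And>m w. m \<in> chart_preimage c (cball x r) \<Longrightarrow> \<kappa> * norm w \<le> sqrt (g c m w w)"
    and ab: "a < b" and C1: "C1_curve_on M A \<gamma> a b"
  defines "u \<equiv> \<lambda>q. if q \<in> chart_preimage c (ball x r) then \<kappa> * dist (coord c q) x else \<kappa> * r"
  shows "u (\<gamma> a) \<le> curve_length A g \<gamma> a b + u (\<gamma> b)"
proof -
  let ?s = "speed A g \<gamma> a b"
  let ?O = "chart_preimage c (ball x r)" and ?C = "chart_preimage c (cball x r)"
  have cont: "continuous_map (top_of_set {a..b}) M \<gamma>" using C1 by (simp add: C1_curve_on_def)
  have inM: "\<gamma> t \<in> topspace M" if "t \<in> {a..b}" for t
    using continuous_map_image_subset_topspace[OF cont] that by auto
  have sc: "continuous_on {a..b} ?s" by (rule speed_continuous[OF ab C1])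
  have s0: "?s t \<ge> 0" if "t \<in> {a..b}" for t using speed_nonneg inM that by blast
  have int: "?s integrable_on {p..q}" if "a \<le> p" "q \<le> b" for p q
    using that by (intro integrable_continuous_real continuous_on_subset[OF sc]) auto
  have u_le: "u q \<le> \<kappa> * r" for q
    using \<kappa>(1) by (auto simp: u_def chart_preimage_def dist_commute)
  \<comment> \<open>A final stretch inside the closed ball: there \<kappa> times the norm of the
    coordinate velocity is at most the speed, so the mean value inequality bounds the coordinate
    displacement.\<close>
  have tail: "\<kappa> * dist (coord c (\<gamma> \<tau>)) x \<le> curve_length A g \<gamma> a b + \<kappa> * dist (coord c (\<gamma> b)) x"
    if tau: "a \<le> \<tau>" "\<tau> < b" and inC: "\<And>t. t \<in> {\<tau>..b} \<Longrightarrow> \<gamma> t \<in> ?C" for \<tau>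
  proof -
    let ?f = "coord c \<circ> \<gamma>"
    have dom: "\<gamma> t \<in> chart_dom c" if "t \<in> {\<tau>..b}" for t using inC[OF that] by (simp add: chart_preimage_def)
    define w where "w t = vector_derivative ?f (at t within {a..b})" for t
    have d: "(?f has_vector_derivative w t) (at t within {a..b})" if "t \<in> {\<tau>..b}" for t
      using C1 c dom[OF that] that tau unfolding w_def C1_curve_on_def
      by (metis (no_types, lifting) atLeastAtMost_iff order_trans vector_derivative_works)
    have wb: "\<kappa> * norm (w t) \<le> ?s t" if "t \<in> {\<tau>..b}" for t
    proof -
      have "?s t = sqrt (g c (\<gamma> t) (w t) (w t))"
        using that tau by (intro speed_eq[OF ab _ cont c dom[OF that] d[OF that]]) auto
      then show ?thesis using \<kappa>(2)[OF inC[OF that]] by simp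
    qed
    let ?p = "\<lambda>t. integral {\<tau>..t} ?s"
    have "norm (\<kappa> *\<^sub>R ?f b - \<kappa> *\<^sub>R ?f \<tau>) \<le> ?p b - ?p \<tau>"
    proof (rule differentiable_bound_general[OF tau(2), where f' = "\<lambda>t. \<kappa> *\<^sub>R w t" and \<phi>' = ?s])
      have "continuous_on {\<tau>..b} ?f"
      proof (rule continuous_on_vector_derivative)
        show "(?f has_vector_derivative w t) (at t within {\<tau>..b})" if "t \<in> {\<tau>..b}" for t
          by (rule has_vector_derivative_within_subset[OF d[OF that]]) (use tau in auto)
      qed
      then show "continuous_on {\<tau>..b} (\<lambda>t. \<kappa> *\<^sub>R ?f t)" by (intro continuous_intros)
      show "continuous_on {\<tau>..b} ?p" by (intro indefinite_integral_continuous_1 int tau order_refl)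
      fix t assume t: "\<tau> < t" "t < b"
      have "(?f has_vector_derivative w t) (at t)"
        using d[of t] t tau by (simp add: at_within_Icc_at)
      then show "((\<lambda>t. \<kappa> *\<^sub>R ?f t) has_vector_derivative \<kappa> *\<^sub>R w t) (at t)"
        by (rule bounded_linear.has_vector_derivative[OF bounded_linear_scaleR_right])
      have "(?p has_vector_derivative ?s t) (at t within {\<tau>..b})"
        using t tau by (intro integral_has_vector_derivative continuous_on_subset[OF sc]) auto
      then show "(?p has_vector_derivative ?s t) (at t)" using t by (simp add: at_within_Icc_at)
      show "norm (\<kappa> *\<^sub>R w t) \<le> ?s t" using wb[of t] t \<kappa>(1) by simp
    qed
    then have "norm (\<kappa> *\<^sub>R (?f b - ?f \<tau>)) \<le> integral {\<tau>..b} ?s" by (simp add: scaleR_diff_right)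
    then have "\<kappa> * dist (?f b) (?f \<tau>) \<le> integral {\<tau>..b} ?s" using \<kappa>(1) by (simp add: dist_norm)
    also have "\<dots> \<le> integral {a..b} ?s"
      using tau s0 by (intro integral_subset_le int) auto
    finally have "\<kappa> * dist (?f b) (?f \<tau>) \<le> curve_length A g \<gamma> a b" by (simp add: curve_length_def)
    moreover have "\<kappa> * dist (?f \<tau>) x \<le> \<kappa> * (dist (?f b) (?f \<tau>) + dist (?f b) x)"
      using \<kappa>(1) dist_triangle2[of "?f \<tau>" x "?f b"] by (intro mult_left_mono) (auto simp: dist_commute)
    ultimately show ?thesis by (simp add: distrib_left)
  qed
  have OC: "?O \<subseteq> ?C" by (auto simp: chart_preimage_def)
  define E where "E = {t \<in> {a..b}. \<gamma> t \<notin> ?O}"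
  show ?thesis
  proof (cases "E = {}")
    case True
    then have "\<gamma> t \<in> ?O" if "t \<in> {a..b}" for t using that by (auto simp: E_def)
    then show ?thesis using tail[of a] OC ab by (auto simp: u_def subset_eq)
  next
    case False
    have clE: "closedin (top_of_set {a..b}) E"
    proof -
      have "openin (top_of_set {a..b}) {t \<in> {a..b}. \<gamma> t \<in> ?O}"
        using openin_continuous_map_preimage[OF cont openin_chart_preimage[OF c open_ball]] by simp
      moreover have "E = {a..b} - {t \<in> {a..b}. \<gamma> t \<in> ?O}" by (auto simp: E_def)
      ultimately show ?thesis using closedin_diff[OF closedin_topspace, of "top_of_set {a..b}"] by simp
    qed
    then have "compact E" using closedin_compact by blast
    \<comment> \<open>\<tau> is the last time outside the open ball; it exists because
      \<open>E\<close> is compact.\<close>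
    then obtain \<tau> where tau: "\<tau> \<in> E" "\<And>t. t \<in> E \<Longrightarrow> t \<le> \<tau>"
      using False compact_attains_sup by metis
    have tab: "a \<le> \<tau>" "\<tau> \<le> b" "\<gamma> \<tau> \<notin> ?O" using tau(1) by (auto simp: E_def)
    show ?thesis
    proof (cases "\<tau> = b")
      case True
      have "curve_length A g \<gamma> a b \<ge> 0"
        unfolding curve_length_def by (rule Henstock_Kurzweil_Integration.integral_nonneg[OF int s0]) auto
      moreover have "u (\<gamma> b) = \<kappa> * r" using True tab by (simp add: u_def)
      ultimately show ?thesis using u_le[of "\<gamma> a"] by linarith
    next
      case False
      then have tb: "\<tau> < b" using tab by simp
      have inO: "\<gamma> t \<in> ?O" if "\<tau> < t" "t \<le> b" for t
        using tau(2)[of t] that tab by (force simp: E_def)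
      have clC: "closed {t \<in> {a..b}. \<gamma> t \<in> ?C}"
      proof -
        have "closedin (top_of_set {a..b}) {t \<in> {a..b}. \<gamma> t \<in> ?C}"
          using closedin_continuous_map_preimage[OF cont closedin_chart_preimage[OF c fd_compact_cball r(1)]] by simp
        then show ?thesis using closedin_closed_trans by blast
      qed
      have "{\<tau><..b} \<subseteq> {t \<in> {a..b}. \<gamma> t \<in> ?C}" using inO OC tab by auto
      \<comment> \<open>Passing to the closure puts the point at time \<tau> into the closed ball.
        As it is outside the open ball, it lies on the sphere.\<close>
      then have "closure {\<tau><..b} \<subseteq> {t \<in> {a..b}. \<gamma> t \<in> ?C}" using clC closure_minimal by blast
      then have inC: "\<gamma> t \<in> ?C" if "t \<in> {\<tau>..b}" for t using that tb by auto
      have "\<gamma> \<tau> \<in> chart_dom c" using inC[of \<tau>] tb by (simp add: chart_preimage_def)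
      then have "r \<le> dist (coord c (\<gamma> \<tau>)) x" using tab(3) by (simp add: chart_preimage_def dist_commute)
      then have "\<kappa> * r \<le> \<kappa> * dist (coord c (\<gamma> \<tau>)) x" using \<kappa>(1) by simp
      also have "\<dots> \<le> curve_length A g \<gamma> a b + \<kappa> * dist (coord c (\<gamma> b)) x"
        by (rule tail[OF tab(1) tb inC])
      also have "\<kappa> * dist (coord c (\<gamma> b)) x = u (\<gamma> b)" using inO[of b] tb by (simp add: u_def)
      finally show ?thesis using u_le[of "\<gamma> a"] by linarith
    qed
  qed
qed

text \<open>Summed over the pieces, the drop of \<open>u\<close> from \<open>\<kappa> * r\<close>
  outside the coordinate ball to 0 at \<open>p\<close> bounds every admissible length from below.
  Together with \<open>riem_dist_small\<close> this matches distance and topology.\<close>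

lemma riem_dist_large:
  assumes N: "openin M N" and p: "p \<in> N"
  obtains \<epsilon> where "\<epsilon> > 0" "\<And>m. riem_dist M A g m p \<le> ereal \<epsilon> \<Longrightarrow> m \<in> N"
proof -
  obtain c r where c: "c \<in> A" "p \<in> chart_dom c" "r > 0" "cball (coord c p) r \<subseteq> chart_im c"
    "chart_preimage c (cball (coord c p) r) \<subseteq> N"
    using coordinate_ball_ex[OF N p] by metis
  let ?x = "coord c p"
  obtain \<kappa> where k: "\<kappa> > 0" "\<And>m w. m \<in> chart_preimage c (cball ?x r) \<Longrightarrow> \<kappa> * norm w \<le> sqrt (g c m w w)"
    using metric_bounds[OF c(1,4)] by metis
  define u where "u q = (if q \<in> chart_preimage c (ball ?x r) then \<kappa> * dist (coord c q) ?x else \<kappa> * r)" for q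
  have up: "u p = 0" using c(2,3) by (simp add: u_def chart_preimage_def)
  have "ereal (\<kappa> * r) \<le> riem_dist M A g m p" if m: "m \<notin> N" for m
    unfolding riem_dist_def
  proof (rule Inf_greatest, clarify)
    fix n t \<gamma>
    assume ends: "m = \<gamma> (t 0)" "p = \<gamma> (t n)"
      and C1: "\<forall>i<n. t i < t (Suc i) \<and> C1_curve_on M A \<gamma> (t i) (t (Suc i))"
    have "u (\<gamma> (t 0)) \<le> (\<Sum>i<k. curve_length A g \<gamma> (t i) (t (Suc i))) + u (\<gamma> (t k))" if "k \<le> n" for k
      using that
    proof (induction k)
      case (Suc k)
      then have "u (\<gamma> (t k)) \<le> curve_length A g \<gamma> (t k) (t (Suc k)) + u (\<gamma> (t (Suc k)))"
        unfolding u_def using C1 by (intro curve_length_lower c k) auto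
      then show ?case using Suc by simp
    qed simp
    from this[of n] have "u m \<le> (\<Sum>i<n. curve_length A g \<gamma> (t i) (t (Suc i)))"
      using up ends by simp
    moreover have "u m = \<kappa> * r" using m c(5) by (auto simp: u_def chart_preimage_def)
    ultimately show "ereal (\<kappa> * r) \<le> ereal (\<Sum>i<n. curve_length A g \<gamma> (t i) (t (Suc i)))" by simp
  qed
  \<comment> \<open>Half of \<open>\<kappa> * r\<close> is taken because the claim has a non-strict
    inequality.\<close>
  moreover have "\<kappa> * r / 2 < \<kappa> * r" "\<kappa> * r / 2 > 0" using k(1) c(3) by auto
  ultimately show ?thesis using that[of "\<kappa> * r / 2"] by (metis ereal_less_eq(3) linorder_not_less order_trans)
qed

end

section \<open>Line integrals of closed 1-forms\<close>

text \<open>\<open>\<Lambda>\<close> is a primitive of the pullback of \<open>\<theta>\<close> along the path \<open>\<gamma>\<close> on \<open>{a..b}\<close>.\<close>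

definition primitive_along :: "'a cform \<Rightarrow> real \<Rightarrow> real \<Rightarrow> (real \<Rightarrow> 'a) \<Rightarrow> (real \<Rightarrow> real) \<Rightarrow> bool" where
  "primitive_along \<theta> a b \<gamma> \<Lambda> \<longleftrightarrow> (\<forall>t\<in>{a..b}. \<forall>U\<in>fst \<theta>. \<gamma> t \<in> U \<longrightarrow>
     (\<exists>V. open V \<and> t \<in> V \<and> (\<forall>s\<in>V \<inter> {a..b}. \<Lambda> s - snd \<theta> U (\<gamma> s) = \<Lambda> t - snd \<theta> U (\<gamma> t))))"

lemma primitive_alongD:
  assumes "primitive_along \<theta> a b \<gamma> \<Lambda>" "t \<in> {a..b}" "U \<in> fst \<theta>" "\<gamma> t \<in> U"
  obtains V where "open V" "t \<in> V" "\<And>s. s \<in> V \<Longrightarrow> s \<in> {a..b} \<Longrightarrow> \<Lambda> s - snd \<theta> U (\<gamma> s) = \<Lambda> t - snd \<theta> U (\<gamma> t)"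
  using mp[OF bspec[OF bspec[OF assms(1)[unfolded primitive_along_def] assms(2)] assms(3)] assms(4)]
  by (elim exE conjE) (rule that, assumption, assumption, erule bspec, blast)

lemma primitive_along_compose:
  assumes p: "primitive_along \<theta> c d \<gamma> \<Lambda>" and \<eta>: "continuous_on {a..b} \<eta>" "\<eta> ` {a..b} \<subseteq> {c..d}"
  shows "primitive_along \<theta> a b (\<lambda>t. \<gamma> (\<eta> t)) (\<lambda>t. \<Lambda> (\<eta> t))"
  unfolding primitive_along_def
proof (intro ballI impI)
  fix t U assume t: "t \<in> {a..b}" and U: "U \<in> fst \<theta>" "\<gamma> (\<eta> t) \<in> U"
  obtain V where V: "open V" "\<eta> t \<in> V"
    "\<And>s. s \<in> V \<Longrightarrow> s \<in> {c..d} \<Longrightarrow> \<Lambda> s - snd \<theta> U (\<gamma> s) = \<Lambda> (\<eta> t) - snd \<theta> U (\<gamma> (\<eta> t))"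
    using primitive_alongD[OF p _ U] t \<eta>(2) by blast
  obtain W where W: "open W" "W \<inter> {a..b} = \<eta> -` V \<inter> {a..b}"
    using \<eta>(1) V(1) unfolding continuous_on_open_invariant by blast
  then have tW: "t \<in> W" using t V(2) by blast
  have W2: "\<Lambda> (\<eta> s) - snd \<theta> U (\<gamma> (\<eta> s)) = \<Lambda> (\<eta> t) - snd \<theta> U (\<gamma> (\<eta> t))" if "s \<in> W \<inter> {a..b}" for s
  proof (rule V(3))
    show "\<eta> s \<in> V" "\<eta> s \<in> {c..d}" using W(2) \<eta>(2) that by blast+
  qed
  show "\<exists>V. open V \<and> t \<in> V \<and> (\<forall>s\<in>V \<inter> {a..b}.
      \<Lambda> (\<eta> s) - snd \<theta> U (\<gamma> (\<eta> s)) = \<Lambda> (\<eta> t) - snd \<theta> U (\<gamma> (\<eta> t)))"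
    by (intro exI[of _ W] conjI ballI W(1) tW W2)
qed

lemma primitive_along_subset:
  "primitive_along \<theta> a b \<gamma> \<Lambda> \<Longrightarrow> a \<le> c \<Longrightarrow> d \<le> b \<Longrightarrow> primitive_along \<theta> c d \<gamma> \<Lambda>"
  by (rule primitive_along_compose[of \<theta> a b \<gamma> \<Lambda> c d "\<lambda>t. t"]) auto

lemma primitive_along_cong:
  assumes "primitive_along \<theta> a b \<gamma> \<Lambda>" "\<And>t. t \<in> {a..b} \<Longrightarrow> \<gamma> t = \<delta> t"
  shows "primitive_along \<theta> a b \<delta> \<Lambda>"
  unfolding primitive_along_def
proof (intro ballI impI)
  fix t U assume t: "t \<in> {a..b}" "U \<in> fst \<theta>" "\<delta> t \<in> U"
  have gU: "\<gamma> t \<in> U" using t(3) assms(2)[OF t(1)] by simp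
  obtain V where V: "open V" "t \<in> V"
    "\<And>s. s \<in> V \<Longrightarrow> s \<in> {a..b} \<Longrightarrow> \<Lambda> s - snd \<theta> U (\<gamma> s) = \<Lambda> t - snd \<theta> U (\<gamma> t)"
    by (rule primitive_alongD[OF assms(1) t(1,2) gU]) (rule that; assumption)
  have V3: "\<Lambda> s - snd \<theta> U (\<delta> s) = \<Lambda> t - snd \<theta> U (\<delta> t)" if "s \<in> V \<inter> {a..b}" for s
    using V(3)[of s] assms(2)[of s] assms(2)[OF t(1)] that by (simp only: Int_iff)
  show "\<exists>V. open V \<and> t \<in> V \<and> (\<forall>s\<in>V \<inter> {a..b}. \<Lambda> s - snd \<theta> U (\<delta> s) = \<Lambda> t - snd \<theta> U (\<delta> t))"
    by (intro exI[of _ V] conjI ballI V(1,2) V3)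
qed

lemma primitive_along_join:
  assumes 1: "primitive_along \<theta> a b \<gamma> \<Lambda>1" and 2: "primitive_along \<theta> b c \<gamma> \<Lambda>2" and abc: "a \<le> b" "b \<le> c"
  shows "primitive_along \<theta> a c \<gamma> (\<lambda>t. if t \<le> b then \<Lambda>1 t else \<Lambda>2 t - \<Lambda>2 b + \<Lambda>1 b)"
    (is "primitive_along \<theta> a c \<gamma> ?L")
  unfolding primitive_along_def
proof (intro ballI impI)
  fix t U assume t: "t \<in> {a..c}" and U: "U \<in> fst \<theta>" "\<gamma> t \<in> U"
  show "\<exists>V. open V \<and> t \<in> V \<and> (\<forall>s\<in>V \<inter> {a..c}. ?L s - snd \<theta> U (\<gamma> s) = ?L t - snd \<theta> U (\<gamma> t))"
  proof (cases t b rule: linorder_cases)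
    case less
    obtain V where V: "open V" "t \<in> V" "\<And>s. s \<in> V \<Longrightarrow> s \<in> {a..b} \<Longrightarrow> \<Lambda>1 s - snd \<theta> U (\<gamma> s) = \<Lambda>1 t - snd \<theta> U (\<gamma> t)"
      using primitive_alongD[OF 1 _ U] t less by auto
    then show ?thesis using less by (intro exI[of _ "V \<inter> {..<b}"]) auto
  next
    case greater
    obtain V where V: "open V" "t \<in> V" "\<And>s. s \<in> V \<Longrightarrow> s \<in> {b..c} \<Longrightarrow> \<Lambda>2 s - snd \<theta> U (\<gamma> s) = \<Lambda>2 t - snd \<theta> U (\<gamma> t)"
      using primitive_alongD[OF 2 _ U] t greater by auto
    show ?thesis
    proof (intro exI[of _ "V \<inter> {b<..}"] conjI ballI)
      fix s assume "s \<in> V \<inter> {b<..} \<inter> {a..c}"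
      then show "?L s - snd \<theta> U (\<gamma> s) = ?L t - snd \<theta> U (\<gamma> t)" using V(3)[of s] greater by auto
    qed (use V greater in auto)
  next
    case equal
    obtain V where V: "open V" "b \<in> V" "\<And>s. s \<in> V \<Longrightarrow> s \<in> {a..b} \<Longrightarrow> \<Lambda>1 s - snd \<theta> U (\<gamma> s) = \<Lambda>1 b - snd \<theta> U (\<gamma> b)"
      using primitive_alongD[OF 1 _ U(1), of b] U(2) abc equal by auto
    obtain W where W: "open W" "b \<in> W" "\<And>s. s \<in> W \<Longrightarrow> s \<in> {b..c} \<Longrightarrow> \<Lambda>2 s - snd \<theta> U (\<gamma> s) = \<Lambda>2 b - snd \<theta> U (\<gamma> b)"
      using primitive_alongD[OF 2 _ U(1), of b] U(2) abc equal by auto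
    show ?thesis
    proof (intro exI[of _ "V \<inter> W"] conjI ballI)
      fix s assume "s \<in> V \<inter> W \<inter> {a..c}"
      then show "?L s - snd \<theta> U (\<gamma> s) = ?L t - snd \<theta> U (\<gamma> t)" using V(3)[of s] W(3)[of s] equal by auto
    qed (use V W equal in auto)
  qed
qed

lemma is_line_integral_join:
  assumes 1: "is_line_integral \<theta> a b \<gamma> I1" and 2: "is_line_integral \<theta> b c \<gamma> I2"
  shows "is_line_integral \<theta> a c \<gamma> (I1 + I2)"
proof -
  obtain \<U> f where \<theta>: "\<theta> = (\<U>, f)" by fastforce
  from 1 obtain N1 t1 U1 where 1: "t1 0 = a" "t1 N1 = b"
    "\<forall>i<N1. t1 i < t1 (Suc i) \<and> U1 i \<in> \<U> \<and> \<gamma> ` {t1 i..t1 (Suc i)} \<subseteq> U1 i"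
    "I1 = (\<Sum>i<N1. f (U1 i) (\<gamma> (t1 (Suc i))) - f (U1 i) (\<gamma> (t1 i)))"
    unfolding is_line_integral_def \<theta> prod.case by (elim exE conjE) (rule that; assumption)
  from 2 obtain N2 t2 U2 where 2: "t2 0 = b" "t2 N2 = c"
    "\<forall>i<N2. t2 i < t2 (Suc i) \<and> U2 i \<in> \<U> \<and> \<gamma> ` {t2 i..t2 (Suc i)} \<subseteq> U2 i"
    "I2 = (\<Sum>i<N2. f (U2 i) (\<gamma> (t2 (Suc i))) - f (U2 i) (\<gamma> (t2 i)))"
    unfolding is_line_integral_def \<theta> prod.case by (elim exE conjE) (rule that; assumption)
  define t where "t i = (if i \<le> N1 then t1 i else t2 (i - N1))" for i
  define U where "U i = (if i < N1 then U1 i else U2 (i - N1))" for i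
  have lo: "t i = t1 i" "t (Suc i) = t1 (Suc i)" "U i = U1 i" if "i < N1" for i
    using that by (auto simp: t_def U_def)
  have hi: "t (N1 + i) = t2 i" "t (Suc (N1 + i)) = t2 (Suc i)" "U (N1 + i) = U2 i" for i
    using 1(2) 2(1) by (auto simp: t_def U_def)
  let ?F = "\<lambda>i. f (U i) (\<gamma> (t (Suc i))) - f (U i) (\<gamma> (t i))"
  have "(\<Sum>i<N1 + N2. ?F i) = (\<Sum>i<N1. ?F i) + (\<Sum>i<N2. ?F (N1 + i))"
    by (induction N2) (auto simp: add.assoc)
  also have "(\<Sum>i<N1. ?F i) = I1" unfolding 1(4) by (rule sum.cong) (auto simp: lo)
  also have "(\<Sum>i<N2. ?F (N1 + i)) = I2" unfolding 2(4) by (rule sum.cong) (auto simp: hi)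
  finally have sum: "I1 + I2 = (\<Sum>i<N1 + N2. ?F i)" by simp
  have "t i < t (Suc i) \<and> U i \<in> \<U> \<and> \<gamma> ` {t i..t (Suc i)} \<subseteq> U i" if i: "i < N1 + N2" for i
  proof (cases "i < N1")
    case True
    then show ?thesis using 1(3) lo by simp
  next
    case False
    then obtain j where "i = N1 + j" "j < N2" using i by (metis add_less_cancel_left le_add_diff_inverse linorder_not_less)
    then show ?thesis using 2(3) hi by simp
  qed
  moreover have "t 0 = a" "t (N1 + N2) = c" using 1(1) hi(1)[of N2] 2(2) by (simp_all add: t_def)
  ultimately show ?thesis unfolding is_line_integral_def \<theta> prod.case
    by (intro exI[of _ "N1 + N2"] exI[of _ t] exI[of _ U] conjI allI impI sum; simp)
qed

lemma
  assumes "continuous_closed_one_form X \<theta>"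
  shows closed_form_open: "U \<in> fst \<theta> \<Longrightarrow> openin X U"
    and closed_form_continuous: "U \<in> fst \<theta> \<Longrightarrow> continuous_map (subtopology X U) euclideanreal (snd \<theta> U)"
    and closed_form_cover: "\<Union>(fst \<theta>) = topspace X"
    and closed_form_diff: "U \<in> fst \<theta> \<Longrightarrow> V \<in> fst \<theta> \<Longrightarrow>
      locally_constant_on X (U \<inter> V) (\<lambda>x. snd \<theta> U x - snd \<theta> V x)"
proof -
  obtain \<U> f where [simp]: "\<theta> = (\<U>, f)" by fastforce
  note p = assms[unfolded continuous_closed_one_form_def \<open>\<theta> = (\<U>, f)\<close> prod.case]
  show "\<Union>(fst \<theta>) = topspace X" using p by simp
  show "U \<in> fst \<theta> \<Longrightarrow> openin X U" "U \<in> fst \<theta> \<Longrightarrow> continuous_map (subtopology X U) euclideanreal (snd \<theta> U)"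
    using bspec[OF conjunct1[OF p]] by simp_all
  show "U \<in> fst \<theta> \<Longrightarrow> V \<in> fst \<theta> \<Longrightarrow> locally_constant_on X (U \<inter> V) (\<lambda>x. snd \<theta> U x - snd \<theta> V x)"
    using bspec[OF bspec[OF conjunct2[OF conjunct2[OF p]]]] by simp
qed

lemma primitive_along_within:
  assumes \<theta>: "continuous_closed_one_form X \<theta>" and \<gamma>: "continuous_map (top_of_set {a..b}) X \<gamma>"
    and U: "U \<in> fst \<theta>" "\<gamma> ` {a..b} \<subseteq> U"
  shows "primitive_along \<theta> a b \<gamma> (\<lambda>t. snd \<theta> U (\<gamma> t))"
  unfolding primitive_along_def
proof (intro ballI impI)
  fix t W assume t: "t \<in> {a..b}" and W: "W \<in> fst \<theta>" "\<gamma> t \<in> W"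
  have op: "openin X U" "openin X W" and lc: "locally_constant_on X (U \<inter> W) (\<lambda>x. snd \<theta> U x - snd \<theta> W x)"
    by (rule closed_form_open[OF \<theta> U(1)], rule closed_form_open[OF \<theta> W(1)], rule closed_form_diff[OF \<theta> U(1) W(1)])
  have "\<gamma> t \<in> U \<inter> W" using U W t by blast
  from bspec[OF lc[unfolded locally_constant_on_def] this]
  obtain N where N: "openin (subtopology X (U \<inter> W)) N" "\<gamma> t \<in> N"
    "\<And>y. y \<in> N \<Longrightarrow> snd \<theta> U y - snd \<theta> W y = snd \<theta> U (\<gamma> t) - snd \<theta> W (\<gamma> t)"
    by (elim exE conjE) (rule that, assumption, assumption, erule bspec, blast)
  have "openin X N" using N(1) op openin_trans_full openin_Int by blast
  then have "openin (top_of_set {a..b}) {s \<in> {a..b}. \<gamma> s \<in> N}"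
    using openin_continuous_map_preimage[OF \<gamma>] by simp
  then obtain V where V: "open V" "{s \<in> {a..b}. \<gamma> s \<in> N} = {a..b} \<inter> V" by (auto simp: openin_open)
  then have tV: "t \<in> V" using t N(2) by blast
  have V2: "snd \<theta> U (\<gamma> s) - snd \<theta> W (\<gamma> s) = snd \<theta> U (\<gamma> t) - snd \<theta> W (\<gamma> t)" if "s \<in> V \<inter> {a..b}" for s
    by (rule N(3)) (use V(2) that in blast)
  show "\<exists>V. open V \<and> t \<in> V \<and> (\<forall>s\<in>V \<inter> {a..b}.
      snd \<theta> U (\<gamma> s) - snd \<theta> W (\<gamma> s) = snd \<theta> U (\<gamma> t) - snd \<theta> W (\<gamma> t))"
    by (intro exI[of _ V] conjI ballI V(1) tV V2)
qed

lemma is_line_integral_within: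
  assumes "a \<le> b" "U \<in> fst \<theta>" "\<gamma> ` {a..b} \<subseteq> U"
  shows "is_line_integral \<theta> a b \<gamma> (snd \<theta> U (\<gamma> b) - snd \<theta> U (\<gamma> a))"
proof -
  obtain \<U> f where \<theta>: "\<theta> = (\<U>, f)" by fastforce
  show ?thesis
  proof (cases "a = b")
    case True
    then show ?thesis unfolding is_line_integral_def \<theta> prod.case
      by (intro exI[of _ 0] exI[of _ "\<lambda>_. a"] exI[of _ "\<lambda>_. U"]) auto
  next
    case False
    then show ?thesis using assms unfolding is_line_integral_def \<theta> prod.case
      by (intro exI[of _ "1::nat"] exI[of _ "\<lambda>i. if i = 0 then a else b"] exI[of _ "\<lambda>_. U"]) auto
  qed
qed

text \<open>Bisection by \<open>Bolzano\<close>: the property passes to the union of adjacent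
  intervals and holds on intervals so short that the path stays in one set of the cover.\<close>

lemma primitive_along_exists:
  assumes \<theta>: "continuous_closed_one_form X \<theta>" and \<gamma>: "continuous_map (top_of_set {a..b}) X \<gamma>" and ab: "a \<le> b"
  shows "\<exists>\<Lambda>. primitive_along \<theta> a b \<gamma> \<Lambda> \<and> is_line_integral \<theta> a b \<gamma> (\<Lambda> b - \<Lambda> a)"
proof -
  \<comment> \<open>The bounds stand inside \<open>P\<close>, since the bisection principle also
    asks about intervals that reach beyond \<open>{a..b}\<close>.\<close>
  define P where "P p q \<longleftrightarrow> (a \<le> p \<and> p \<le> q \<and> q \<le> b \<longrightarrow>
    (\<exists>\<Lambda>. primitive_along \<theta> p q \<gamma> \<Lambda> \<and> is_line_integral \<theta> p q \<gamma> (\<Lambda> q - \<Lambda> p)))" for p q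
  have "P a b"
  proof (rule Bolzano[OF ab])
    fix p q r assume PP: "P p q" "P q r" and pqr: "p \<le> q" "q \<le> r"
    show "P p r" unfolding P_def
    proof (intro impI)
      assume "a \<le> p \<and> p \<le> r \<and> r \<le> b"
      then obtain L1 L2 where L: "primitive_along \<theta> p q \<gamma> L1" "is_line_integral \<theta> p q \<gamma> (L1 q - L1 p)"
        "primitive_along \<theta> q r \<gamma> L2" "is_line_integral \<theta> q r \<gamma> (L2 r - L2 q)"
        using PP pqr unfolding P_def by (meson order_trans)
      let ?L = "\<lambda>t. if t \<le> q then L1 t else L2 t - L2 q + L1 q"
      have "?L r - ?L p = (L1 q - L1 p) + (L2 r - L2 q)" using pqr by auto
      then show "\<exists>\<Lambda>. primitive_along \<theta> p r \<gamma> \<Lambda> \<and> is_line_integral \<theta> p r \<gamma> (\<Lambda> r - \<Lambda> p)"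
        using primitive_along_join[OF L(1,3) pqr] is_line_integral_join[OF L(2,4)]
        by (intro exI[of _ ?L]) metis
    qed
  next
    fix x assume x: "a \<le> x" "x \<le> b"
    have "\<gamma> x \<in> topspace X" using continuous_map_image_subset_topspace[OF \<gamma>] x by auto
    then obtain U where U: "U \<in> fst \<theta>" "\<gamma> x \<in> U" "openin X U"
      using closed_form_cover[OF \<theta>] closed_form_open[OF \<theta>] by blast
    have "openin (top_of_set {a..b}) {s \<in> {a..b}. \<gamma> s \<in> U}"
      using openin_continuous_map_preimage[OF \<gamma> U(3)] by simp
    then obtain d where d: "d > 0" "\<And>s. s \<in> {a..b} \<Longrightarrow> dist s x < d \<Longrightarrow> \<gamma> s \<in> U"
      using x U(2) by (force simp: openin_euclidean_subtopology_iff)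
    have "P p q" if pq: "p \<le> x \<and> x \<le> q \<and> q - p < d" for p q
      unfolding P_def
    proof (intro impI)
      assume ab': "a \<le> p \<and> p \<le> q \<and> q \<le> b"
      have sub: "\<gamma> ` {p..q} \<subseteq> U" using d(2) ab' pq by (auto simp: dist_real_def)
      have "continuous_map (top_of_set {p..q}) X \<gamma>"
        using continuous_map_from_subtopology_mono[OF \<gamma>, of "{p..q}"] ab' by simp
      from primitive_along_within[OF \<theta> this U(1) sub] is_line_integral_within[OF _ U(1) sub] ab'
      show "\<exists>\<Lambda>. primitive_along \<theta> p q \<gamma> \<Lambda> \<and> is_line_integral \<theta> p q \<gamma> (\<Lambda> q - \<Lambda> p)" by blast
    qed
    then show "\<exists>d>0. \<forall>p q. p \<le> x \<and> x \<le> q \<and> q - p < d \<longrightarrow> P p q" using d(1) by blast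
  qed
  then show ?thesis using ab by (simp add: P_def)
qed

text \<open>On each piece of the subdivision the primitive differs from the local function by a
  locally constant, hence constant, amount, and the sum telescopes. With the existence of a
  primitive, this makes the descriptive \<open>line_integral\<close> well defined.\<close>

lemma is_line_integral_unique:
  assumes I: "is_line_integral \<theta> a b \<gamma> I" and \<Lambda>: "primitive_along \<theta> a b \<gamma> \<Lambda>"
  shows "I = \<Lambda> b - \<Lambda> a"
proof -
  obtain \<U> f where \<theta>: "\<theta> = (\<U>, f)" by fastforce
  from I obtain N t U where t: "t 0 = a" "t N = b"
    "\<forall>i<N. t i < t (Suc i) \<and> U i \<in> \<U> \<and> \<gamma> ` {t i..t (Suc i)} \<subseteq> U i"
    and Ieq: "I = (\<Sum>i<N. f (U i) (\<gamma> (t (Suc i))) - f (U i) (\<gamma> (t i)))"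
    unfolding is_line_integral_def \<theta> prod.case by (elim exE conjE) (rule that; assumption)
  have mono: "t i \<le> t j" if "i \<le> j" "j \<le> N" for i j
    using that
  proof (induction j)
    case (Suc j)
    then show ?case using t(3)[rule_format, of j] by (cases "i = Suc j") auto
  qed simp
  have piece: "f (U i) (\<gamma> (t (Suc i))) - f (U i) (\<gamma> (t i)) = \<Lambda> (t (Suc i)) - \<Lambda> (t i)" if i: "i < N" for i
  proof -
    let ?J = "{t i..t (Suc i)}" and ?h = "\<lambda>s. \<Lambda> s - f (U i) (\<gamma> s)"
    have J: "?J \<subseteq> {a..b}" using mono[of 0 i] mono[of "Suc i" N] i t(1,2) by auto
    have "?h (t i) = ?h (t (Suc i))"
    proof (rule connected_local_const[of ?J _ _ ?h])
      show "\<forall>s\<in>?J. \<forall>\<^sub>F r in at s within ?J. ?h s = ?h r"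
      proof
        fix s assume s: "s \<in> ?J"
        have "\<gamma> s \<in> U i" "U i \<in> fst \<theta>" "s \<in> {a..b}" using t(3)[rule_format, OF i] s J \<theta> by auto
        from primitive_alongD[OF \<Lambda> this(3) this(2) this(1)] obtain V where
          V: "open V" "s \<in> V" "\<And>r. r \<in> V \<Longrightarrow> r \<in> {a..b} \<Longrightarrow> ?h r = ?h s" by (metis \<theta> snd_conv)
        have "\<forall>\<^sub>F r in at s within ?J. r \<in> V" using topological_tendstoD[OF tendsto_ident_at V(1,2)] .
        moreover have "\<forall>\<^sub>F r in at s within ?J. r \<in> ?J" by (simp add: eventually_at_filter)
        ultimately show "\<forall>\<^sub>F r in at s within ?J. ?h s = ?h r"
          by eventually_elim (use V(3) J in force)
      qed
    qed (use t(3)[rule_format, OF i] in auto)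
    then show ?thesis by simp
  qed
  have "I = (\<Sum>i<N. \<Lambda> (t (Suc i)) - \<Lambda> (t i))" unfolding Ieq by (rule sum.cong) (use piece in auto)
  also have "\<dots> = \<Lambda> (t N) - \<Lambda> (t 0)" by (rule sum_lessThan_telescope)
  finally show ?thesis using t by simp
qed

lemma line_integral_primitive:
  assumes \<theta>: "continuous_closed_one_form X \<theta>" and \<gamma>: "continuous_map (top_of_set {a..b}) X \<gamma>"
    and ab: "a \<le> b" and \<Lambda>: "primitive_along \<theta> a b \<gamma> \<Lambda>"
  shows "line_integral \<theta> a b \<gamma> = \<Lambda> b - \<Lambda> a"
proof -
  obtain L where L: "is_line_integral \<theta> a b \<gamma> (L b - L a)"
    using primitive_along_exists[OF \<theta> \<gamma> ab] by blast
  show ?thesis unfolding line_integral_def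
  proof (rule the_equality)
    show "is_line_integral \<theta> a b \<gamma> (\<Lambda> b - \<Lambda> a)" using L is_line_integral_unique[OF L \<Lambda>] by simp
  qed (rule is_line_integral_unique[OF _ \<Lambda>])
qed

lemma line_integral_within:
  assumes "continuous_closed_one_form X \<theta>" "continuous_map (top_of_set {a..b}) X \<gamma>" "a \<le> b"
    "U \<in> fst \<theta>" "\<gamma> ` {a..b} \<subseteq> U"
  shows "line_integral \<theta> a b \<gamma> = snd \<theta> U (\<gamma> b) - snd \<theta> U (\<gamma> a)"
  by (rule line_integral_primitive[OF assms(1-3)]) (rule primitive_along_within[OF assms(1,2,4,5)])

lemma line_integral_const:
  assumes "continuous_closed_one_form X \<theta>" "x \<in> topspace X" "a \<le> b"
  shows "line_integral \<theta> a b (\<lambda>_. x) = 0"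
proof -
  have "primitive_along \<theta> a b (\<lambda>_. x) (\<lambda>_. 0)"
    unfolding primitive_along_def by (intro ballI impI exI[of _ UNIV]) simp
  moreover have "continuous_map (top_of_set {a..b}) X (\<lambda>_. x)" using assms(2) by simp
  ultimately have "line_integral \<theta> a b (\<lambda>_. x) = 0 - 0"
    using line_integral_primitive[OF assms(1) _ assms(3)] by blast
  then show ?thesis by simp
qed

lemma line_integral_cong:
  assumes "continuous_closed_one_form X \<theta>" "continuous_map (top_of_set {a..b}) X \<gamma>" "a \<le> b"
    "\<And>t. t \<in> {a..b} \<Longrightarrow> \<gamma> t = \<delta> t"
  shows "line_integral \<theta> a b \<gamma> = line_integral \<theta> a b \<delta>"
proof -
  obtain L where L: "primitive_along \<theta> a b \<gamma> L" using primitive_along_exists[OF assms(1-3)] by blast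
  have d: "continuous_map (top_of_set {a..b}) X \<delta>"
    by (rule continuous_map_eq[OF assms(2)], rule assms(4)) simp
  have "primitive_along \<theta> a b \<delta> L" by (rule primitive_along_cong[OF L], rule assms(4))
  from line_integral_primitive[OF assms(1) d assms(3) this] line_integral_primitive[OF assms(1-3) L]
  show ?thesis by (simp only:)
qed

lemma line_integral_combine:
  assumes \<theta>: "continuous_closed_one_form X \<theta>" and \<gamma>: "continuous_map (top_of_set {a..c}) X \<gamma>"
    and abc: "a \<le> b" "b \<le> c"
  shows "line_integral \<theta> a c \<gamma> = line_integral \<theta> a b \<gamma> + line_integral \<theta> b c \<gamma>"
proof -
  obtain L where L: "primitive_along \<theta> a c \<gamma> L" using primitive_along_exists[OF \<theta> \<gamma>] abc by force
  have cont: "continuous_map (top_of_set {a..b}) X \<gamma>" "continuous_map (top_of_set {b..c}) X \<gamma>"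
    using continuous_map_from_subtopology_mono[OF \<gamma>] abc by simp_all
  show ?thesis
    using line_integral_primitive[OF \<theta> \<gamma> _ L] line_integral_primitive[OF \<theta> cont(1) abc(1) primitive_along_subset[OF L]]
      line_integral_primitive[OF \<theta> cont(2) abc(2) primitive_along_subset[OF L]] abc by simp
qed

lemma continuous_map_reparam:
  assumes "continuous_map (top_of_set {c..d::real}) X \<gamma>" "continuous_on {a..b::real} \<eta>" "\<eta> ` {a..b} \<subseteq> {c..d}"
  shows "continuous_map (top_of_set {a..b}) X (\<lambda>t. \<gamma> (\<eta> t))"
proof -
  have "continuous_map (top_of_set {a..b}) (top_of_set {c..d}) \<eta>"
    using assms(2,3) by (auto simp: continuous_map_in_subtopology)
  from continuous_map_compose[OF this assms(1)] show ?thesis by (simp add: o_def)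
qed

text \<open>Primitives pull back along any continuous change of parameter, monotone or not, so only
  its end values matter.\<close>

lemma line_integral_reparam:
  assumes \<theta>: "continuous_closed_one_form X \<theta>" and \<gamma>: "continuous_map (top_of_set {c..d}) X \<gamma>"
    and ab: "a \<le> b" and \<eta>: "continuous_on {a..b} \<eta>" "\<eta> ` {a..b} \<subseteq> {c..d}"
  shows "\<eta> a = c \<Longrightarrow> \<eta> b = d \<Longrightarrow> line_integral \<theta> a b (\<lambda>t. \<gamma> (\<eta> t)) = line_integral \<theta> c d \<gamma>"
    and "\<eta> a = d \<Longrightarrow> \<eta> b = c \<Longrightarrow> line_integral \<theta> a b (\<lambda>t. \<gamma> (\<eta> t)) = - line_integral \<theta> c d \<gamma>"
proof -
  have cd: "c \<le> d" using \<eta>(2) ab by (metis atLeastatMost_empty_iff2 image_is_empty subset_empty)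
  obtain L where L: "primitive_along \<theta> c d \<gamma> L" using primitive_along_exists[OF \<theta> \<gamma> cd] by blast
  have 1: "line_integral \<theta> c d \<gamma> = L d - L c" by (rule line_integral_primitive[OF \<theta> \<gamma> cd L])
  have 2: "line_integral \<theta> a b (\<lambda>t. \<gamma> (\<eta> t)) = L (\<eta> b) - L (\<eta> a)"
    by (rule line_integral_primitive[OF \<theta> continuous_map_reparam[OF \<gamma> \<eta>] ab primitive_along_compose[OF L \<eta>]])
  show "\<eta> a = c \<Longrightarrow> \<eta> b = d \<Longrightarrow> line_integral \<theta> a b (\<lambda>t. \<gamma> (\<eta> t)) = line_integral \<theta> c d \<gamma>"
    and "\<eta> a = d \<Longrightarrow> \<eta> b = c \<Longrightarrow> line_integral \<theta> a b (\<lambda>t. \<gamma> (\<eta> t)) = - line_integral \<theta> c d \<gamma>"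
    using 1 2 by simp_all
qed

lemma continuous_map_concat:
  fixes S T :: real
  assumes \<gamma>: "continuous_map (top_of_set {0..S}) X \<gamma>" and \<delta>: "continuous_map (top_of_set {0..T}) X \<delta>"
    and eq: "\<gamma> S = \<delta> 0"
  shows "continuous_map (top_of_set {0..S + T}) X (\<lambda>t. if t \<le> S then \<gamma> t else \<delta> (t - S))"
proof (rule continuous_map_cases_le[where p = "\<lambda>t. t" and q = "\<lambda>_. S"])
  show "continuous_map (subtopology (top_of_set {0..S + T}) {x \<in> topspace (top_of_set {0..S + T}). x \<le> S}) X \<gamma>"
    unfolding subtopology_subtopology by (rule continuous_map_from_subtopology_mono[OF \<gamma>]) auto
  have "continuous_map (top_of_set {S..S + T}) X (\<lambda>t. \<delta> (t - S))"
    by (rule continuous_map_reparam[OF \<delta>]) (auto intro!: continuous_intros)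
  then show "continuous_map (subtopology (top_of_set {0..S + T}) {x \<in> topspace (top_of_set {0..S + T}). S \<le> x}) X (\<lambda>t. \<delta> (t - S))"
    unfolding subtopology_subtopology by (rule continuous_map_from_subtopology_mono) auto
qed (use eq in auto)

lemma line_integral_concat:
  assumes \<theta>: "continuous_closed_one_form X \<theta>" and \<gamma>: "continuous_map (top_of_set {0..S}) X \<gamma>"
    and \<delta>: "continuous_map (top_of_set {0..T}) X \<delta>" and eq: "\<gamma> S = \<delta> 0" and ST: "0 \<le> S" "0 \<le> T"
  shows "line_integral \<theta> 0 (S + T) (\<lambda>t. if t \<le> S then \<gamma> t else \<delta> (t - S)) =
    line_integral \<theta> 0 S \<gamma> + line_integral \<theta> 0 T \<delta>"
proof -
  let ?\<kappa> = "\<lambda>t. if t \<le> S then \<gamma> t else \<delta> (t - S)"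
  have "line_integral \<theta> 0 (S + T) ?\<kappa> = line_integral \<theta> 0 S ?\<kappa> + line_integral \<theta> S (S + T) ?\<kappa>"
    using ST by (intro line_integral_combine[OF \<theta> continuous_map_concat[OF \<gamma> \<delta> eq]]) auto
  also have "line_integral \<theta> 0 S ?\<kappa> = line_integral \<theta> 0 S \<gamma>"
    by (rule line_integral_cong[OF \<theta> \<gamma> ST(1), symmetric]) auto
  also have "line_integral \<theta> S (S + T) ?\<kappa> = line_integral \<theta> S (S + T) (\<lambda>t. \<delta> (t - S))"
  proof (rule line_integral_cong[OF \<theta>, symmetric])
    show "continuous_map (top_of_set {S..S + T}) X (\<lambda>t. \<delta> (t - S))"
      by (rule continuous_map_reparam[OF \<delta>]) (auto intro!: continuous_intros)
  qed (use ST eq in auto)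
  also have "\<dots> = line_integral \<theta> 0 T \<delta>"
    using ST by (intro line_integral_reparam(1)[OF \<theta> \<delta>]) (auto intro!: continuous_intros)
  finally show ?thesis .
qed

section \<open>Tame homotopies\<close>

lemma continuous_map_scaleR:
  fixes f :: "'a \<Rightarrow> 'b::real_normed_vector"
  shows "continuous_map X euclideanreal l \<Longrightarrow> continuous_map X euclidean f \<Longrightarrow>
    continuous_map X euclidean (\<lambda>x. l x *\<^sub>R f x)"
  by (simp add: continuous_map_atin tendsto_scaleR)

lemma convex_combination_in_ball:
  fixes x :: "'e::real_normed_vector"
  assumes "a \<in> ball x r" "b \<in> ball x r" "0 \<le> l" "l \<le> 1"
  shows "a + l *\<^sub>R (b - a) \<in> ball x r"
proof -
  have "(1 - l) *\<^sub>R a + l *\<^sub>R b \<in> ball x r"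
    using assms by (intro convexD_alt[OF convex_ball]) auto
  moreover have "a + l *\<^sub>R (b - a) = (1 - l) *\<^sub>R a + l *\<^sub>R b" by (simp add: algebra_simps)
  ultimately show ?thesis by simp
qed

context closed_manifold begin

section \<open>Comparison of two representatives of a class\<close>

lemma closed_form_bounded:
  assumes \<theta>: "continuous_closed_one_form M \<theta>" and U: "U \<in> fst \<theta>" and K: "compactin M K" "K \<subseteq> U"
  obtains B where "\<And>x. x \<in> K \<Longrightarrow> \<bar>snd \<theta> U x\<bar> \<le> B"
proof -
  have "compactin (subtopology M U) K" using K by (simp add: compactin_subtopology)
  from image_compactin[OF this closed_form_continuous[OF \<theta> U]]
  have "bounded (snd \<theta> U ` K)" by (simp add: compact_imp_bounded)
  then show ?thesis using that by (auto simp: bounded_iff)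
qed

lemma chart_path:
  assumes c: "c \<in> A" and ball: "ball x r \<subseteq> chart_im c"
    and pq: "p \<in> chart_preimage c (ball x r)" "q \<in> chart_preimage c (ball x r)"
  obtains \<gamma> :: "real \<Rightarrow> 'a" where "continuous_map (top_of_set {0..1}) M \<gamma>" "\<gamma> 0 = p" "\<gamma> 1 = q"
    "\<gamma> ` {0..1} \<subseteq> chart_preimage c (ball x r)"
proof -
  define \<gamma> where "\<gamma> t = chart_inv c (coord c p + t *\<^sub>R (coord c q - coord c p))" for t
  have pq': "p \<in> chart_dom c" "q \<in> chart_dom c" "coord c p \<in> ball x r" "coord c q \<in> ball x r"
    using pq by (auto simp: chart_preimage_def)
  have inb: "coord c p + t *\<^sub>R (coord c q - coord c p) \<in> ball x r" if "t \<in> {0..1}" for t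
    using convex_combination_in_ball[OF pq'(3,4)] that by simp
  have cont: "continuous_map (top_of_set {0..1}) M \<gamma>" unfolding \<gamma>_def
    by (rule continuous_chart_inv_compose[OF c]) (use inb ball in \<open>auto intro!: continuous_intros\<close>)
  have sub: "\<gamma> ` {0..1} \<subseteq> chart_preimage c (ball x r)"
  proof clarify
    fix t :: real assume "t \<in> {0..1}"
    from inb[OF this] ball have "coord c p + t *\<^sub>R (coord c q - coord c p) \<in> chart_im c" by blast
    with inb[OF \<open>t \<in> {0..1}\<close>] show "\<gamma> t \<in> chart_preimage c (ball x r)"
      by (simp add: \<gamma>_def chart_preimage_def chart_inv_in del: mem_ball)
  qed
  have "\<gamma> 0 = p" "\<gamma> 1 = q" using c pq' by (simp_all add: \<gamma>_def)
  then show ?thesis by (rule that[OF cont _ _ sub])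
qed

text \<open>Both forms have equal integrals over loops, so the difference of their path integrals
  depends on the end points alone; a finite cover by sets in which it changes by at most 1 bounds
  it.\<close>

lemma representatives_bounded_difference:
  assumes r1: "represents M \<theta>1 \<xi>" and r2: "represents M \<theta>2 \<xi>"
  obtains C where "\<And>T \<gamma>. 0 \<le> T \<Longrightarrow> continuous_map (top_of_set {0..T}) M \<gamma> \<Longrightarrow>
    \<bar>line_integral \<theta>1 0 T \<gamma> - line_integral \<theta>2 0 T \<gamma>\<bar> \<le> C"
proof -
  have th: "continuous_closed_one_form M \<theta>1" "continuous_closed_one_form M \<theta>2"
    using r1 r2 by (auto simp: represents_def)
  \<comment> \<open>A relation instead of a function, because \<open>M\<close> may be disconnected
    and no path may join \<open>x\<close> to \<open>y\<close>.\<close>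
  define J where "J x y D \<longleftrightarrow> (\<exists>T \<gamma>. 0 \<le> T \<and> continuous_map (top_of_set {0..T}) M \<gamma> \<and> \<gamma> 0 = x \<and> \<gamma> T = y \<and>
    D = line_integral \<theta>1 0 T \<gamma> - line_integral \<theta>2 0 T \<gamma>)" for x y D
  have JI: "J (\<gamma> 0) (\<gamma> T) (line_integral \<theta>1 0 T \<gamma> - line_integral \<theta>2 0 T \<gamma>)"
    if "0 \<le> T" "continuous_map (top_of_set {0..T}) M \<gamma>" for T \<gamma>
    unfolding J_def using that by (intro exI[of _ T] exI[of _ \<gamma>]) simp
  have trans: "J x z (D + E)" if J1: "J x y D" and J2: "J y z E" for x y z D E
  proof -
    obtain S \<gamma> where S: "0 \<le> S" "continuous_map (top_of_set {0..S}) M \<gamma>" "\<gamma> 0 = x" "\<gamma> S = y"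
      "D = line_integral \<theta>1 0 S \<gamma> - line_integral \<theta>2 0 S \<gamma>" using J1 unfolding J_def
      by (elim exE conjE) (rule that; assumption)
    obtain T \<delta> where T: "0 \<le> T" "continuous_map (top_of_set {0..T}) M \<delta>" "\<delta> 0 = y" "\<delta> T = z"
      "E = line_integral \<theta>1 0 T \<delta> - line_integral \<theta>2 0 T \<delta>" using J2 unfolding J_def
      by (elim exE conjE) (rule that; assumption)
    let ?\<kappa> = "\<lambda>t. if t \<le> S then \<gamma> t else \<delta> (t - S)"
    have eq: "\<gamma> S = \<delta> 0" using S T by simp
    have "J (?\<kappa> 0) (?\<kappa> (S + T)) (line_integral \<theta>1 0 (S + T) ?\<kappa> - line_integral \<theta>2 0 (S + T) ?\<kappa>)"
      using S(1) T(1) by (intro JI continuous_map_concat[OF S(2) T(2) eq]) auto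
    moreover have "?\<kappa> 0 = x" "?\<kappa> (S + T) = z" using S T by auto
    moreover have "line_integral \<theta>1 0 (S + T) ?\<kappa> - line_integral \<theta>2 0 (S + T) ?\<kappa> = D + E"
      using line_integral_concat[OF th(1) S(2) T(2) eq S(1) T(1)] line_integral_concat[OF th(2) S(2) T(2) eq S(1) T(1)] S(5) T(5)
      by linarith
    ultimately show ?thesis by (simp only:)
  qed
  have sym: "J y x (- D)" if J1: "J x y D" for x y D
  proof -
    obtain T \<gamma> where T: "0 \<le> T" "continuous_map (top_of_set {0..T}) M \<gamma>" "\<gamma> 0 = x" "\<gamma> T = y"
      "D = line_integral \<theta>1 0 T \<gamma> - line_integral \<theta>2 0 T \<gamma>" using J1 unfolding J_def
      by (elim exE conjE) (rule that; assumption)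
    have eta: "continuous_on {0..T} (\<lambda>t. T - t)" "(\<lambda>t. T - t) ` {0..T} \<subseteq> {0..T}"
      by (auto intro!: continuous_intros)
    let ?\<kappa> = "\<lambda>t. \<gamma> (T - t)"
    have "J (?\<kappa> 0) (?\<kappa> T) (line_integral \<theta>1 0 T ?\<kappa> - line_integral \<theta>2 0 T ?\<kappa>)"
      by (intro JI T(1) continuous_map_reparam[OF T(2) eta])
    then show ?thesis
      using line_integral_reparam(2)[OF th(1) T(2,1) eta] line_integral_reparam(2)[OF th(2) T(2,1) eta] T(3-5)
      by simp
  qed
  have loop: "D = 0" if J1: "J x x D" for x D
  proof -
    obtain T \<gamma> where T: "0 \<le> T" "continuous_map (top_of_set {0..T}) M \<gamma>" "\<gamma> 0 = x" "\<gamma> T = x"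
      "D = line_integral \<theta>1 0 T \<gamma> - line_integral \<theta>2 0 T \<gamma>" using J1 unfolding J_def
      by (elim exE conjE) (rule that; assumption)
    \<comment> \<open>The loop is rescaled to the unit interval, where \<open>represents\<close>
      compares periods.\<close>
    have eta: "continuous_on {0..1} (\<lambda>t. T * t)" "(\<lambda>t. T * t) ` {0..1} \<subseteq> {0..T}"
      using T(1) by (auto intro!: continuous_intros simp: mult_left_le)
    let ?\<kappa> = "\<lambda>t. \<gamma> (T * t)"
    have path: "pathin M ?\<kappa> \<and> ?\<kappa> 0 = ?\<kappa> 1"
      using continuous_map_reparam[OF T(2) eta] T(3,4) by (simp add: pathin_def)
    then have "line_integral \<theta>1 0 1 ?\<kappa> = line_integral \<theta>2 0 1 ?\<kappa>"
      using mp[OF spec[OF conjunct2[OF conjunct2[OF r1[unfolded represents_def]]]], of ?\<kappa>]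
        mp[OF spec[OF conjunct2[OF conjunct2[OF r2[unfolded represents_def]]]], of ?\<kappa>] by simp
    then show ?thesis
      using line_integral_reparam(1)[OF th(1) T(2) _ eta] line_integral_reparam(1)[OF th(2) T(2) _ eta] T(5) by simp
  qed
  have unique: "D = E" if "J x y D" "J x y E" for x y D E
    using loop[OF trans[OF that(1) sym[OF that(2)]]] by simp
  \<comment> \<open>Both local primitives vary by less than 1/2 near \<open>x\<close>, and nearby
    points are joined to \<open>x\<close> inside a chart ball.\<close>
  have "\<exists>N. openin M N \<and> x \<in> N \<and> (\<forall>y\<in>N. \<exists>D. J x y D \<and> \<bar>D\<bar> \<le> 1)" if x: "x \<in> topspace M" for x
  proof -
    have half: "\<exists>N U. openin M N \<and> x \<in> N \<and> N \<subseteq> U \<and> U \<in> fst \<theta> \<and> (\<forall>y\<in>N. \<bar>snd \<theta> U y - snd \<theta> U x\<bar> < 1/2)"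
      if \<theta>: "continuous_closed_one_form M \<theta>" for \<theta>
    proof -
      obtain U where U: "U \<in> fst \<theta>" "x \<in> U" using closed_form_cover[OF \<theta>] x by blast
      have op: "openin M U" by (rule closed_form_open[OF \<theta> U(1)])
      let ?N = "{y \<in> topspace (subtopology M U). snd \<theta> U y \<in> ball (snd \<theta> U x) (1/2)}"
      have "openin (subtopology M U) ?N"
        by (rule openin_continuous_map_preimage[OF closed_form_continuous[OF \<theta> U(1)]]) simp
      then have "openin M ?N" using op openin_trans_full by blast
      then show ?thesis using U x
        by (intro exI[of _ ?N] exI[of _ U]) (auto simp: dist_real_def abs_minus_commute)
    qed
    obtain N1 U1 where N1: "openin M N1" "x \<in> N1" "N1 \<subseteq> U1" "U1 \<in> fst \<theta>1"
      "\<And>y. y \<in> N1 \<Longrightarrow> \<bar>snd \<theta>1 U1 y - snd \<theta>1 U1 x\<bar> < 1/2" using half[OF th(1)] by blast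
    obtain N2 U2 where N2: "openin M N2" "x \<in> N2" "N2 \<subseteq> U2" "U2 \<in> fst \<theta>2"
      "\<And>y. y \<in> N2 \<Longrightarrow> \<bar>snd \<theta>2 U2 y - snd \<theta>2 U2 x\<bar> < 1/2" using half[OF th(2)] by blast
    obtain c r where c: "c \<in> A" "x \<in> chart_dom c" "r > 0" "cball (coord c x) r \<subseteq> chart_im c"
      "chart_preimage c (cball (coord c x) r) \<subseteq> N1 \<inter> N2"
      using coordinate_ball_ex[OF openin_Int[OF N1(1) N2(1)]] N1(2) N2(2) by (metis IntI)
    let ?N = "chart_preimage c (ball (coord c x) r)"
    have sub: "?N \<subseteq> N1 \<inter> N2" using c(5) by (auto simp: chart_preimage_def)
    have xN: "x \<in> ?N" using c by (simp add: chart_preimage_def)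
    have "\<exists>D. J x y D \<and> \<bar>D\<bar> \<le> 1" if y: "y \<in> ?N" for y
    proof -
      have b: "ball (coord c x) r \<subseteq> chart_im c" using c(4) ball_subset_cball by blast
      obtain \<gamma> :: "real \<Rightarrow> 'a" where
        g: "continuous_map (top_of_set {0..1}) M \<gamma>" "\<gamma> 0 = x" "\<gamma> 1 = y" "\<gamma> ` {0..1} \<subseteq> ?N"
        by (rule chart_path[OF c(1) b xN y])
      have "line_integral \<theta>1 0 1 \<gamma> = snd \<theta>1 U1 y - snd \<theta>1 U1 x"
        using line_integral_within[OF th(1) g(1) zero_le_one N1(4)] g sub N1(3) by auto
      moreover have "line_integral \<theta>2 0 1 \<gamma> = snd \<theta>2 U2 y - snd \<theta>2 U2 x"
        using line_integral_within[OF th(2) g(1) zero_le_one N2(4)] g sub N2(3) by auto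
      moreover have "\<bar>snd \<theta>1 U1 y - snd \<theta>1 U1 x\<bar> < 1/2" "\<bar>snd \<theta>2 U2 y - snd \<theta>2 U2 x\<bar> < 1/2"
        using N1(5) N2(5) sub y by blast+
      ultimately have "\<bar>line_integral \<theta>1 0 1 \<gamma> - line_integral \<theta>2 0 1 \<gamma>\<bar> \<le> 1" by linarith
      then show ?thesis using JI[OF zero_le_one g(1)] g(2,3) by metis
    qed
    then show ?thesis using openin_chart_preimage[OF c(1) open_ball] xN by blast
  qed
  then obtain N where N: "\<And>x. x \<in> topspace M \<Longrightarrow> openin M (N x) \<and> x \<in> N x \<and> (\<forall>y\<in>N x. \<exists>D. J x y D \<and> \<bar>D\<bar> \<le> 1)"
    by metis
  obtain F where F: "finite F" "F \<subseteq> topspace M" "topspace M \<subseteq> (\<Union>x\<in>F. N x)"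
    by (rule compactin_pointwise_cover[of M "topspace M" N]) (use compact N in \<open>auto simp: compact_space_def\<close>)
  \<comment> \<open>For centres that no path joins, the chosen value is arbitrary; it can only
    enlarge \<open>C\<close>, as all entries are nonnegative.\<close>
  define d where "d x y = \<bar>SOME D. J x y D\<bar>" for x y
  \<comment> \<open>The summand 2 pays for the two short connections between the end points and the
    centres.\<close>
  define C where "C = 2 + (\<Sum>x\<in>F. \<Sum>y\<in>F. d x y)"
  have dC: "d x y \<le> C - 2" if "x \<in> F" "y \<in> F" for x y
  proof -
    have "d x y \<le> (\<Sum>y\<in>F. d x y)" using that F(1) by (intro member_le_sum) (auto simp: d_def)
    also have "\<dots> \<le> (\<Sum>x\<in>F. \<Sum>y\<in>F. d x y)"
      using that F(1) by (intro member_le_sum[of x F "\<lambda>x. \<Sum>y\<in>F. d x y"]) (auto simp: d_def intro: sum_nonneg)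
    finally show ?thesis by (simp add: C_def)
  qed
  have bound: "\<bar>D\<bar> \<le> C" if D: "J x y D" and xy: "x \<in> topspace M" "y \<in> topspace M" for x y D
  proof -
    obtain p q where p: "p \<in> F" "x \<in> N p" and q: "q \<in> F" "y \<in> N q" using F(3) xy by blast
    obtain D1 D2 where D1: "J p x D1" "\<bar>D1\<bar> \<le> 1" and D2: "J q y D2" "\<bar>D2\<bar> \<le> 1"
      using N p q F(2) by (meson subsetD)
    have 1: "J p q (D1 + D + - D2)" by (intro trans[OF trans[OF D1(1) D] sym[OF D2(1)]])
    then have "J p q (SOME D. J p q D)" by (rule someI)
    from unique[OF 1 this] have "\<bar>D1 + D + - D2\<bar> = d p q" by (simp add: d_def)
    then show ?thesis using dC[OF p(1) q(1)] D1(2) D2(2) by linarith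
  qed
  show ?thesis
  proof (rule that)
    fix T :: real and \<gamma> :: "real \<Rightarrow> 'a" assume T: "0 \<le> T" and \<gamma>: "continuous_map (top_of_set {0..T}) M \<gamma>"
    have "\<gamma> t \<in> topspace M" if "t \<in> {0..T}" for t
      using continuous_map_image_subset_topspace[OF \<gamma>] that by auto
    from this[of 0] this[of T] have "\<gamma> 0 \<in> topspace M" "\<gamma> T \<in> topspace M" using T by simp_all
    from bound[OF JI[OF T \<gamma>] this]
    show "\<bar>line_integral \<theta>1 0 T \<gamma> - line_integral \<theta>2 0 T \<gamma>\<bar> \<le> C" .
  qed
qed

section \<open>Bump functions and homotopies with bounded integrals\<close>

definition bump :: "('a, 'e) chart \<Rightarrow> 'e \<Rightarrow> real \<Rightarrow> 'a \<Rightarrow> real" where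
  "bump c x r m = (if m \<in> chart_dom c then max 0 (1 - dist (coord c m) x / r) else 0)"

lemma bump_bounds: "0 \<le> bump c x r m" "r > 0 \<Longrightarrow> bump c x r m \<le> 1"
  by (auto simp: bump_def)

lemma bump_pos_iff: "r > 0 \<Longrightarrow> bump c x r m > 0 \<longleftrightarrow> m \<in> chart_preimage c (ball x r)"
  by (auto simp: bump_def chart_preimage_def less_max_iff_disj dist_commute)

text \<open>On the chart domain the formula is continuous. Off the compact ball, which is closed
  because \<open>M\<close> is Hausdorff, the function vanishes. These two open sets cover
  \<open>M\<close>.\<close>

lemma bump_continuous:
  assumes c: "c \<in> A" and r: "r > 0" "cball x r \<subseteq> chart_im c"
  shows "continuous_map M euclideanreal (bump c x r)"
proof (rule continuous_map_locally)
  fix m assume m: "m \<in> topspace M"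
  let ?K = "chart_preimage c (cball x r)"
  show "\<exists>U. openin M U \<and> m \<in> U \<and> continuous_map (subtopology M U) euclideanreal (bump c x r)"
  proof (cases "m \<in> chart_dom c")
    case True
    have "continuous_map (subtopology M (chart_dom c)) euclideanreal (\<lambda>q. max 0 (1 - dist (coord c q) x / r))"
    proof -
      have "continuous_on UNIV (\<lambda>y. max 0 (1 - dist y x / r))"
        using r(1) by (intro continuous_intros) auto
      then show ?thesis
        using continuous_map_compose[OF continuous_coord[OF c], of euclideanreal "\<lambda>y. max 0 (1 - dist y x / r)"]
        by (simp add: o_def)
    qed
    then have "continuous_map (subtopology M (chart_dom c)) euclideanreal (bump c x r)"
      by (rule continuous_map_eq) (simp add: bump_def)
    then show ?thesis using chart_open(1)[OF c] True by blast
  next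
    case False
    have "openin M (topspace M - ?K)"
      using closedin_chart_preimage[OF c fd_compact_cball r(2)] by blast
    moreover have "continuous_map (subtopology M (topspace M - ?K)) euclideanreal (bump c x r)"
    proof (rule continuous_map_eq[of _ _ "\<lambda>_. 0"])
      fix q assume "q \<in> topspace (subtopology M (topspace M - ?K))"
      then have "q \<notin> chart_preimage c (ball x r)" by (auto simp: chart_preimage_def)
      then have "\<not> bump c x r q > 0" using bump_pos_iff[OF r(1)] by blast
      then show "0 = bump c x r q" using bump_bounds(1)[of c x r q] by linarith
    qed simp
    moreover have "m \<in> topspace M - ?K" using m False by (auto simp: chart_preimage_def)
    ultimately show ?thesis by blast
  qed
qed

text \<open>\<open>B\<close> bounds the integrals along the tracks uniformly in the starting point.
  The duration \<open>T\<close> is free so that homotopies can be run one after another without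
  rescaling.\<close>

definition tame_homotopic :: "'a cform \<Rightarrow> 'a set \<Rightarrow> ('a \<Rightarrow> 'a) \<Rightarrow> ('a \<Rightarrow> 'a) \<Rightarrow> bool" where
  "tame_homotopic \<theta> F \<phi> \<psi> \<longleftrightarrow> (\<exists>T H B. 0 \<le> T \<and>
     continuous_map (prod_topology (top_of_set {0..T}) (subtopology M F)) M (\<lambda>(t, x). H t x) \<and>
     (\<forall>x\<in>F. H 0 x = \<phi> x \<and> H T x = \<psi> x \<and> \<bar>line_integral \<theta> 0 T (\<lambda>t. H t x)\<bar> \<le> B))"

lemma homotopy_track:
  assumes "continuous_map (prod_topology (top_of_set S) (subtopology M F)) M (\<lambda>(t, x). H t x)" "x \<in> F" "F \<subseteq> topspace M"
  shows "continuous_map (top_of_set S) M (\<lambda>t. H t x)"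
  using continuous_map_Pair_left[OF _ assms(1), of x] assms(2,3) by auto

lemma continuous_map_homotopy_subset:
  assumes "continuous_map (prod_topology (top_of_set S) (subtopology M F)) Y f" "S' \<subseteq> S" "F' \<subseteq> F"
  shows "continuous_map (prod_topology (top_of_set S') (subtopology M F')) Y f"
  using continuous_map_from_subtopology[OF assms(1), of "S' \<times> F'"] assms(2,3)
  by (simp add: subtopology_Times subtopology_subtopology Int_absorb1)

lemma homotopy_concat_continuous:
  fixes S T :: real
  assumes H: "continuous_map (prod_topology (top_of_set {0..S}) (subtopology M F)) M (\<lambda>(t, x). H t x)"
    and G: "continuous_map (prod_topology (top_of_set {0..T}) (subtopology M F)) M (\<lambda>(t, x). G t x)"
    and eq: "\<And>x. x \<in> F \<Longrightarrow> H S x = G 0 x"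
  shows "continuous_map (prod_topology (top_of_set {0..S + T}) (subtopology M F)) M
    (\<lambda>(t, x). if t \<le> S then H t x else G (t - S) x)"
proof -
  let ?X = "prod_topology (top_of_set {0..S + T}) (subtopology M F)"
  have fst: "continuous_map ?X euclideanreal fst"
    by (rule continuous_map_restrict_range[OF continuous_map_fst])
  have "continuous_map ?X M (\<lambda>p. if fst p \<le> S then (\<lambda>(t, x). H t x) p else (\<lambda>(t, x). G (t - S) x) p)"
  proof (rule continuous_map_cases_le[where p = fst and q = "\<lambda>_. S"])
    have "{p \<in> topspace ?X. fst p \<le> S} = topspace ?X \<inter> ({..S} \<times> UNIV)" by auto
    then have "subtopology ?X {p \<in> topspace ?X. fst p \<le> S} = subtopology ?X ({..S} \<times> UNIV)"
      by (simp only: subtopology_restrict)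
    then show "continuous_map (subtopology ?X {p \<in> topspace ?X. fst p \<le> S}) M (\<lambda>(t, x). H t x)"
      using continuous_map_homotopy_subset[OF H, of "{0..S + T} \<inter> {..S}" F]
      by (auto simp: subtopology_Times subtopology_subtopology)
    have "continuous_map (prod_topology (top_of_set {S..S + T}) (subtopology M F)) (prod_topology (top_of_set {0..T}) (subtopology M F))
        (\<lambda>p. (fst p - S, snd p))"
    proof (intro continuous_map_pairedI continuous_map_snd)
      have "continuous_map (prod_topology (top_of_set {S..S + T}) (subtopology M F)) euclideanreal fst"
        by (rule continuous_map_restrict_range[OF continuous_map_fst])
      then show "continuous_map (prod_topology (top_of_set {S..S + T}) (subtopology M F)) (top_of_set {0..T}) (\<lambda>p. fst p - S)"
        by (auto simp: continuous_map_in_subtopology intro!: continuous_map_diff)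
    qed
    from continuous_map_compose[OF this G]
    have G': "continuous_map (prod_topology (top_of_set {S..S + T}) (subtopology M F)) M (\<lambda>(t, x). G (t - S) x)"
      by (simp add: o_def case_prod_unfold)
    have "{p \<in> topspace ?X. S \<le> fst p} = topspace ?X \<inter> ({S..} \<times> UNIV)" by auto
    then have "subtopology ?X {p \<in> topspace ?X. S \<le> fst p} = subtopology ?X ({S..} \<times> UNIV)"
      by (simp only: subtopology_restrict)
    then show "continuous_map (subtopology ?X {p \<in> topspace ?X. S \<le> fst p}) M (\<lambda>(t, x). G (t - S) x)"
      using continuous_map_homotopy_subset[OF G', of "{0..S + T} \<inter> {S..}" F]
      by (auto simp: subtopology_Times subtopology_subtopology)
  qed (use fst eq in auto)
  then show ?thesis
    by (rule back_subst[of "continuous_map ?X M"]) (simp add: fun_eq_iff)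
qed

lemma tame_homotopic_trans:
  assumes \<theta>: "continuous_closed_one_form M \<theta>" and F: "F \<subseteq> topspace M"
    and 1: "tame_homotopic \<theta> F \<phi> \<psi>" and 2: "tame_homotopic \<theta> F \<psi> \<kappa>"
  shows "tame_homotopic \<theta> F \<phi> \<kappa>"
proof -
  obtain S H B where S: "0 \<le> S" and H: "continuous_map (prod_topology (top_of_set {0..S}) (subtopology M F)) M (\<lambda>(t, x). H t x)"
    and Hx': "\<forall>x\<in>F. H 0 x = \<phi> x \<and> H S x = \<psi> x \<and> \<bar>line_integral \<theta> 0 S (\<lambda>t. H t x)\<bar> \<le> B"
    using 1 unfolding tame_homotopic_def by (elim exE conjE) (rule that; assumption)
  obtain T G C where T: "0 \<le> T" and G: "continuous_map (prod_topology (top_of_set {0..T}) (subtopology M F)) M (\<lambda>(t, x). G t x)"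
    and Gx': "\<forall>x\<in>F. G 0 x = \<psi> x \<and> G T x = \<kappa> x \<and> \<bar>line_integral \<theta> 0 T (\<lambda>t. G t x)\<bar> \<le> C"
    using 2 unfolding tame_homotopic_def by (elim exE conjE) (rule that; assumption)
  note Hx = Hx'[rule_format] and Gx = Gx'[rule_format]
  define K where "K t x = (if t \<le> S then H t x else G (t - S) x)" for t x
  have eq: "H S x = G 0 x" if "x \<in> F" for x using Hx[OF that] Gx[OF that] by simp
  have "K 0 x = \<phi> x \<and> K (S + T) x = \<kappa> x \<and> \<bar>line_integral \<theta> 0 (S + T) (\<lambda>t. K t x)\<bar> \<le> B + C" if x: "x \<in> F" for x
  proof -
    have "line_integral \<theta> 0 (S + T) (\<lambda>t. K t x) = line_integral \<theta> 0 S (\<lambda>t. H t x) + line_integral \<theta> 0 T (\<lambda>t. G t x)"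
      unfolding K_def by (rule line_integral_concat[OF \<theta> homotopy_track[OF H x F] homotopy_track[OF G x F] eq[OF x] S T])
    moreover have "K 0 x = \<phi> x" "K (S + T) x = \<kappa> x"
      using Hx[OF x] Gx[OF x] S T by (auto simp: K_def)
    ultimately show ?thesis using Hx[OF x] Gx[OF x] by auto
  qed
  moreover have "continuous_map (prod_topology (top_of_set {0..S + T}) (subtopology M F)) M (\<lambda>(t, x). K t x)"
    unfolding K_def by (rule homotopy_concat_continuous[OF H G eq])
  moreover have "0 \<le> S + T" using S T by simp
  ultimately show ?thesis unfolding tame_homotopic_def by (intro exI[of _ "S + T"] exI[of _ K] exI[of _ "B + C"]) simp
qed

lemma tame_homotopic_subset:
  assumes "tame_homotopic \<theta> F \<phi> \<psi>" "F' \<subseteq> F"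
  shows "tame_homotopic \<theta> F' \<phi> \<psi>"
proof -
  obtain T H B where T: "0 \<le> T" and H: "continuous_map (prod_topology (top_of_set {0..T}) (subtopology M F)) M (\<lambda>(t, x). H t x)"
    and Hx: "\<forall>x\<in>F. H 0 x = \<phi> x \<and> H T x = \<psi> x \<and> \<bar>line_integral \<theta> 0 T (\<lambda>t. H t x)\<bar> \<le> B"
    using assms(1) unfolding tame_homotopic_def by (elim exE conjE) (rule that; assumption)
  from continuous_map_homotopy_subset[OF H order_refl assms(2)] T Hx assms(2) show ?thesis
    unfolding tame_homotopic_def by (intro exI[of _ T] exI[of _ H] exI[of _ B]) (simp add: subset_iff)
qed

lemma tame_homotopic_refl:
  assumes \<theta>: "continuous_closed_one_form M \<theta>" and F: "F \<subseteq> topspace M"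
    and \<phi>: "continuous_map (subtopology M F) M \<phi>"
  shows "tame_homotopic \<theta> F \<phi> \<phi>"
proof -
  have "continuous_map (prod_topology (top_of_set {0..0::real}) (subtopology M F)) M (\<lambda>(t, x). \<phi> x)"
    using continuous_map_compose[OF continuous_map_snd \<phi>] by (simp add: o_def case_prod_unfold)
  moreover have "line_integral \<theta> 0 0 (\<lambda>t. \<phi> x) = 0" if "x \<in> F" for x
  proof (rule line_integral_const[OF \<theta>])
    show "\<phi> x \<in> topspace M" using continuous_map_image_subset_topspace[OF \<phi>] that F by auto
  qed simp
  ultimately show ?thesis
    unfolding tame_homotopic_def by (intro exI[of _ 0] exI[of _ "\<lambda>_. \<phi>"] exI[of _ 0]) simp
qed

end

lemma openin_map_preimage:
  assumes "openin X F" "continuous_map (subtopology X F) Y f" "openin Y U"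
  shows "openin X {x \<in> F. f x \<in> U}"
proof -
  have "openin (subtopology X F) {x \<in> topspace (subtopology X F). f x \<in> U}"
    by (rule openin_continuous_map_preimage[OF assms(2,3)])
  moreover have "{x \<in> topspace (subtopology X F). f x \<in> U} = {x \<in> F. f x \<in> U}"
    using openin_subset[OF assms(1)] by auto
  ultimately show ?thesis using openin_trans_full[OF _ assms(1)] by metis
qed

text \<open>A neighbourhood of a compact piece of an ENR in a compact Hausdorff space maps to the ENR,
  since the embedding of the piece into Euclidean space extends to the whole space.\<close>

lemma ENR_neighbourhood_map:
  assumes X: "compact_space X" "Hausdorff_space X" and U: "U \<subseteq> topspace X" "ENR_space (subtopology X U)"
    and C: "closedin X C" "C \<subseteq> U"
  obtains N \<rho> where "openin X N" "C \<subseteq> N" "continuous_map (subtopology X N) X \<rho>" "\<rho> ` N \<subseteq> U"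
    "\<And>x. x \<in> C \<Longrightarrow> \<rho> x = x"
proof -
  obtain n Y W where W: "openin (Euclidean_space n) W"
    and Y: "Y retract_of_space (subtopology (Euclidean_space n) W)"
    and hom: "subtopology X U homeomorphic_space subtopology (Euclidean_space n) Y"
    using U(2) unfolding ENR_space_def by blast
  let ?E = "Euclidean_space n"
  obtain \<phi> \<psi> where hm: "homeomorphic_maps (subtopology X U) (subtopology ?E Y) \<phi> \<psi>"
    using hom unfolding homeomorphic_space_def by blast
  have \<phi>: "continuous_map (subtopology X U) (subtopology ?E Y) \<phi>"
    and \<psi>: "continuous_map (subtopology ?E Y) (subtopology X U) \<psi>"
    and inv: "\<And>x. x \<in> U \<Longrightarrow> \<psi> (\<phi> x) = x"
    using hm U(1) by (auto simp: homeomorphic_maps_def)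
  have YW: "Y \<subseteq> topspace ?E \<inter> W" using Y by (auto simp: retract_of_space_def)
  obtain q where q: "continuous_map (subtopology ?E W) (subtopology (subtopology ?E W) Y) q" "\<And>y. y \<in> Y \<Longrightarrow> q y = y"
    using Y unfolding retract_of_space_def by blast
  have "subtopology (subtopology ?E W) Y = subtopology ?E Y"
    using YW by (simp add: subtopology_subtopology Int_absorb1)
  then have q': "continuous_map (subtopology ?E W) (subtopology ?E Y) q" using q(1) by simp
  have normal: "normal_space X" using X compact_Hausdorff_or_regular_imp_normal_space by blast
  have \<phi>C: "continuous_map (subtopology X C) ?E \<phi>"
    using continuous_map_from_subtopology_mono[OF continuous_map_restrict_range[OF \<phi>] C(2)] .
  \<comment> \<open>Tietze's theorem extends the embedding of \<open>C\<close> one coordinate at a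
    time.\<close>
  have "\<exists>g. continuous_map X euclideanreal g \<and> (\<forall>x\<in>C. g x = \<phi> x i)" for i
  proof -
    have "continuous_map (subtopology X C) (powertop_real UNIV) \<phi>"
      using \<phi>C unfolding Euclidean_space_def by (rule continuous_map_restrict_range)
    then have "continuous_map (subtopology X C) euclideanreal (\<lambda>x. \<phi> x i)"
      by (simp add: continuous_map_componentwise_UNIV)
    then show ?thesis using normal C(1) unfolding normal_space_iff_Tietze by blast
  qed
  then obtain g where g: "\<And>i. continuous_map X euclideanreal (g i)" "\<And>i x. x \<in> C \<Longrightarrow> g i x = \<phi> x i" by metis
  \<comment> \<open>Coordinates from \<open>n\<close> on are set to 0, as membership in
    \<open>Euclidean_space n\<close> requires.\<close>
  define \<Phi> where "\<Phi> x i = (if i < n then g i x else 0)" for x and i :: nat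
  have \<Phi>: "continuous_map X ?E \<Phi>"
    using g(1) unfolding \<Phi>_def[abs_def] by (simp add: continuous_map_componentwise_Euclidean_space)
  have \<phi>Y: "\<phi> x \<in> Y \<and> \<phi> x \<in> topspace ?E" if "x \<in> U" for x
    using continuous_map_image_subset_topspace[OF \<phi>] that U(1) by auto
  have \<Phi>C: "\<Phi> x = \<phi> x" if "x \<in> C" for x
    using \<phi>Y[of x] that C(2) g(2)[OF that] by (auto simp: \<Phi>_def topspace_Euclidean_space fun_eq_iff)
  \<comment> \<open>Where the extension lands in the open set \<open>W\<close>, it can be retracted
    to \<open>Y\<close> and carried back to \<open>U\<close>.\<close>
  define N where "N = {x \<in> topspace X. \<Phi> x \<in> W}"
  have N: "openin X N" unfolding N_def by (rule openin_continuous_map_preimage[OF \<Phi> W])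
  have "continuous_map (subtopology X N) (subtopology ?E W) \<Phi>"
    using continuous_map_from_subtopology[OF \<Phi>, of N] by (auto simp: continuous_map_in_subtopology N_def)
  from continuous_map_compose[OF continuous_map_compose[OF this q'] \<psi>]
  have \<rho>: "continuous_map (subtopology X N) (subtopology X U) (\<psi> \<circ> (q \<circ> \<Phi>))" .
  show ?thesis
  proof (rule that[OF N])
    show "C \<subseteq> N"
    proof
      fix x assume x: "x \<in> C"
      then have "\<Phi> x \<in> W" using \<Phi>C \<phi>Y C(2) YW by (metis IntE subsetD)
      then show "x \<in> N" using x C(1) closedin_subset by (fastforce simp: N_def)
    qed
    show "continuous_map (subtopology X N) X (\<psi> \<circ> (q \<circ> \<Phi>))"
      by (rule continuous_map_restrict_range[OF \<rho>])
    show "(\<psi> \<circ> (q \<circ> \<Phi>)) ` N \<subseteq> U"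
      using continuous_map_image_subset_topspace[OF \<rho>] openin_subset[OF N] by (auto simp: image_subset_iff)
    show "(\<psi> \<circ> (q \<circ> \<Phi>)) x = x" if x: "x \<in> C" for x
    proof -
      have "x \<in> U" using C(2) x by blast
      then show ?thesis using \<Phi>C[OF x] q(2) \<phi>Y[of x] inv[of x] by simp
    qed
  qed
qed

context closed_manifold begin

lemma tame_homotopic_cong:
  assumes "tame_homotopic \<theta> F \<phi> \<psi>" "\<And>x. x \<in> F \<Longrightarrow> \<psi> x = \<psi>' x"
  shows "tame_homotopic \<theta> F \<phi> \<psi>'"
  using assms(1) unfolding tame_homotopic_def
proof (elim exE conjE)
  fix T H B
  assume h: "0 \<le> T" "continuous_map (prod_topology (top_of_set {0..T}) (subtopology M F)) M (\<lambda>(t, x). H t x)"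
    "\<forall>x\<in>F. H 0 x = \<phi> x \<and> H T x = \<psi> x \<and> \<bar>line_integral \<theta> 0 T (\<lambda>t. H t x)\<bar> \<le> B"
  have "\<forall>x\<in>F. H 0 x = \<phi> x \<and> H T x = \<psi>' x \<and> \<bar>line_integral \<theta> 0 T (\<lambda>t. H t x)\<bar> \<le> B"
    using h(3) assms(2) by simp
  with h(1,2) show "\<exists>T H B. 0 \<le> T \<and>
     continuous_map (prod_topology (top_of_set {0..T}) (subtopology M F)) M (\<lambda>(t, x). H t x) \<and>
     (\<forall>x\<in>F. H 0 x = \<phi> x \<and> H T x = \<psi>' x \<and> \<bar>line_integral \<theta> 0 T (\<lambda>t. H t x)\<bar> \<le> B)"
    by (intro exI conjI)
qed

text \<open>One stage towards \<rho>, inside a single chart ball. The discarded points are those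
  whose target lies in the inner ball \<open>S\<close> while their current position \<phi> is
  outside \<open>V\<close>; a point already at its target is never among them.\<close>

lemma deform_step:
  assumes \<theta>: "continuous_closed_one_form M \<theta>" and F: "openin M F"
    and \<phi>: "continuous_map (subtopology M F) M \<phi>" and \<rho>: "continuous_map (subtopology M F) M \<rho>"
    and c: "c \<in> A" and r: "r > 0" "cball x r \<subseteq> chart_im c"
    and U: "U \<in> fst \<theta>" "chart_preimage c (cball x r) \<subseteq> U"
  shows "\<exists>F' \<psi>. openin M F' \<and> F' \<subseteq> F \<and> continuous_map (subtopology M F') M \<psi> \<and> tame_homotopic \<theta> F' \<phi> \<psi> \<and>
    (\<forall>y\<in>F. \<phi> y = \<rho> y \<longrightarrow> y \<in> F' \<and> \<psi> y = \<rho> y) \<and>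
    (\<forall>y\<in>F'. \<rho> y \<in> chart_preimage c (ball x (r / 3)) \<longrightarrow> \<psi> y = \<rho> y)"
proof -
  define V where "V = chart_preimage c (ball x r)"
  define S where "S = chart_preimage c (cball x (2 * r / 3))"
  \<comment> \<open>The bump of radius \<open>2 * r / 3\<close> is at least 1/2 on the ball of
    radius \<open>r / 3\<close>, so doubling and truncating gives 1 there, and 0 off
    \<open>S\<close>.\<close>
  define lam where "lam y = min 1 (2 * bump c x (2 * r / 3) y)" for y
  have r': "2 * r / 3 > 0" "cball x (2 * r / 3) \<subseteq> chart_im c" using r by auto
  have lam01: "0 \<le> lam y" "lam y \<le> 1" for y using bump_bounds(1)[of c x "2 * r / 3" y] by (auto simp: lam_def)
  have lam0: "lam y = 0" if "y \<notin> S" for y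
  proof -
    have "y \<notin> chart_preimage c (ball x (2 * r / 3))" using that by (auto simp: S_def chart_preimage_def)
    then have "\<not> bump c x (2 * r / 3) y > 0" using bump_pos_iff[OF r'(1)] by blast
    then show ?thesis using bump_bounds(1)[of c x "2 * r / 3" y] by (simp add: lam_def)
  qed
  have lam1: "lam y = 1" if "y \<in> chart_preimage c (ball x (r / 3))" for y
  proof -
    have y: "y \<in> chart_dom c" "dist (coord c y) x < r / 3" using that by (auto simp: chart_preimage_def dist_commute)
    then have "dist (coord c y) x / (2 * r / 3) \<le> 1 / 2" using r(1) by (simp add: field_simps)
    then have "1 / 2 \<le> bump c x (2 * r / 3) y" using y(1) unfolding bump_def if_P[OF y(1)] by linarith
    then show ?thesis by (simp add: lam_def)
  qed
  have lamc: "continuous_map M euclideanreal lam"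
    unfolding lam_def using bump_continuous[OF c r'] by (intro continuous_map_real_min continuous_map_real_mult_left) auto
  have SV: "S \<subseteq> V" using r(1) by (auto simp: S_def V_def chart_preimage_def)
  have V: "openin M V" unfolding V_def by (rule openin_chart_preimage[OF c open_ball])
  have opS: "openin M (topspace M - S)"
    unfolding S_def using closedin_chart_preimage[OF c fd_compact_cball r'(2)] by blast
  have FM: "F \<subseteq> topspace M" using openin_subset[OF F] .
  have im: "\<phi> y \<in> topspace M" "\<rho> y \<in> topspace M" if "y \<in> F" for y
    using continuous_map_image_subset_topspace[OF \<phi>] continuous_map_image_subset_topspace[OF \<rho>] that FM
    by (auto simp: image_subset_iff)
  \<comment> \<open>On \<open>P1\<close> the weight \<open>lam (\<rho> y)\<close> is 0 and nothing
    moves; on \<open>P2\<close> current position and target lie in the chart ball. On the overlap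
    both descriptions of \<open>G\<close> agree, which gives continuity on the union.\<close>
  define P1 where "P1 = {y \<in> F. \<rho> y \<in> topspace M - S}"
  define P2 where "P2 = {y \<in> F. \<rho> y \<in> V} \<inter> {y \<in> F. \<phi> y \<in> V}"
  have P: "openin M P1" "openin M P2"
    unfolding P1_def P2_def
    by (intro openin_Int openin_map_preimage[OF F \<rho>] openin_map_preimage[OF F \<phi>] V opS)+
  define F' where "F' = P1 \<union> P2"
  have F': "openin M F'" "F' \<subseteq> F" "P1 \<subseteq> F'" "P2 \<subseteq> F'"
    using openin_Un[OF P] by (auto simp: F'_def P1_def P2_def)
  have F'M: "F' \<subseteq> topspace M" using F'(2) FM by blast
  define pt where "pt s y = coord c (\<phi> y) + (s * lam (\<rho> y)) *\<^sub>R (coord c (\<rho> y) - coord c (\<phi> y))" for s y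
  define G where "G s y = (if y \<in> P2 then chart_inv c (pt s y) else \<phi> y)" for s y
  have P2D: "\<phi> y \<in> chart_dom c" "\<rho> y \<in> chart_dom c" "coord c (\<phi> y) \<in> ball x r" "coord c (\<rho> y) \<in> ball x r"
    if "y \<in> P2" for y using that by (auto simp: P2_def V_def chart_preimage_def)
  have ptb: "pt s y \<in> ball x r" if "y \<in> P2" "s \<in> {0..1}" for s y
    unfolding pt_def using P2D[OF that(1)] that(2) lam01[of "\<rho> y"]
    by (intro convex_combination_in_ball) (auto intro: mult_le_one)
  have pti: "pt s y \<in> chart_im c" if "y \<in> P2" "s \<in> {0..1}" for s y
    using ptb[OF that] r(2) by (meson ball_subset_cball subsetD)
  have GV: "G s y \<in> V" if "y \<in> P2" "s \<in> {0..1}" for s y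
    using ptb[OF that] pti[OF that] that(1) by (simp add: G_def V_def chart_preimage_def chart_inv_in del: mem_ball)
  have G0: "G 0 y = \<phi> y" for y
    using P2D(1)[of y] c by (simp add: G_def pt_def)
  have Gphi: "G s y = \<phi> y" if "y \<in> P1" for s y
    using that lam0[of "\<rho> y"] P2D(1)[of y] c by (simp add: G_def pt_def P1_def)
  have Geq: "G s y = \<rho> y" if "\<phi> y = \<rho> y" for s y
    using that P2D(1)[of y] c by (simp add: G_def pt_def)
  let ?I = "top_of_set {0..1::real}"
  have sub: "subtopology (prod_topology ?I (subtopology M F')) ({0..1} \<times> P) = prod_topology ?I (subtopology M P)" if "P \<subseteq> F'" for P
    using that by (simp add: subtopology_Times subtopology_subtopology Int_absorb1)
  have phisub: "continuous_map (subtopology M P) M \<phi>" "continuous_map (subtopology M P) M \<rho>" if "P \<subseteq> F'" for P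
    using continuous_map_from_subtopology_mono[OF \<phi>] continuous_map_from_subtopology_mono[OF \<rho>] that F'(2) by blast+
  have Gc: "continuous_map (prod_topology ?I (subtopology M F')) M (\<lambda>(s, y). G s y)"
  proof (rule continuous_map_locally)
    fix z assume z: "z \<in> topspace (prod_topology ?I (subtopology M F'))"
    then have z1: "fst z \<in> {0..1}" and "snd z \<in> F'" by auto
    have op: "openin (prod_topology ?I (subtopology M F')) ({0..1} \<times> P)" if "openin M P" "P \<subseteq> F'" for P
    proof -
      have "openin (subtopology M F') P" using that by (simp add: openin_subset_topspace_eq openin_subtopology) (metis Int_absorb2)
      then show ?thesis by (simp add: openin_prod_Times_iff)
    qed
    from \<open>snd z \<in> F'\<close> consider "snd z \<in> P1" | "snd z \<in> P2" by (auto simp: F'_def)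
    then show "\<exists>U. openin (prod_topology ?I (subtopology M F')) U \<and> z \<in> U \<and>
        continuous_map (subtopology (prod_topology ?I (subtopology M F')) U) M (\<lambda>(s, y). G s y)"
    proof cases
      case 1
      have "continuous_map (prod_topology ?I (subtopology M P1)) M (\<lambda>p. \<phi> (snd p))"
        using continuous_map_compose[OF continuous_map_snd phisub(1)[OF F'(3)]] by (simp add: o_def)
      then have "continuous_map (prod_topology ?I (subtopology M P1)) M (\<lambda>(s, y). G s y)"
        by (rule continuous_map_eq) (auto simp: Gphi)
      then show ?thesis using op[OF P(1) F'(3)] z1 1 sub[OF F'(3)]
        by (intro exI[of _ "{0..1} \<times> P1"]) (auto simp: mem_Times_iff)
    next
      case 2
      let ?X = "prod_topology ?I (subtopology M P2)"
      have X: "snd p \<in> P2 \<and> fst p \<in> {0..1}" if "p \<in> topspace ?X" for p using that by auto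
      have phic: "continuous_map ?X M (\<lambda>p. \<phi> (snd p))" "continuous_map ?X M (\<lambda>p. \<rho> (snd p))"
        using continuous_map_compose[OF continuous_map_snd phisub(1)[OF F'(4)]]
          continuous_map_compose[OF continuous_map_snd phisub(2)[OF F'(4)]] by (simp_all add: o_def)
      have cc: "continuous_map ?X euclidean (\<lambda>p. coord c (\<phi> (snd p)))" "continuous_map ?X euclidean (\<lambda>p. coord c (\<rho> (snd p)))"
        using X P2D by (intro continuous_coord_compose[OF c] phic; blast)+
      have "continuous_map ?X euclideanreal (\<lambda>p. lam (\<rho> (snd p)))"
        using continuous_map_compose[OF phic(2) lamc] by (simp add: o_def)
      moreover have "continuous_map ?X euclideanreal fst"
        by (rule continuous_map_restrict_range[OF continuous_map_fst])
      ultimately have "continuous_map ?X euclidean (\<lambda>p. pt (fst p) (snd p))"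
        unfolding pt_def by (intro continuous_map_add continuous_map_scaleR continuous_map_real_mult continuous_map_diff cc)
      then have "continuous_map ?X M (\<lambda>p. chart_inv c (pt (fst p) (snd p)))"
        by (rule continuous_chart_inv_compose[OF c]) (use X pti in blast)
      then have "continuous_map ?X M (\<lambda>(s, y). G s y)"
        by (rule continuous_map_eq) (auto simp: G_def)
      then show ?thesis using op[OF P(2) F'(4)] z1 2 sub[OF F'(4)]
        by (intro exI[of _ "{0..1} \<times> P2"]) (auto simp: mem_Times_iff)
    qed
  qed
  obtain B where B: "\<And>y. y \<in> chart_preimage c (cball x r) \<Longrightarrow> \<bar>snd \<theta> U y\<bar> \<le> B"
    by (rule closed_form_bounded[OF \<theta> U(1) compactin_chart_preimage[OF c fd_compact_cball r(2)] U(2)]) (rule that; assumption)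
  have VB: "V \<subseteq> chart_preimage c (cball x r)" by (auto simp: V_def chart_preimage_def)
  \<comment> \<open>On \<open>P2\<close> the integral is a difference of two values of one local
    primitive, bounded on the compact ball; elsewhere the track is constant.\<close>
  have "\<bar>line_integral \<theta> 0 1 (\<lambda>t. G t y)\<bar> \<le> 2 * \<bar>B\<bar>" if y: "y \<in> F'" for y
  proof (cases "y \<in> P2")
    case True
    have "line_integral \<theta> 0 1 (\<lambda>t. G t y) = snd \<theta> U (G 1 y) - snd \<theta> U (G 0 y)"
      by (rule line_integral_within[OF \<theta> homotopy_track[OF Gc y F'M] zero_le_one U(1)]) (use GV[OF True] VB U(2) in blast)
    moreover have "\<bar>snd \<theta> U (G 1 y)\<bar> \<le> B" "\<bar>snd \<theta> U (G 0 y)\<bar> \<le> B"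
      using GV[OF True, of 1] GV[OF True, of 0] VB by (intro B; auto)+
    ultimately show ?thesis by linarith
  next
    case False
    have "line_integral \<theta> 0 1 (\<lambda>t. \<phi> y) = 0"
      using y F'(2) by (intro line_integral_const[OF \<theta>] im) auto
    then show ?thesis using False by (simp add: G_def)
  qed
  then have tame: "tame_homotopic \<theta> F' \<phi> (G 1)"
    unfolding tame_homotopic_def using Gc G0
    by (intro exI[of _ 1] exI[of _ G] exI[of _ "2 * \<bar>B\<bar>"]) simp
  have "continuous_map (subtopology M F') (prod_topology ?I (subtopology M F')) (\<lambda>y. (1, y))"
    by (intro continuous_map_pairedI) auto
  from continuous_map_compose[OF this Gc] have G1: "continuous_map (subtopology M F') M (G 1)"
    by (simp add: o_def)
  have keep: "y \<in> F' \<and> G 1 y = \<rho> y" if y: "y \<in> F" "\<phi> y = \<rho> y" for y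
  proof -
    have "y \<in> F'"
      using y im[OF y(1)] SV by (cases "\<rho> y \<in> S") (auto simp: F'_def P1_def P2_def)
    then show ?thesis using Geq[OF y(2)] by simp
  qed
  have reach: "G 1 y = \<rho> y" if y: "y \<in> F'" "\<rho> y \<in> chart_preimage c (ball x (r / 3))" for y
  proof -
    have "\<rho> y \<in> S" using y(2) r(1) by (auto simp: S_def chart_preimage_def)
    then have "y \<in> P2" using y(1) by (auto simp: F'_def P1_def)
    then show ?thesis using lam1[OF y(2)] P2D(2)[of y] c by (simp add: G_def pt_def)
  qed
  have "\<forall>y\<in>F. \<phi> y = \<rho> y \<longrightarrow> y \<in> F' \<and> G 1 y = \<rho> y" by (intro ballI impI keep)
  moreover have "\<forall>y\<in>F'. \<rho> y \<in> chart_preimage c (ball x (r / 3)) \<longrightarrow> G 1 y = \<rho> y" by (intro ballI impI reach)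
  ultimately show ?thesis
    by (intro exI[of _ F'] exI[of _ "G 1"] conjI F'(1,2) G1 tame)
qed

text \<open>The point \<open>y\<close> is moved towards \<open>\<rho> y\<close> along straight lines in one chart after the other; a
  bump function of \<open>\<rho> y\<close> makes each stage continuous, and \<open>F\<close> consists of the points for which all
  the stages are defined.\<close>

lemma deform_to_map:
  assumes \<theta>: "continuous_closed_one_form M \<theta>" and N: "openin M N" and \<rho>: "continuous_map (subtopology M N) M \<rho>"
  obtains F where "openin M F" "F \<subseteq> N" "\<And>y. y \<in> N \<Longrightarrow> \<rho> y = y \<Longrightarrow> y \<in> F" "tame_homotopic \<theta> F (\<lambda>y. y) \<rho>"
proof -
  have NM: "N \<subseteq> topspace M" using openin_subset[OF N] .
  have "\<exists>c r U. c \<in> A \<and> m \<in> chart_dom c \<and> r > 0 \<and> cball (coord c m) r \<subseteq> chart_im c \<and> U \<in> fst \<theta> \<and>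
      chart_preimage c (cball (coord c m) r) \<subseteq> U" if m: "m \<in> topspace M" for m
  proof -
    obtain U where U: "U \<in> fst \<theta>" "m \<in> U" using closed_form_cover[OF \<theta>] m by blast
    obtain c r where "c \<in> A" "m \<in> chart_dom c" "r > 0" "cball (coord c m) r \<subseteq> chart_im c"
      "chart_preimage c (cball (coord c m) r) \<subseteq> U"
      by (rule coordinate_ball_ex[OF closed_form_open[OF \<theta> U(1)] U(2)])
    then show ?thesis using U(1) by blast
  qed
  then obtain c r U where D: "\<And>m. m \<in> topspace M \<Longrightarrow> c m \<in> A \<and> m \<in> chart_dom (c m) \<and> r m > 0 \<and>
      cball (coord (c m) m) (r m) \<subseteq> chart_im (c m) \<and> U m \<in> fst \<theta> \<and>
      chart_preimage (c m) (cball (coord (c m) m) (r m)) \<subseteq> U m"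
    by metis
  \<comment> \<open>\<open>r m / 3\<close> is the radius within which \<open>deform_step\<close>
    reaches the target.\<close>
  define K where "K m = chart_preimage (c m) (ball (coord (c m) m) (r m / 3))" for m
  have K: "openin M (K m) \<and> m \<in> K m" if "m \<in> topspace M" for m
  proof
    show "openin M (K m)" unfolding K_def using D[OF that] by (intro openin_chart_preimage open_ball) blast
    show "m \<in> K m" using D[OF that] by (simp add: K_def chart_preimage_def)
  qed
  obtain I where I: "finite I" "I \<subseteq> topspace M" "topspace M \<subseteq> (\<Union>m\<in>I. K m)"
    by (rule compactin_pointwise_cover[of M "topspace M" K]) (use compact K in \<open>auto simp: compact_space_def\<close>)
  \<comment> \<open>Invariant of the stages: points fixed by \<rho> are kept, and points whose
    target lies in a set already treated have arrived.\<close>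
  have "\<exists>F \<phi>. openin M F \<and> F \<subseteq> N \<and> continuous_map (subtopology M F) M \<phi> \<and> tame_homotopic \<theta> F (\<lambda>y. y) \<phi> \<and>
      (\<forall>y\<in>N. \<rho> y = y \<longrightarrow> y \<in> F \<and> \<phi> y = \<rho> y) \<and> (\<forall>y\<in>F. \<rho> y \<in> (\<Union>m\<in>I. K m) \<longrightarrow> \<phi> y = \<rho> y)"
    using I(1,2)
  proof (induction I)
    case empty
    have "continuous_map (subtopology M N) M (\<lambda>y. y)"
      using continuous_map_from_subtopology[OF continuous_map_id] by (simp add: id_def)
    then show ?case using N tame_homotopic_refl[OF \<theta> NM] by (intro exI[of _ N] exI[of _ "\<lambda>y. y"]) auto
  next
    case (insert m I)
    then obtain F \<phi> where F: "openin M F" "F \<subseteq> N" and \<phi>: "continuous_map (subtopology M F) M \<phi>"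
      and tame: "tame_homotopic \<theta> F (\<lambda>y. y) \<phi>"
      and fixed: "\<forall>y\<in>N. \<rho> y = y \<longrightarrow> y \<in> F \<and> \<phi> y = \<rho> y" and hit: "\<forall>y\<in>F. \<rho> y \<in> (\<Union>m\<in>I. K m) \<longrightarrow> \<phi> y = \<rho> y"
      by auto
    have m: "m \<in> topspace M" using insert by blast
    have "continuous_map (subtopology M F) M \<rho>" by (rule continuous_map_from_subtopology_mono[OF \<rho> F(2)])
    from deform_step[OF \<theta> F(1) \<phi> this, of "c m" "r m" "coord (c m) m" "U m"] D[OF m]
    have "\<exists>F' \<psi>. openin M F' \<and> F' \<subseteq> F \<and> continuous_map (subtopology M F') M \<psi> \<and> tame_homotopic \<theta> F' \<phi> \<psi> \<and>
      (\<forall>y\<in>F. \<phi> y = \<rho> y \<longrightarrow> y \<in> F' \<and> \<psi> y = \<rho> y) \<and> (\<forall>y\<in>F'. \<rho> y \<in> K m \<longrightarrow> \<psi> y = \<rho> y)"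
      unfolding K_def by (elim conjE)
    then obtain F' \<psi> where F': "openin M F'" "F' \<subseteq> F" "continuous_map (subtopology M F') M \<psi>"
      and tame': "tame_homotopic \<theta> F' \<phi> \<psi>"
      and fixed': "\<forall>y\<in>F. \<phi> y = \<rho> y \<longrightarrow> y \<in> F' \<and> \<psi> y = \<rho> y" and hit': "\<forall>y\<in>F'. \<rho> y \<in> K m \<longrightarrow> \<psi> y = \<rho> y"
      by (elim exE conjE) (rule that; assumption)
    have "F' \<subseteq> topspace M" using openin_subset[OF F'(1)] .
    then have t: "tame_homotopic \<theta> F' (\<lambda>y. y) \<psi>"
      by (rule tame_homotopic_trans[OF \<theta> _ tame_homotopic_subset[OF tame F'(2)] tame'])
    have f: "y \<in> F' \<and> \<psi> y = \<rho> y" if "y \<in> N" "\<rho> y = y" for y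
      using fixed[rule_format, OF that] fixed' by simp
    have d: "\<psi> y = \<rho> y" if "y \<in> F'" "\<rho> y \<in> (\<Union>m\<in>insert m I. K m)" for y
    proof (cases "\<rho> y \<in> K m")
      case True
      then show ?thesis using hit' that(1) by simp
    next
      case False
      then have "\<rho> y \<in> (\<Union>m\<in>I. K m)" using that(2) by auto
      then have "\<phi> y = \<rho> y" using hit that(1) F'(2) by (metis subsetD)
      then show ?thesis using fixed' that(1) F'(2) by (metis subsetD)
    qed
    have fx: "\<forall>y\<in>N. \<rho> y = y \<longrightarrow> y \<in> F' \<and> \<psi> y = \<rho> y" by (intro ballI impI f)
    have dx: "\<forall>y\<in>F'. \<rho> y \<in> (\<Union>m\<in>insert m I. K m) \<longrightarrow> \<psi> y = \<rho> y" by (intro ballI impI d)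
    show ?case
      by (rule exI[of _ F'], rule exI[of _ \<psi>]) (intro conjI F'(1,3) t order_trans[OF F'(2) F(2)] fx dx)
  qed
  then obtain F \<phi> where F: "openin M F" "F \<subseteq> N" and tame: "tame_homotopic \<theta> F (\<lambda>y. y) \<phi>"
      and fixed: "\<forall>y\<in>N. \<rho> y = y \<longrightarrow> y \<in> F \<and> \<phi> y = \<rho> y" and hit: "\<forall>y\<in>F. \<rho> y \<in> (\<Union>m\<in>I. K m) \<longrightarrow> \<phi> y = \<rho> y"
    by (elim exE conjE) (rule that; assumption)
  \<comment> \<open>The treated sets cover \<open>M\<close>, so every remaining point has
    arrived.\<close>
  have "\<phi> y = \<rho> y" if "y \<in> F" for y
  proof -
    have "\<rho> y \<in> topspace M"
      using continuous_map_image_subset_topspace[OF \<rho>] that F(2) NM by (auto simp: image_subset_iff)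
    then show ?thesis using hit that I(3) by (metis subsetD)
  qed
  then have t: "tame_homotopic \<theta> F (\<lambda>y. y) \<rho>" by (rule tame_homotopic_cong[OF tame])
  have "y \<in> F" if "y \<in> N" "\<rho> y = y" for y
    by (rule conjunct1[OF mp[OF bspec[OF fixed that(1)] that(2)]])
  then show ?thesis by (rule that[OF F _ t])
qed

end

section \<open>Dynamics near an isolated zero\<close>

text \<open>Weierstrass M-test: the partial sums converge uniformly.\<close>

lemma continuous_map_suminf:
  fixes f :: "nat \<Rightarrow> 'a \<Rightarrow> real"
  assumes "\<And>n. continuous_map X euclideanreal (f n)" "\<And>n x. x \<in> topspace X \<Longrightarrow> \<bar>f n x\<bar> \<le> B n" "summable B"
  shows "continuous_map X euclideanreal (\<lambda>x. suminf (\<lambda>n. f n x))"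
proof -
  have "((\<lambda>x. suminf (\<lambda>n. f n x)) \<longlongrightarrow> (suminf (\<lambda>n. f n x))) (atin X x)" if x: "x \<in> topspace X" for x
  proof (rule swap_uniform_limit')
    show "\<forall>\<^sub>F n in sequentially. ((\<lambda>y. \<Sum>i<n. f i y) \<longlongrightarrow> (\<Sum>i<n. f i x)) (atin X x)"
    proof (intro always_eventually allI tendsto_sum)
      show "(f i \<longlongrightarrow> f i x) (atin X x)" for i
        using assms(1)[of i] x by (simp add: continuous_map_atin)
    qed
    have "summable (\<lambda>n. f n x)"
      by (rule summable_comparison_test[OF _ assms(3)]) (use assms(2)[OF x] in auto)
    then show "(\<lambda>n. \<Sum>i<n. f i x) \<longlonglongrightarrow> (suminf (\<lambda>n. f n x))" by (rule summable_LIMSEQ)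
    show "uniform_limit (topspace X) (\<lambda>n x. \<Sum>i<n. f i x) (\<lambda>x. suminf (\<lambda>n. f n x)) sequentially"
      by (rule Weierstrass_m_test[OF _ assms(3)]) (use assms(2) in simp)
    show "\<forall>\<^sub>F y in atin X x. y \<in> topspace X"
      unfolding eventually_atin using x by blast
  qed simp
  then show ?thesis by (simp add: continuous_map_atin)
qed

locale riemannian_field = manifold_field M A v + riemannian_manifold M A g
  for M :: "'a topology" and A :: "('a, 'e::real_normed_vector) chart set" and v g
begin

lemma flow_path: "x \<in> topspace M \<Longrightarrow> continuous_map euclideanreal M (fl x)"
  using flow_curve by (simp add: integral_curve_def)

lemma zeros_subset: "zeros M A v \<subseteq> topspace M"
  by (auto simp: zeros_def)

text \<open>If trajectories starting arbitrarily close to \<open>p\<close> left the ball of radius \<open>r\<close> and came back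
  arbitrarily close to \<open>p\<close>, they would cross the sphere of radius \<open>r\<close> near a chain recurrent point:
  the chain is closed by a jump near \<open>p\<close>, and its times are long because \<open>p\<close> is a rest point.\<close>

lemma no_return:
  assumes p: "p \<in> zeros M A v" and iso: "openin (subtopology M (chain_recurrent_set M A g v)) {p}"
  obtains c r \<rho> where "c \<in> A" "p \<in> chart_dom c" "r > 0" "cball (coord c p) r \<subseteq> chart_im c"
    "\<rho> > 0" "cball (coord c p) \<rho> \<subseteq> chart_im c"
    "\<And>x a b s. x \<in> topspace M \<Longrightarrow> a \<le> s \<Longrightarrow> s \<le> b \<Longrightarrow> fl x a \<in> chart_preimage c (ball (coord c p) \<rho>) \<Longrightarrow>
      fl x b \<in> chart_preimage c (ball (coord c p) \<rho>) \<Longrightarrow> fl x s \<in> chart_preimage c (ball (coord c p) r)"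
proof -
  let ?R = "chain_recurrent_set M A g v"
  have pM: "p \<in> topspace M" using p zeros_subset by blast
  obtain N where N: "openin M N" "{p} = N \<inter> ?R" using iso by (auto simp: openin_subtopology)
  then have pN: "p \<in> N" by blast
  obtain c r where c: "c \<in> A" "p \<in> chart_dom c" and r: "r > 0" "cball (coord c p) r \<subseteq> chart_im c"
    "chart_preimage c (cball (coord c p) r) \<subseteq> N"
    by (rule coordinate_ball_ex[OF N(1) pN])
  let ?x0 = "coord c p"
  let ?W = "chart_preimage c (ball ?x0 r)" and ?B = "chart_preimage c (cball ?x0 r)"
  define K where "K = chart_preimage c (sphere ?x0 r)"
  have opW: "openin M ?W" by (rule openin_chart_preimage[OF c(1) open_ball])
  have pW: "p \<in> ?W" using c r by (simp add: chart_preimage_def)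
  have clB: "closedin M ?B" by (rule closedin_chart_preimage[OF c(1) fd_compact_cball r(2)])
  have BK: "?B \<subseteq> ?W \<union> K" "?W \<subseteq> ?B" by (auto simp: K_def chart_preimage_def)
  have K_eq: "K = ?B - ?W" by (auto simp: K_def chart_preimage_def)
  have clK: "closedin M K" unfolding K_eq by (rule closedin_diff[OF clB opW])
  have cK: "compactin M K" by (rule closedin_compact_space[OF compact clK])
  have pK: "p \<notin> K" using pW by (simp add: K_eq)
  \<comment> \<open>The sphere lies in \<open>N\<close>, whose only chain recurrent point is
    \<open>p\<close>, the centre.\<close>
  have KR: "y \<notin> ?R" if "y \<in> K" for y
  proof
    assume "y \<in> ?R"
    moreover have "y \<in> N" using that r(3) unfolding K_eq by blast
    ultimately have "y \<in> {p}" unfolding N(2) by blast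
    then show False using pK that by simp
  qed
  \<comment> \<open>As \<open>y\<close> is not chain recurrent, some \<delta> and \<open>T\<close>
    admit no chain; the neighbourhoods of \<open>y\<close> and \<open>p\<close> are chosen so that a
    return would produce one.\<close>
  have local: "\<exists>Ny Wy. openin M Ny \<and> y \<in> Ny \<and> openin M Wy \<and> p \<in> Wy \<and>
      (\<forall>x t s. x \<in> Wy \<longrightarrow> 0 \<le> t \<longrightarrow> t \<le> s \<longrightarrow> fl x t \<in> K \<inter> Ny \<longrightarrow> fl x s \<notin> Wy)" if y: "y \<in> K" for y
  proof -
    have yM: "y \<in> topspace M" using y clK closedin_subset by blast
    define chain where "chain \<delta> T \<longleftrightarrow> (\<exists>k (z::nat \<Rightarrow> 'a) (s::nat \<Rightarrow> real).
       (\<forall>j\<le>k. z j \<in> topspace M \<and> s j > T) \<and> riem_dist M A g y (z 0) < ereal \<delta> \<and>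
       riem_dist M A g (fl (z k) (s k)) y < ereal \<delta> \<and>
       (\<forall>j<k. riem_dist M A g (fl (z j) (s j)) (z (Suc j)) < ereal \<delta>))" for \<delta> T :: real
    have "y \<in> ?R \<longleftrightarrow> (\<forall>\<delta>>0. \<forall>T>0. chain \<delta> T)"
      unfolding chain_recurrent_set_def chain_def using yM by simp
    moreover have "y \<notin> ?R" by (rule KR[OF y])
    ultimately obtain \<delta> T where dT: "\<delta> > 0" "T > 0" and nochain: "\<not> chain \<delta> T" by blast
    obtain Ny where Ny: "openin M Ny" "y \<in> Ny" "\<And>a b. a \<in> Ny \<Longrightarrow> b \<in> Ny \<Longrightarrow> riem_dist M A g a b < ereal \<delta>"
      by (rule riem_dist_small[OF yM dT(1)]) (rule that; assumption)
    obtain W1 where W1: "openin M W1" "p \<in> W1" "\<And>a b. a \<in> W1 \<Longrightarrow> b \<in> W1 \<Longrightarrow> riem_dist M A g a b < ereal \<delta>"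
      by (rule riem_dist_small[OF pM dT(1)]) (rule that; assumption)
    \<comment> \<open>The rest point \<open>p\<close> stays off \<open>K\<close> for all times in
      \<open>{-T..T}\<close>; by the tube lemma so do all points near \<open>p\<close>.\<close>
    let ?far = "{q \<in> topspace (prod_topology M euclideanreal). (\<lambda>(x, t). fl x t) q \<in> topspace M - K}"
    have "openin (prod_topology M euclideanreal) ?far"
      by (rule openin_continuous_map_preimage[OF flow_continuous]) (use clK in blast)
    moreover have "{p} \<times> {-T..T} \<subseteq> ?far" using pM pK flow_zero[OF p] by auto
    ultimately obtain W2 V where W2: "openin M W2" "p \<in> W2" "{-T..T} \<subseteq> V" "W2 \<times> V \<subseteq> ?far"
      using tube_lemma_right[of M euclideanreal ?far "{-T..T}" p] pM by (auto simp: compactin_euclidean_iff)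
    have far: "fl x t \<notin> K" if "x \<in> W2" "\<bar>t\<bar> \<le> T" for x t
    proof -
      have "t \<in> V" using that(2) W2(3) by (auto simp: abs_le_iff)
      then show ?thesis using that(1) W2(4) by auto
    qed
    have "fl x s \<notin> W1 \<inter> W2" if x: "x \<in> W1 \<inter> W2" and ts: "0 \<le> t" "t \<le> s" and K: "fl x t \<in> K \<inter> Ny" for x t s
    proof
      assume z: "fl x s \<in> W1 \<inter> W2"
      have xM: "x \<in> topspace M" using x openin_subset[OF W1(1)] by blast
      have ret: "fl (fl x t) (s - t) = fl x s" using flow_add[OF xM, of t "s - t"] by simp
      \<comment> \<open>Read backwards from \<open>fl x s\<close>, which is near \<open>p\<close>,
        the passage through \<open>K\<close> must also be more than \<open>T\<close> away in
        time.\<close>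
      have "fl (fl x s) (t - s) = fl x t" using flow_add[OF xM, of s "t - s"] by simp
      then have "fl (fl x s) (t - s) \<in> K" using K by simp
      then have "\<bar>t - s\<bar> > T" using far[of "fl x s" "t - s"] z by force
      moreover have "\<bar>t\<bar> > T" using far[of x t] x K by force
      ultimately have T: "t > T" "s - t > T" using ts by auto
      \<comment> \<open>A chain of two trajectory pieces, hence \<open>k = 1\<close>: from
        \<open>fl x t\<close> for time \<open>s - t\<close> to a point near \<open>p\<close>, a jump
        to \<open>x\<close>, then for time \<open>t\<close> back to \<open>fl x t\<close>.\<close>
      let ?z = "\<lambda>j::nat. if j = 0 then fl x t else x" and ?s = "\<lambda>j::nat. if j = 0 then s - t else t"
      have "\<forall>j\<le>1. ?z j \<in> topspace M \<and> ?s j > T" using T xM flow_in[OF xM] by simp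
      moreover have "riem_dist M A g y (?z 0) < ereal \<delta>" using Ny(2,3) K by simp
      moreover have "riem_dist M A g (fl (?z 1) (?s 1)) y < ereal \<delta>" using Ny(2,3) K by simp
      moreover have "\<forall>j<1. riem_dist M A g (fl (?z j) (?s j)) (?z (Suc j)) < ereal \<delta>"
        using W1(3) z x ret by simp
      ultimately have "chain \<delta> T"
        unfolding chain_def by (intro exI[of _ 1] exI[of _ ?z] exI[of _ ?s] conjI)
      then show False using nochain by contradiction
    qed
    then show ?thesis using Ny(1,2) W1(1,2) W2(1,2)
      by (intro exI[of _ Ny] exI[of _ "W1 \<inter> W2"]) (simp add: openin_Int)
  qed
  then obtain Ny Wy where NW: "\<And>y. y \<in> K \<Longrightarrow> openin M (Ny y) \<and> y \<in> Ny y"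
    "\<And>y. y \<in> K \<Longrightarrow> openin M (Wy y) \<and> p \<in> Wy y"
    "\<And>y x t s. y \<in> K \<Longrightarrow> x \<in> Wy y \<Longrightarrow> 0 \<le> t \<Longrightarrow> t \<le> s \<Longrightarrow> fl x t \<in> K \<inter> Ny y \<Longrightarrow> fl x s \<notin> Wy y"
    by metis
  obtain F where F: "finite F" "F \<subseteq> K" "K \<subseteq> (\<Union>y\<in>F. Ny y)"
    by (rule compactin_pointwise_cover[OF cK NW(1)])
  \<comment> \<open>Including \<open>topspace M\<close> makes the intersection open in
    \<open>M\<close> also when \<open>F\<close> is empty.\<close>
  define W' where "W' = ?W \<inter> \<Inter>(insert (topspace M) (Wy ` F))"
  have "openin M (\<Inter>(insert (topspace M) (Wy ` F)))"
    using F NW(2) by (intro openin_Inter) auto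
  then have W': "openin M W'" unfolding W'_def using opW by blast
  have pW': "p \<in> W'" using pW pM NW(2) F(2) by (auto simp: W'_def)
  obtain \<rho> where \<rho>: "\<rho> > 0" "cball ?x0 \<rho> \<subseteq> chart_im c" "chart_preimage c (cball ?x0 \<rho>) \<subseteq> W'"
    by (rule coordinate_ball[OF c W' pW'])
  have small: "chart_preimage c (ball ?x0 \<rho>) \<subseteq> W'"
    using \<rho>(3) by (auto simp: chart_preimage_def)
  have main: "fl x s \<in> ?W" if xM: "x \<in> topspace M" and s: "a \<le> s" "s \<le> b"
    and ab: "fl x a \<in> W'" "fl x b \<in> W'" for x a b s
  proof (rule ccontr)
    assume out: "fl x s \<notin> ?W"
    define y where "y = fl x a"
    have yM: "y \<in> topspace M" unfolding y_def by (rule flow_in[OF xM])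
    have yt: "fl y t = fl x (a + t)" for t unfolding y_def by (rule flow_add[OF xM])
    let ?J = "{0..s - a}"
    \<comment> \<open>A trajectory from \<open>?W\<close> to a point outside has to meet the sphere;
      otherwise the open ball and the complement of the closed one would separate a time
      interval.\<close>
    have "\<exists>t\<in>?J. fl y t \<in> K"
    proof (rule ccontr)
      assume "\<not> ?thesis"
      then have noK: "fl y t \<notin> K" if "t \<in> ?J" for t using that by blast
      let ?A1 = "{t. fl y t \<in> ?W}" and ?A2 = "{t. fl y t \<in> topspace M - ?B}"
      have "open ?A1" "open ?A2"
        using openin_continuous_map_preimage[OF flow_path[OF yM] opW]
          openin_continuous_map_preimage[OF flow_path[OF yM], of "topspace M - ?B"] clB by auto
      moreover have "?A1 \<inter> ?A2 \<inter> ?J = {}" using BK by blast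
      moreover have "?J \<subseteq> ?A1 \<union> ?A2" using noK BK flow_in[OF yM] by blast
      ultimately have "?A1 \<inter> ?J = {} \<or> ?A2 \<inter> ?J = {}" using connectedD[OF connected_Icc] by metis
      moreover have "0 \<in> ?A1 \<inter> ?J" using ab(1) s flow_0[OF yM] by (simp add: y_def W'_def)
      moreover have "s - a \<in> ?A2 \<inter> ?J"
        using out noK[of "s - a"] BK s flow_in[OF yM] by (auto simp: yt)
      ultimately show False by blast
    qed
    then obtain t where t: "0 \<le> t" "t \<le> s - a" "fl y t \<in> K" by auto
    then obtain q where q: "q \<in> F" "fl y t \<in> Ny q" using F(3) by blast
    have "y \<in> Wy q" "fl y (b - a) \<in> Wy q"
      using ab q(1) by (auto simp: yt) (auto simp: y_def W'_def)
    then show False using NW(3)[of q y t "b - a"] q t s F(2) by auto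
  qed
  show ?thesis
    by (rule that[OF c r(1,2) \<rho>(1,2)]) (use main small in blast)
qed

text \<open>A continuous choice of a time at which the trajectory is in the ball of radius \<open>r\<close> is obtained
  by averaging the rational times at which it is in the ball of radius \<open>\<rho>\<close>.\<close>

lemma basin_null_homotopic:
  assumes c: "c \<in> A" and r: "r > 0" "cball x0 r \<subseteq> chart_im c" and \<rho>: "\<rho> > 0" "cball x0 \<rho> \<subseteq> chart_im c"
    and convex: "\<And>x a b s. x \<in> topspace M \<Longrightarrow> a \<le> s \<Longrightarrow> s \<le> b \<Longrightarrow> fl x a \<in> chart_preimage c (ball x0 \<rho>) \<Longrightarrow>
      fl x b \<in> chart_preimage c (ball x0 \<rho>) \<Longrightarrow> fl x s \<in> chart_preimage c (ball x0 r)"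
  defines "G \<equiv> {m \<in> topspace M. \<exists>t. fl m t \<in> chart_preimage c (ball x0 \<rho>)}"
  shows "openin M G" "null_homotopic_in M G"
proof -
  let ?W = "chart_preimage c (ball x0 \<rho>)" and ?V = "chart_preimage c (ball x0 r)"
  have opW: "openin M ?W" by (rule openin_chart_preimage[OF c open_ball])
  have "G = (\<Union>t. {m \<in> topspace M. fl m t \<in> ?W})" by (auto simp: G_def)
  moreover have "openin M {m \<in> topspace M. fl m t \<in> ?W}" for t
    by (rule openin_continuous_map_preimage[OF flow_continuous_fixed_time opW])
  ultimately show G: "openin M G" by auto
  have GM: "G \<subseteq> topspace M" by (auto simp: G_def)
  \<comment> \<open>An enumeration of the rationals: a series over a dense set of times takes the
    place of an integral over the line.\<close>
  define q :: "nat \<Rightarrow> real" where "q n = of_rat (from_nat n)" for n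
  \<comment> \<open>With these weights both the series of \<open>w n\<close> and that of
    \<open>w n * q n\<close> are dominated by a geometric one.\<close>
  define w where "w n = (1/2)^n / (1 + \<bar>q n\<bar>)" for n
  define \<phi> where "\<phi> = bump c x0 \<rho>"
  have wpos: "w n > 0" for n unfolding w_def by (intro divide_pos_pos) auto
  have wle: "w n \<le> (1/2)^n" "\<bar>w n * q n\<bar> \<le> (1/2)^n" for n
  proof -
    have "(1/2)^n * 1 \<le> (1/2::real)^n * (1 + \<bar>q n\<bar>)" "(1/2)^n * \<bar>q n\<bar> \<le> (1/2::real)^n * (1 + \<bar>q n\<bar>)"
      by (intro mult_left_mono; simp)+
    then show "w n \<le> (1/2)^n" "\<bar>w n * q n\<bar> \<le> (1/2)^n"
      unfolding w_def by (simp_all add: abs_mult divide_le_eq)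
  qed
  have phi01: "0 \<le> \<phi> m" "\<phi> m \<le> 1" for m using bump_bounds \<rho>(1) by (auto simp: \<phi>_def)
  have phic: "continuous_map M euclideanreal (\<lambda>m. \<phi> (fl m t))" for t
    using continuous_map_compose[OF flow_continuous_fixed_time bump_continuous[OF c \<rho>]] by (simp add: o_def \<phi>_def)
  have geo: "summable (\<lambda>n. (1/2::real)^n)" by (rule summable_geometric) simp
  have b0: "\<bar>w n * \<phi> m\<bar> \<le> (1/2)^n" "\<bar>w n * q n * \<phi> m\<bar> \<le> (1/2)^n" for n m
  proof -
    have "\<bar>w n * \<phi> m\<bar> \<le> w n * 1" using wpos[of n] phi01[of m] by (simp add: abs_mult mult_left_mono)
    then show "\<bar>w n * \<phi> m\<bar> \<le> (1/2)^n" using wle(1)[of n] by simp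
    have "\<bar>w n * q n * \<phi> m\<bar> \<le> \<bar>w n * q n\<bar> * 1" using phi01[of m] unfolding abs_mult[of "w n * q n"]
      by (intro mult_left_mono) auto
    then show "\<bar>w n * q n * \<phi> m\<bar> \<le> (1/2)^n" using wle(2)[of n] by simp
  qed
  define S0 where "S0 m = (suminf (\<lambda>n. w n * \<phi> (fl m (q n))))" for m
  define S1 where "S1 m = (suminf (\<lambda>n. w n * q n * \<phi> (fl m (q n))))" for m
  have S0c: "continuous_map M euclideanreal S0" unfolding S0_def
    by (rule continuous_map_suminf[OF _ b0(1) geo]) (intro continuous_map_real_mult_left phic)
  have S1c: "continuous_map M euclideanreal S1" unfolding S1_def
    by (rule continuous_map_suminf[OF _ b0(2) geo]) (intro continuous_map_real_mult_left phic)
  have sum0: "summable (\<lambda>n. w n * \<phi> (fl m (q n)))" and sum1: "summable (\<lambda>n. w n * q n * \<phi> (fl m (q n)))" for m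
    by (rule summable_comparison_test[OF _ geo]; use b0 in auto)+
  \<comment> \<open>The set of visiting times is open and so contains a rational.\<close>
  have hit: "\<exists>n. \<phi> (fl m (q n)) > 0" if m: "m \<in> G" for m
  proof -
    obtain t where mM: "m \<in> topspace M" and t: "fl m t \<in> ?W" using m by (auto simp: G_def)
    have "open {t. fl m t \<in> ?W}"
      using openin_continuous_map_preimage[OF flow_path[OF mM] opW] by simp
    then obtain e where e: "e > 0" "ball t e \<subseteq> {t. fl m t \<in> ?W}" using t open_contains_ball by blast
    obtain s :: rat where s: "t < of_rat s" "of_rat s < t + e" using of_rat_dense[of t "t + e"] e(1) by auto
    then have "of_rat s \<in> ball t e" by (simp add: dist_real_def)
    then have "fl m (q (to_nat s)) \<in> ?W" using e(2) by (auto simp: q_def)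
    then show ?thesis using bump_pos_iff[OF \<rho>(1)] unfolding \<phi>_def by blast
  qed
  have S0pos: "S0 m > 0" if m: "m \<in> G" for m
  proof -
    obtain n where "\<phi> (fl m (q n)) > 0" using hit[OF m] by blast
    then show ?thesis unfolding S0_def using wpos phi01
      by (intro suminf_pos2[OF sum0, where i = n]) (auto simp: less_imp_le)
  qed
  \<comment> \<open>The mean of the sampled times, weighted by \<open>w\<close> and by how deep the
    trajectory is in the ball; on \<open>G\<close> the total weight \<open>S0\<close> is
    positive.\<close>
  define \<tau> where "\<tau> m = S1 m / S0 m" for m
  have average: "(suminf (\<lambda>n. w n * (q n - \<tau> m) * \<phi> (fl m (q n)))) = 0"
      "summable (\<lambda>n. w n * (q n - \<tau> m) * \<phi> (fl m (q n)))" if m: "m \<in> G" for m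
  proof -
    have e: "w n * (q n - \<tau> m) * \<phi> (fl m (q n)) = w n * q n * \<phi> (fl m (q n)) - \<tau> m * (w n * \<phi> (fl m (q n)))" for n
      by (simp add: algebra_simps)
    show "summable (\<lambda>n. w n * (q n - \<tau> m) * \<phi> (fl m (q n)))"
      unfolding e by (intro summable_diff sum1 summable_mult sum0)
    have "(suminf (\<lambda>n. w n * (q n - \<tau> m) * \<phi> (fl m (q n)))) = S1 m - \<tau> m * S0 m"
      unfolding e S1_def S0_def using sum0 sum1
      by (subst suminf_diff[symmetric]) (auto intro: summable_mult simp: suminf_mult)
    then show "(suminf (\<lambda>n. w n * (q n - \<tau> m) * \<phi> (fl m (q n)))) = 0"
      using S0pos[OF m] by (simp add: \<tau>_def)
  qed
  \<comment> \<open>The deviations from the mean sum to zero, so some visit is no later and some no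
    earlier than \<open>\<tau> m\<close>; \<open>convex\<close> then places the trajectory in the
    larger ball at that time.\<close>
  have inV: "fl m (\<tau> m) \<in> ?V" if m: "m \<in> G" for m
  proof -
    obtain i where i: "\<phi> (fl m (q i)) > 0" using hit[OF m] by blast
    have "\<exists>n. \<phi> (fl m (q n)) > 0 \<and> q n \<le> \<tau> m"
    proof (rule ccontr)
      assume "\<not> ?thesis"
      then have lt: "q n - \<tau> m > 0" if "\<phi> (fl m (q n)) > 0" for n using that by force
      have "w n * (q n - \<tau> m) * \<phi> (fl m (q n)) \<ge> 0" for n
        using lt[of n] wpos[of n] phi01(1)[of "fl m (q n)"] by (cases "\<phi> (fl m (q n)) = 0") auto
      moreover have "w i * (q i - \<tau> m) * \<phi> (fl m (q i)) > 0" using i lt[OF i] wpos by simp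
      ultimately have "(suminf (\<lambda>n. w n * (q n - \<tau> m) * \<phi> (fl m (q n)))) > 0"
        by (rule suminf_pos2[OF average(2)[OF m]])
      then show False using average(1)[OF m] by simp
    qed
    then obtain a where a: "\<phi> (fl m (q a)) > 0" "q a \<le> \<tau> m" by blast
    have "\<exists>n. \<phi> (fl m (q n)) > 0 \<and> \<tau> m \<le> q n"
    proof (rule ccontr)
      assume "\<not> ?thesis"
      then have lt: "q n - \<tau> m < 0" if "\<phi> (fl m (q n)) > 0" for n using that by force
      have "- (w n * (q n - \<tau> m) * \<phi> (fl m (q n))) \<ge> 0" for n
      proof (cases "\<phi> (fl m (q n)) = 0")
        case False
        then have "\<phi> (fl m (q n)) > 0" using phi01(1)[of "fl m (q n)"] by linarith
        then show ?thesis using lt[of n] wpos[of n] by (simp add: mult_nonneg_nonpos mult_nonpos_nonneg)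
      qed simp
      moreover have "- (w i * (q i - \<tau> m) * \<phi> (fl m (q i))) > 0"
        using i lt[OF i] wpos[of i] by (simp add: mult_pos_neg mult_neg_pos)
      ultimately have "(suminf (\<lambda>n. - (w n * (q n - \<tau> m) * \<phi> (fl m (q n))))) > 0"
        by (rule suminf_pos2[OF summable_minus[OF average(2)[OF m]]])
      then show False using average(1)[OF m] suminf_minus[OF average(2)[OF m]] by simp
    qed
    then obtain b where b: "\<phi> (fl m (q b)) > 0" "\<tau> m \<le> q b" by blast
    show ?thesis
      using convex[of m "q a" "\<tau> m" "q b"] a b bump_pos_iff[OF \<rho>(1)] m GM unfolding \<phi>_def by blast
  qed
  let ?X = "subtopology M G"
  have tauc: "continuous_map ?X euclideanreal \<tau>"
    unfolding \<tau>_def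
  proof (rule continuous_map_real_divide)
    show "continuous_map ?X euclideanreal S1" "continuous_map ?X euclideanreal S0"
      using continuous_map_from_subtopology S0c S1c by blast+
    show "S0 m \<noteq> 0" if "m \<in> topspace ?X" for m using S0pos[of m] that by force
  qed
  let ?I = "top_of_set {0..1::real}"
  let ?Y = "prod_topology ?I ?X"
  have fst: "continuous_map ?Y euclideanreal fst" by (rule continuous_map_restrict_range[OF continuous_map_fst])
  have snd: "continuous_map ?Y M snd" by (rule continuous_map_restrict_range[OF continuous_map_snd])
  have taus: "continuous_map ?Y euclideanreal (\<lambda>p. \<tau> (snd p))"
    using continuous_map_compose[OF continuous_map_snd tauc] by (simp add: o_def)
  define e where "e m = fl m (\<tau> m)" for m
  have ec: "continuous_map ?Y M (\<lambda>p. e (snd p))" unfolding e_def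
    by (rule continuous_flow_compose[OF snd taus])
  have e: "e m \<in> chart_dom c" "coord c (e m) \<in> ball x0 r" if "m \<in> G" for m
    using inV[OF that] by (auto simp: e_def chart_preimage_def)
  \<comment> \<open>Each point first flows for time \<open>\<tau> m\<close>, which brings the basin
    into the chart ball; there it shrinks along straight lines to the centre.\<close>
  have "homotopic_with (\<lambda>_. True) ?X M (\<lambda>m. m) e"
  proof (subst homotopic_with, simp, intro exI conjI ballI)
    show "continuous_map ?Y M (\<lambda>p. fl (snd p) (fst p * \<tau> (snd p)))"
      by (intro continuous_flow_compose snd continuous_map_real_mult fst taus)
    show "fl (snd (0, m)) (fst (0, m) * \<tau> (snd (0, m))) = m" if "m \<in> topspace ?X" for m
      using flow_0[of m] that by simp
    show "fl (snd (1, m)) (fst (1, m) * \<tau> (snd (1, m))) = e m" for m by (simp add: e_def)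
  qed simp
  moreover have "homotopic_with (\<lambda>_. True) ?X M e (\<lambda>_. chart_inv c x0)"
  proof (subst homotopic_with, simp, intro exI conjI ballI)
    let ?pt = "\<lambda>p. coord c (e (snd p)) + fst p *\<^sub>R (x0 - coord c (e (snd p)))"
    have "continuous_map ?Y euclidean (\<lambda>p. coord c (e (snd p)))"
      by (rule continuous_coord_compose[OF c ec]) (use e in auto)
    then have "continuous_map ?Y euclidean ?pt"
      by (intro continuous_map_add continuous_map_scaleR fst continuous_map_diff) simp_all
    then show "continuous_map ?Y M (\<lambda>p. chart_inv c (?pt p))"
    proof (rule continuous_chart_inv_compose[OF c])
      fix p assume "p \<in> topspace ?Y"
      then have p: "fst p \<in> {0..1}" "snd p \<in> G" by auto
      then have "?pt p \<in> ball x0 r"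
        using e(2)[OF p(2)] r(1) by (intro convex_combination_in_ball) auto
      then show "?pt p \<in> chart_im c" using r(2) by (meson ball_subset_cball subsetD)
    qed
    show "chart_inv c (?pt (0, m)) = e m" if "m \<in> topspace ?X" for m
      using e(1)[of m] that c by simp
    show "chart_inv c (?pt (1, m)) = chart_inv c x0" for m by simp
  qed simp
  ultimately have "homotopic_with (\<lambda>_. True) ?X M (\<lambda>m. m) (\<lambda>_. chart_inv c x0)"
    by (rule homotopic_with_trans)
  then show "null_homotopic_in M G" unfolding null_homotopic_in_def by blast
qed

end

section \<open>Growth of the integral along the flow\<close>

context manifold_field begin

lemma local_primitivesD:
  assumes "local_primitives M A \<omega> \<theta>" "U \<in> fst \<theta>"
  shows "openin M U" "smooth_function_on A U (snd \<theta> U)"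
    "c \<in> A \<Longrightarrow> m \<in> chart_dom c \<inter> U \<Longrightarrow> \<omega> c m w = differential (snd \<theta> U) c m w"
proof -
  obtain \<U> f where [simp]: "\<theta> = (\<U>, f)" by fastforce
  note p = bspec[OF conjunct2[OF assms(1)[unfolded local_primitives_def \<open>\<theta> = (\<U>, f)\<close> prod.case]], of U]
  have U: "U \<in> \<U>" using assms(2) by simp
  show "openin M U" "smooth_function_on A U (snd \<theta> U)" using p[OF U] by simp_all
  show "c \<in> A \<Longrightarrow> m \<in> chart_dom c \<inter> U \<Longrightarrow> \<omega> c m w = differential (snd \<theta> U) c m w"
    using bspec[OF bspec[OF conjunct2[OF conjunct2[OF p[OF U]]]], of c m] by simp
qed

lemma one_form_field_invariant:
  assumes \<omega>: "smooth_one_form A \<omega>" and c: "c \<in> A" "c' \<in> A" "m \<in> chart_dom c \<inter> chart_dom c'"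
  shows "\<omega> c m (v c m) = \<omega> c' m (v c' m)"
proof -
  have "\<omega> c m (v c m) = \<omega> c' m (transition_deriv c c' m (v c m))"
    using bspec[OF bspec[OF bspec[OF conjunct2[OF conjunct2[OF \<omega>[unfolded smooth_one_form_def]]] c(1)] c(2)] c(3)]
    by (rule spec)
  moreover have "v c' m = transition_deriv c c' m (v c m)"
    by (rule bspec[OF bspec[OF bspec[OF conjunct2[OF field[unfolded smooth_vector_field_def]] c(1)] c(2)] c(3)])
  ultimately show ?thesis by simp
qed

lemma one_form_field_continuous:
  assumes \<omega>: "smooth_one_form A \<omega>" and c: "c \<in> A"
  shows "continuous_on (chart_im c) (\<lambda>x. \<omega> c (chart_inv c x) (v c (chart_inv c x)))"
proof (rule continuous_on_linear_apply[where h = "\<lambda>x. \<omega> c (chart_inv c x)"])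
  note p = \<omega>[unfolded smooth_one_form_def]
  show "linear (\<omega> c (chart_inv c x))" if "x \<in> chart_im c" for x
    using bspec[OF bspec[OF conjunct1[OF p] c] chart_inv_in[OF that]] .
  show "continuous_on (chart_im c) (\<lambda>x. \<omega> c (chart_inv c x) w)" for w
    by (rule smooth_on_imp_continuous_on, rule spec[OF bspec[OF conjunct1[OF conjunct2[OF p]] c]])
  show "continuous_on (chart_im c) (\<lambda>x. v c (chart_inv c x))"
    by (rule smooth_on_imp_continuous_on[OF smooth_local_field[OF c]])
qed

text \<open>Near each point of \<open>K\<close> the continuous function \<omega>(\<open>v\<close>)
  keeps half of its positive value, and it does not depend on the chart; a finite subcover gives a
  common bound.\<close>

lemma lyapunov_lower_bound:
  assumes \<omega>: "lyapunov_one_form M A v \<omega>" and K: "compactin M K" "K \<inter> zeros M A v = {}"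
  obtains \<kappa> where "\<kappa> > 0" "\<And>m c. m \<in> K \<Longrightarrow> c \<in> A \<Longrightarrow> m \<in> chart_dom c \<Longrightarrow> \<kappa> \<le> \<omega> c m (v c m)"
proof -
  have sm: "smooth_one_form A \<omega>"
    using conjunct1[OF \<omega>[unfolded lyapunov_one_form_def]] by (simp add: smooth_closed_one_form_def)
  have pos: "\<omega> c m (v c m) > 0" if "m \<in> topspace M - zeros M A v" "c \<in> A" "m \<in> chart_dom c" for m c
    using mp[OF bspec[OF bspec[OF conjunct1[OF conjunct2[OF \<omega>[unfolded lyapunov_one_form_def]]] that(1)] that(2)] that(3)] .
  have KM: "K \<subseteq> topspace M" using K(1) by (rule compactin_subset_topspace)
  have "\<exists>N k. openin M N \<and> m \<in> N \<and> k > 0 \<and> (\<forall>q\<in>N. \<forall>c\<in>A. q \<in> chart_dom c \<longrightarrow> k \<le> \<omega> c q (v c q))" if m: "m \<in> K" for m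
  proof -
    obtain c where c: "c \<in> A" "m \<in> chart_dom c" using chart_ex m KM by blast
    let ?h = "\<lambda>x. \<omega> c (chart_inv c x) (v c (chart_inv c x))"
    have hm: "?h (coord c m) > 0" using pos[of m c] m K(2) KM c by auto
    let ?S = "chart_im c \<inter> ?h -` {?h (coord c m) / 2<..}"
    have "open ?S"
      by (rule continuous_open_preimage[OF one_form_field_continuous[OF sm c(1)] chart_open(2)[OF c(1)]]) simp
    then have "openin M (chart_preimage c ?S)" by (rule openin_chart_preimage[OF c(1)])
    moreover have "m \<in> chart_preimage c ?S" using c hm by (auto simp: chart_preimage_def)
    moreover have "?h (coord c m) / 2 \<le> \<omega> c' q (v c' q)" if q: "q \<in> chart_preimage c ?S" "c' \<in> A" "q \<in> chart_dom c'" for q c'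
    proof -
      have qc: "q \<in> chart_dom c" "?h (coord c q) > ?h (coord c m) / 2" using q(1) by (auto simp: chart_preimage_def)
      have "\<omega> c' q (v c' q) = \<omega> c q (v c q)"
        using one_form_field_invariant[OF sm q(2) c(1), of q] q(3) qc(1) by blast
      then show ?thesis using qc c(1) by simp
    qed
    ultimately show ?thesis using hm
      by (intro exI[of _ "chart_preimage c ?S"] exI[of _ "?h (coord c m) / 2"] conjI ballI impI) auto
  qed
  then obtain N k where N: "\<And>m. m \<in> K \<Longrightarrow> openin M (N m) \<and> m \<in> N m"
    "\<And>m. m \<in> K \<Longrightarrow> k m > 0" "\<And>m q c. m \<in> K \<Longrightarrow> q \<in> N m \<Longrightarrow> c \<in> A \<Longrightarrow> q \<in> chart_dom c \<Longrightarrow> k m \<le> \<omega> c q (v c q)"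
    by metis
  obtain F where F: "finite F" "F \<subseteq> K" "K \<subseteq> (\<Union>m\<in>F. N m)"
    by (rule compactin_pointwise_cover[OF K(1) N(1)])
  \<comment> \<open>\<open>Min\<close> needs a nonempty set; the 1 is there for an empty
    \<open>F\<close>.\<close>
  define \<kappa> where "\<kappa> = Min (insert 1 (k ` F))"
  have "\<kappa> > 0" using F(1,2) N(2) by (auto simp: \<kappa>_def)
  moreover have "\<kappa> \<le> \<omega> c m (v c m)" if m: "m \<in> K" "c \<in> A" "m \<in> chart_dom c" for m c
  proof -
    obtain q where q: "q \<in> F" "m \<in> N q" using F(3) m(1) by blast
    have "\<kappa> \<le> k q" using F(1) q(1) by (simp add: \<kappa>_def)
    also have "\<dots> \<le> \<omega> c m (v c m)" using N(3) q m F(2) by blast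
    finally show ?thesis .
  qed
  ultimately show ?thesis using that by blast
qed

lemma primitive_derivative_along_flow:
  assumes prims: "local_primitives M A \<omega> \<theta>" and U: "U \<in> fst \<theta>" "fl x t \<in> U" and x: "x \<in> topspace M"
    and c: "c \<in> A" "fl x t \<in> chart_dom c"
  shows "((\<lambda>s. snd \<theta> U (fl x s)) has_real_derivative \<omega> c (fl x t) (v c (fl x t))) (at t)"
proof -
  let ?f = "snd \<theta> U" and ?\<gamma> = "fl x"
  have "smooth_on (coord c ` (chart_dom c \<inter> U)) (?f \<circ> chart_inv c)"
    using bspec[OF local_primitivesD(2)[OF prims U(1), unfolded smooth_function_on_def] c(1)] .
  then have "(?f \<circ> chart_inv c has_derivative differential ?f c (?\<gamma> t)) (at ((coord c \<circ> ?\<gamma>) t))"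
    using smooth_on_imp_derivative[of _ "?f \<circ> chart_inv c" "coord c (?\<gamma> t)"] c U(2) by (simp add: differential_def)
  moreover have g: "icurve_at ?\<gamma> t" by (rule flow_icurve[OF x])
  then have d: "((coord c \<circ> ?\<gamma>) has_vector_derivative v c (?\<gamma> t)) (at t)" using c by (simp add: icurve_at_def)
  ultimately have "((?f \<circ> chart_inv c) \<circ> (coord c \<circ> ?\<gamma>) has_derivative
      (\<lambda>s. differential ?f c (?\<gamma> t) (s *\<^sub>R v c (?\<gamma> t)))) (at t)"
    using diff_chain_at[of "coord c \<circ> ?\<gamma>" "\<lambda>s. s *\<^sub>R v c (?\<gamma> t)" t] by (simp add: has_vector_derivative_def o_def)
  moreover have "differential ?f c (?\<gamma> t) (s *\<^sub>R v c (?\<gamma> t)) = \<omega> c (?\<gamma> t) (v c (?\<gamma> t)) * s" for s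
  proof -
    have "linear (differential ?f c (?\<gamma> t))"
      using \<open>(?f \<circ> chart_inv c has_derivative _) _\<close> has_derivative_linear by blast
    then show ?thesis using local_primitivesD(3)[OF prims U(1) c(1)] c(2) U(2) by (simp add: linear_scale)
  qed
  ultimately have "((?f \<circ> chart_inv c) \<circ> (coord c \<circ> ?\<gamma>) has_real_derivative \<omega> c (?\<gamma> t) (v c (?\<gamma> t))) (at t)"
    by (simp add: has_field_derivative_def)
  moreover have "\<forall>\<^sub>F s in nhds t. ?\<gamma> s \<in> chart_dom c"
    by (rule icurve_at_nbhd[OF g chart_open(1)[OF c(1)] c(2)])
  then have "\<forall>\<^sub>F s in nhds t. ((?f \<circ> chart_inv c) \<circ> (coord c \<circ> ?\<gamma>)) s = ?f (?\<gamma> s)"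
    by eventually_elim (simp add: c(1))
  ultimately show ?thesis by (subst DERIV_cong_ev[OF refl _ refl, symmetric]) auto
qed

text \<open>The primitive along the trajectory has derivative \<omega>(\<open>v\<close>), at least
  \<kappa>, so subtracting \<open>\<kappa> * t\<close> leaves a nondecreasing function.\<close>

lemma flow_integral_growth:
  assumes prims: "local_primitives M A \<omega> \<theta>" and \<theta>: "continuous_closed_one_form M \<theta>" and x: "x \<in> topspace M"
    and \<kappa>: "\<And>t c. c \<in> A \<Longrightarrow> fl x t \<in> chart_dom c \<Longrightarrow> \<kappa> \<le> \<omega> c (fl x t) (v c (fl x t))"
    and T: "0 \<le> T"
  shows "line_integral \<theta> 0 T (fl x) \<ge> \<kappa> * T"
proof -
  have gc: "continuous_map (top_of_set S) M (fl x)" for S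
    using flow_curve[OF x] continuous_map_from_subtopology unfolding integral_curve_def by blast
  \<comment> \<open>The interval is widened on both sides so that two-sided derivatives exist at 0
    and at \<open>T\<close>.\<close>
  obtain \<Lambda> where \<Lambda>: "primitive_along \<theta> (-1) (T + 1) (fl x) \<Lambda>"
    using primitive_along_exists[OF \<theta> gc, of "-1" "T + 1"] T by auto
  have "line_integral \<theta> 0 T (fl x) = \<Lambda> T - \<Lambda> 0"
    by (rule line_integral_primitive[OF \<theta> gc T]) (rule primitive_along_subset[OF \<Lambda>]; simp)
  moreover have "\<Lambda> 0 - \<kappa> * 0 \<le> \<Lambda> T - \<kappa> * T"
  proof (rule DERIV_nonneg_imp_nondecreasing[OF T, of "\<lambda>t. \<Lambda> t - \<kappa> * t"])
    fix t assume t: "0 \<le> t" "t \<le> T"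
    have tM: "fl x t \<in> topspace M" by (rule flow_in[OF x])
    obtain c where c: "c \<in> A" "fl x t \<in> chart_dom c" using chart_ex[OF tM] by blast
    obtain U where U: "U \<in> fst \<theta>" "fl x t \<in> U" using closed_form_cover[OF \<theta>] tM by blast
    let ?l = "\<omega> c (fl x t) (v c (fl x t))"
    have t': "t \<in> {-1..T + 1}" using t by simp
    obtain V where V: "open V" "t \<in> V"
      "\<And>s. s \<in> V \<Longrightarrow> s \<in> {-1..T + 1} \<Longrightarrow> \<Lambda> s - snd \<theta> U (fl x s) = \<Lambda> t - snd \<theta> U (fl x t)"
      by (rule primitive_alongD[OF \<Lambda> t' U]) (rule that; assumption)
    have "((\<lambda>s. snd \<theta> U (fl x s) + (\<Lambda> t - snd \<theta> U (fl x t))) has_real_derivative ?l) (at t)"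
      using primitive_derivative_along_flow[OF prims U x c] by (auto intro!: derivative_eq_intros)
    then have "(\<Lambda> has_real_derivative ?l) (at t)"
    proof (rule has_field_derivative_transform_within_open)
      show "open (V \<inter> {-1<..<T + 1})" "t \<in> V \<inter> {-1<..<T + 1}" using V(1,2) t by auto
      show "snd \<theta> U (fl x s) + (\<Lambda> t - snd \<theta> U (fl x t)) = \<Lambda> s" if "s \<in> V \<inter> {-1<..<T + 1}" for s
        using V(3)[of s] that by auto
    qed
    then have "((\<lambda>t. \<Lambda> t - \<kappa> * t) has_real_derivative ?l - \<kappa>) (at t)"
      by (auto intro!: derivative_eq_intros)
    then show "\<exists>y. ((\<lambda>t. \<Lambda> t - \<kappa> * t) has_real_derivative y) (at t) \<and> 0 \<le> y"
      using \<kappa>[OF c] by (intro exI[of _ "?l - \<kappa>"]) simp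
  qed
  ultimately show ?thesis by simp
qed

text \<open>The backward track is the forward one from \<open>fl x (- T)\<close>, reversed, and
  reversal changes the sign.\<close>

lemma backward_flow_integral_growth:
  assumes prims: "local_primitives M A \<omega> \<theta>" and \<theta>: "continuous_closed_one_form M \<theta>" and x: "x \<in> topspace M"
    and \<kappa>: "\<And>t c. c \<in> A \<Longrightarrow> fl x t \<in> chart_dom c \<Longrightarrow> \<kappa> \<le> \<omega> c (fl x t) (v c (fl x t))"
    and T: "0 \<le> T"
  shows "line_integral \<theta> 0 T (\<lambda>t. fl x (- t)) \<le> - (\<kappa> * T)"
proof -
  define y where "y = fl x (- T)"
  have y: "y \<in> topspace M" unfolding y_def by (rule flow_in[OF x])
  have yt: "fl y t = fl x (t - T)" for t unfolding y_def by (simp add: flow_add[OF x])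
  have gc: "continuous_map (top_of_set {0..T}) M (fl y)"
    using flow_curve[OF y] continuous_map_from_subtopology unfolding integral_curve_def by blast
  have eta: "continuous_on {0..T} (\<lambda>t. T - t)" "(\<lambda>t. T - t) ` {0..T} \<subseteq> {0..T}"
    by (auto intro!: continuous_intros)
  have "line_integral \<theta> 0 T (\<lambda>t. fl y (T - t)) = - line_integral \<theta> 0 T (fl y)"
    by (rule line_integral_reparam(2)[OF \<theta> gc T eta]) simp_all
  moreover have "\<kappa> * T \<le> line_integral \<theta> 0 T (fl y)"
    by (rule flow_integral_growth[OF prims \<theta> y _ T]) (unfold yt, rule \<kappa>)
  moreover have "(\<lambda>t. fl y (T - t)) = (\<lambda>t. fl x (- t))" by (simp add: yt)
  ultimately show ?thesis by simp
qed

text \<open>For both signs of time a point first follows the tame homotopy and then the flow,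
  forwards or backwards. The homotopy and the change of representative cost bounded amounts, which
  linear growth overcomes.\<close>

lemma movable_from_flow:
  assumes prims: "local_primitives M A \<omega> \<theta>" and rep: "represents M \<theta> \<xi>" and rep': "represents M \<theta>' \<xi>"
    and F: "F \<subseteq> topspace M" and tame: "tame_homotopic \<theta> F (\<lambda>x. x) \<rho>" and \<kappa>0: "\<kappa> > 0"
    and \<kappa>: "\<And>x t c. x \<in> F \<Longrightarrow> c \<in> A \<Longrightarrow> fl (\<rho> x) t \<in> chart_dom c \<Longrightarrow> \<kappa> \<le> \<omega> c (fl (\<rho> x) t) (v c (fl (\<rho> x) t))"
  shows "movable M \<theta>' F"
proof -
  have \<theta>: "continuous_closed_one_form M \<theta>" using rep by (simp add: represents_def)
  obtain C where C: "\<And>T \<gamma>. 0 \<le> T \<Longrightarrow> continuous_map (top_of_set {0..T}) M \<gamma> \<Longrightarrow>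
      \<bar>line_integral \<theta> 0 T \<gamma> - line_integral \<theta>' 0 T \<gamma>\<bar> \<le> C"
    by (rule representatives_bounded_difference[OF rep rep']) (rule that; assumption)
  obtain T0 H B where T0: "0 \<le> T0"
    and H: "continuous_map (prod_topology (top_of_set {0..T0}) (subtopology M F)) M (\<lambda>(t, x). H t x)"
    and HB: "\<forall>x\<in>F. H 0 x = x \<and> H T0 x = \<rho> x \<and> \<bar>line_integral \<theta> 0 T0 (\<lambda>t. H t x)\<bar> \<le> B"
    using tame unfolding tame_homotopic_def by (elim exE conjE) (rule that; assumption)
  note HB = HB[rule_format]
  \<comment> \<open>The homotopy parameter is \<open>\<bar>t\<bar>\<close> capped at
    \<open>T0\<close>; the flow time is 0 while \<open>\<bar>t\<bar> \<le> T0\<close> and afterwards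
    the signed excess of \<open>t\<close>.\<close>
  define h where "h t x = fl (H (min \<bar>t\<bar> T0) x) (max 0 (t - T0) + min 0 (t + T0))" for t x
  let ?X = "prod_topology euclideanreal (subtopology M F)"
  have fst: "continuous_map ?X euclideanreal fst" by (rule continuous_map_fst)
  have "continuous_map ?X (top_of_set {0..T0}) (\<lambda>p. min \<bar>fst p\<bar> T0)"
    unfolding continuous_map_in_subtopology using T0
    by (auto intro!: continuous_map_real_min continuous_map_real_abs fst)
  from continuous_map_compose[OF continuous_map_pairedI[OF this continuous_map_snd] H]
  have Hc: "continuous_map ?X M (\<lambda>p. H (min \<bar>fst p\<bar> T0) (snd p))" by (simp add: o_def)
  have tc: "continuous_map ?X euclideanreal (\<lambda>p. max 0 (fst p - T0) + min 0 (fst p + T0))"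
    by (intro continuous_map_add continuous_map_real_max continuous_map_real_min continuous_map_diff fst) simp_all
  have hc: "continuous_map ?X M (\<lambda>(t, x). h t x)"
    using continuous_flow_compose[OF Hc tc] by (simp add: h_def case_prod_unfold)
  have HM: "H t x \<in> topspace M" if "x \<in> F" "t \<in> {0..T0}" for t x
    using continuous_map_image_subset_topspace[OF H] that F by force
  have rhoM: "\<rho> x \<in> topspace M" if "x \<in> F" for x using HM[OF that, of T0] HB[OF that] T0 by simp
  have track: "continuous_map (top_of_set S) M (\<lambda>t. h t x)" if "x \<in> F" for x S
    using homotopy_track[of UNIV F h x] hc that F continuous_map_from_subtopology by (metis subtopology_UNIV)
  have htrack: "continuous_map (top_of_set {0..T0}) M (\<lambda>t. H t x)" if "x \<in> F" for x
    by (rule homotopy_track[OF H that F])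
  have fwd: "h t x = (if t \<le> T0 then H t x else fl (\<rho> x) (t - T0))" if "x \<in> F" "0 \<le> t" for t x
    using that T0 HM[OF that(1), of t] HB[OF that(1)] by (simp add: h_def flow_0 min_def max_def)
  have bwd: "h (- t) x = (if t \<le> T0 then H t x else fl (\<rho> x) (- (t - T0)))" if "x \<in> F" "0 \<le> t" for t x
  proof -
    have "max 0 (- t - T0) + min 0 (- t + T0) = (if t \<le> T0 then 0 else - (t - T0))"
      using that(2) T0 by (auto simp: min_def max_def)
    then show ?thesis using that T0 HM[OF that(1), of t] HB[OF that(1)] by (simp add: h_def flow_0 min_def)
  qed
  have flc: "continuous_map (top_of_set S) M (fl y)" "continuous_map (top_of_set S) M (\<lambda>t. fl y (- t))"
    if y: "y \<in> topspace M" for y S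
  proof -
    have g: "continuous_map euclideanreal M (fl y)" using flow_curve[OF y] by (simp add: integral_curve_def)
    then show "continuous_map (top_of_set S) M (fl y)" by (rule continuous_map_from_subtopology)
    have "continuous_map euclideanreal M (\<lambda>t. fl y (- t))"
      using continuous_map_compose[of euclideanreal euclideanreal uminus M "fl y"] g by (simp add: o_def continuous_intros)
    then show "continuous_map (top_of_set S) M (\<lambda>t. fl y (- t))" by (rule continuous_map_from_subtopology)
  qed
  have up: "line_integral \<theta> 0 t (\<lambda>\<tau>. h \<tau> x) \<ge> \<kappa> * (t - T0) - B"
    and down: "line_integral \<theta> 0 t (\<lambda>\<tau>. h (- \<tau>) x) \<le> B - \<kappa> * (t - T0)" if x: "x \<in> F" and t: "t > T0" for x t
  proof -
    have ends: "H T0 x = fl (\<rho> x) 0" "H T0 x = fl (\<rho> x) (- 0)" using HB[OF x] flow_0[OF rhoM[OF x]] by simp_all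
    have tT: "0 \<le> t - T0" "T0 + (t - T0) = t" using t by simp_all
    have "line_integral \<theta> 0 t (\<lambda>\<tau>. h \<tau> x) = line_integral \<theta> 0 t (\<lambda>\<tau>. if \<tau> \<le> T0 then H \<tau> x else fl (\<rho> x) (\<tau> - T0))"
      using t T0 by (intro line_integral_cong[OF \<theta> track[OF x]]) (simp_all add: fwd[OF x])
    also have "\<dots> = line_integral \<theta> 0 T0 (\<lambda>\<tau>. H \<tau> x) + line_integral \<theta> 0 (t - T0) (fl (\<rho> x))"
      using line_integral_concat[OF \<theta> htrack[OF x] flc(1)[OF rhoM[OF x]] ends(1) T0 tT(1)] unfolding tT(2) .
    finally show "line_integral \<theta> 0 t (\<lambda>\<tau>. h \<tau> x) \<ge> \<kappa> * (t - T0) - B"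
      using flow_integral_growth[OF prims \<theta> rhoM[OF x] \<kappa>[OF x] tT(1)] HB[OF x] by linarith
    have "continuous_map (top_of_set {0..t}) M (\<lambda>\<tau>. h (- \<tau>) x)"
    proof (rule continuous_map_reparam[where \<gamma> = "\<lambda>\<tau>. h \<tau> x" and c = "- t" and d = 0])
      show "continuous_map (top_of_set {- t..0}) M (\<lambda>\<tau>. h \<tau> x)" by (rule track[OF x])
    qed (auto intro!: continuous_intros)
    then have "line_integral \<theta> 0 t (\<lambda>\<tau>. h (- \<tau>) x) = line_integral \<theta> 0 t (\<lambda>\<tau>. if \<tau> \<le> T0 then H \<tau> x else fl (\<rho> x) (- (\<tau> - T0)))"
      using t T0 by (intro line_integral_cong[OF \<theta>]) (simp_all add: bwd[OF x])
    also have "\<dots> = line_integral \<theta> 0 T0 (\<lambda>\<tau>. H \<tau> x) + line_integral \<theta> 0 (t - T0) (\<lambda>\<tau>. fl (\<rho> x) (- \<tau>))"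
      using line_integral_concat[OF \<theta> htrack[OF x] flc(2)[OF rhoM[OF x]] ends(2) T0 tT(1)] unfolding tT(2) .
    finally show "line_integral \<theta> 0 t (\<lambda>\<tau>. h (- \<tau>) x) \<le> B - \<kappa> * (t - T0)"
      using backward_flow_integral_growth[OF prims \<theta> rhoM[OF x] \<kappa>[OF x] tT(1)] HB[OF x] by linarith
  qed
  show ?thesis
    unfolding movable_def
  proof (intro exI[of _ h] conjI ballI allI impI)
    show "continuous_map ?X M (\<lambda>(t, x). h t x)" by (rule hc)
    show "h 0 x = x" if "x \<in> F" for x using fwd[OF that, of 0] HB[OF that] T0 by simp
    fix n :: nat assume "n > 0"
    \<comment> \<open>Beyond \<open>N\<close> the growth exceeds \<open>n\<close> plus
      \<open>\<bar>B\<bar>\<close> for the homotopy and \<open>\<bar>C\<bar>\<close> for passing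
      from \<open>\<theta>\<close> to \<open>\<theta>'\<close>.\<close>
    define N where "N = T0 + (real n + \<bar>B\<bar> + \<bar>C\<bar>) / \<kappa> + 1"
    have NT: "N > T0" "N > 0" using T0 \<kappa>0 by (auto simp: N_def intro!: add_nonneg_pos divide_nonneg_pos)
    have big: "\<kappa> * (t - T0) > real n + \<bar>B\<bar> + \<bar>C\<bar>" if "t > N" for t
    proof -
      have "(real n + \<bar>B\<bar> + \<bar>C\<bar>) / \<kappa> < t - T0" using that by (simp add: N_def)
      then show ?thesis using \<kappa>0 by (simp add: field_simps)
    qed
    have "line_integral \<theta>' 0 t (\<lambda>\<tau>. h \<tau> x) > real n" if "x \<in> F" "t > N" for x t
    proof -
      have t: "t > T0" "0 \<le> t" using that(2) NT by auto
      show ?thesis using up[OF that(1) t(1)] big[OF that(2)] C[OF t(2) track[OF that(1)]] by linarith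
    qed
    moreover have "line_integral \<theta>' 0 (- t) (\<lambda>\<tau>. h (- \<tau>) x) < - real n" if "x \<in> F" "t < - N" for x t
    proof -
      have t: "- t > T0" "0 \<le> - t" "- t > N" using that(2) NT by auto
      have "continuous_map (top_of_set {0..- t}) M (\<lambda>\<tau>. h (- \<tau>) x)"
      proof (rule continuous_map_reparam[where \<gamma> = "\<lambda>\<tau>. h \<tau> x" and c = t and d = 0])
        show "continuous_map (top_of_set {t..0}) M (\<lambda>\<tau>. h \<tau> x)" by (rule track[OF that(1)])
      qed (auto intro!: continuous_intros)
      then show ?thesis using down[OF that(1) t(1)] big[OF t(3)] C[OF t(2)] by fastforce
    qed
    ultimately show "\<exists>N>0. \<forall>x\<in>F. (\<forall>t>N. line_integral \<theta>' 0 t (\<lambda>\<tau>. h \<tau> x) > real n) \<and>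
        (\<forall>t. t < - N \<longrightarrow> line_integral \<theta>' 0 (- t) (\<lambda>\<tau>. h (- \<tau>) x) < - real n)"
      using NT(2) by (intro exI[of _ N]) blast
  qed
qed

end

context riemannian_field begin

section \<open>Assembly of the cover\<close>

lemma number_of_zeros_ge_Cat:
  assumes enr: "\<forall>\<delta>>0. \<exists>\<epsilon>>0. \<epsilon> < \<delta> \<and> ENR_space (subtopology M (away_set M A g v \<epsilon>))"
    and isolated: "\<forall>p\<in>zeros M A v.
      openin (subtopology M (chain_recurrent_set M A g v)) {p}"
    and realized: "\<exists>\<omega>. lyapunov_one_form M A v \<omega> \<and> smooth_represents M A \<omega> \<xi>"
  shows "number_of_elements (zeros M A v) \<ge> Cat M \<xi>"
proof (cases "finite (zeros M A v)")
  case False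
  then show ?thesis by (simp add: number_of_elements_def)
next
  case True
  let ?Z = "zeros M A v"
  obtain \<omega> \<theta> where \<omega>: "lyapunov_one_form M A v \<omega>" and prims: "local_primitives M A \<omega> \<theta>" and rep: "represents M \<theta> \<xi>"
    using realized unfolding smooth_represents_def by blast
  \<comment> \<open>The representative on which \<open>Cat\<close> is computed; only its class is
    known.\<close>
  define \<theta>' where "\<theta>' = (SOME \<theta>. represents M \<theta> \<xi>)"
  have rep': "represents M \<theta>' \<xi>" unfolding \<theta>'_def using rep by (rule someI)
  have \<theta>: "continuous_closed_one_form M \<theta>" using rep by (simp add: represents_def)
  \<comment> \<open>Times of both signs count, so a point outside the basin avoids \<open>W\<close>
    along its whole trajectory, as \<open>away_set\<close> asks.\<close>
  define basin where "basin W = {m \<in> topspace M. \<exists>t. fl m t \<in> W}" for W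
  have "\<exists>W. openin M W \<and> p \<in> W \<and> openin M (basin W) \<and> null_homotopic_in M (basin W)" if p: "p \<in> ?Z" for p
  proof -
    obtain c r \<rho> where c: "c \<in> A" "p \<in> chart_dom c" and r: "r > 0" "cball (coord c p) r \<subseteq> chart_im c"
      and \<rho>: "\<rho> > 0" "cball (coord c p) \<rho> \<subseteq> chart_im c"
      and convex: "\<And>x a b s. x \<in> topspace M \<Longrightarrow> a \<le> s \<Longrightarrow> s \<le> b \<Longrightarrow> fl x a \<in> chart_preimage c (ball (coord c p) \<rho>) \<Longrightarrow>
        fl x b \<in> chart_preimage c (ball (coord c p) \<rho>) \<Longrightarrow> fl x s \<in> chart_preimage c (ball (coord c p) r)"
      by (rule no_return[OF p bspec[OF isolated p]]) (rule that; assumption)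
    let ?W = "chart_preimage c (ball (coord c p) \<rho>)"
    have W: "openin M ?W" "p \<in> ?W"
      using openin_chart_preimage[OF c(1) open_ball] c(2) \<rho>(1) by (auto simp: chart_preimage_def)
    have "openin M (basin ?W)" "null_homotopic_in M (basin ?W)"
      unfolding basin_def by (rule basin_null_homotopic[OF c(1) r \<rho> convex]; assumption)+
    then show ?thesis using W by blast
  qed
  then obtain W where W: "\<And>p. p \<in> ?Z \<Longrightarrow> openin M (W p) \<and> p \<in> W p"
    and W': "\<And>p. p \<in> ?Z \<Longrightarrow> openin M (basin (W p)) \<and> null_homotopic_in M (basin (W p))"
    by metis
  define G where "G p = basin (W p)" for p
  have G: "openin M (G p) \<and> null_homotopic_in M (G p)" if "p \<in> ?Z" for p using W'[OF that] by (simp add: G_def)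
  have "\<exists>\<epsilon>>0. \<forall>m. riem_dist M A g m p \<le> ereal \<epsilon> \<longrightarrow> m \<in> W p" if p: "p \<in> ?Z" for p
  proof -
    obtain \<epsilon> where "\<epsilon> > 0" "\<And>m. riem_dist M A g m p \<le> ereal \<epsilon> \<Longrightarrow> m \<in> W p"
      by (rule riem_dist_large[OF conjunct1[OF W[OF p]] conjunct2[OF W[OF p]]]) (rule that; assumption)
    then show ?thesis by blast
  qed
  then obtain e where e: "\<And>p. p \<in> ?Z \<Longrightarrow> e p > 0" "\<And>p m. p \<in> ?Z \<Longrightarrow> riem_dist M A g m p \<le> ereal (e p) \<Longrightarrow> m \<in> W p"
    by metis
  \<comment> \<open>The zeros are finitely many here, so one \<delta> fits inside all the
    neighbourhoods \<open>W p\<close>; the 1 covers the case without zeros.\<close>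
  define \<delta> where "\<delta> = Min (insert 1 (e ` ?Z))"
  have \<delta>: "\<delta> > 0" "\<And>p. p \<in> ?Z \<Longrightarrow> \<delta> \<le> e p" using True e(1) by (auto simp: \<delta>_def)
  obtain \<epsilon> where \<epsilon>: "\<epsilon> > 0" "\<epsilon> < \<delta>" and enr': "ENR_space (subtopology M (away_set M A g v \<epsilon>))"
    using enr \<delta>(1) by blast
  let ?U = "away_set M A g v \<epsilon>"
  define C where "C = topspace M - (\<Union>p\<in>?Z. G p)"
  have UM: "?U \<subseteq> topspace M" by (auto simp: away_set_def)
  have clC: "closedin M C" unfolding C_def using G by (intro closedin_diff closedin_topspace openin_Union) auto
  have CU: "C \<subseteq> ?U"
  proof
    fix m assume m: "m \<in> C"
    have "riem_dist M A g (fl m t) p > ereal \<epsilon>" if p: "p \<in> ?Z" for t p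
    proof (rule ccontr)
      assume "\<not> ?thesis"
      then have "riem_dist M A g (fl m t) p \<le> ereal (e p)"
        using \<epsilon>(2) \<delta>(2)[OF p] by (meson ereal_less_eq(3) less_imp_le linorder_not_less order_trans)
      then have "fl m t \<in> W p" using e(2) p by blast
      then show False using m p by (auto simp: C_def G_def basin_def)
    qed
    then show "m \<in> ?U" using m by (simp add: away_set_def C_def)
  qed
  obtain N \<rho> where N: "openin M N" "C \<subseteq> N" and \<rho>: "continuous_map (subtopology M N) M \<rho>" "\<rho> ` N \<subseteq> ?U"
    "\<And>x. x \<in> C \<Longrightarrow> \<rho> x = x"
    by (rule ENR_neighbourhood_map[OF compact hausdorff UM enr' clC CU]) (rule that; assumption)
  obtain F where F: "openin M F" "F \<subseteq> N" "\<And>y. y \<in> N \<Longrightarrow> \<rho> y = y \<Longrightarrow> y \<in> F" and tame: "tame_homotopic \<theta> F (\<lambda>y. y) \<rho>"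
    by (rule deform_to_map[OF \<theta> N(1) \<rho>(1)]) (rule that; assumption)
  have CF: "C \<subseteq> F"
    by (intro subsetI F(3) subsetD[OF N(2)] \<rho>(3))
  have FM: "F \<subseteq> topspace M" using openin_subset[OF F(1)] .
  \<comment> \<open>Neighbourhoods of the zeros inside the \<epsilon>-balls. Trajectories from
    \<open>?U\<close> never enter them, since \<open>?U\<close> is defined through whole
    trajectories; their complement \<open>K\<close> is compact and free of zeros.\<close>
  have "\<exists>B. openin M B \<and> p \<in> B \<and> (\<forall>a\<in>B. riem_dist M A g a p < ereal \<epsilon>)" if p: "p \<in> ?Z" for p
  proof -
    have pM: "p \<in> topspace M" using p zeros_subset by blast
    obtain B where "openin M B" "p \<in> B" "\<And>a b. a \<in> B \<Longrightarrow> b \<in> B \<Longrightarrow> riem_dist M A g a b < ereal \<epsilon>"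
      by (rule riem_dist_small[OF pM \<epsilon>(1)]) (rule that; assumption)
    then show ?thesis by blast
  qed
  then obtain B where B: "\<And>p. p \<in> ?Z \<Longrightarrow> openin M (B p) \<and> p \<in> B p \<and> (\<forall>a\<in>B p. riem_dist M A g a p < ereal \<epsilon>)"
    by metis
  define K where "K = topspace M - (\<Union>p\<in>?Z. B p)"
  have "closedin M K" unfolding K_def using B by (intro closedin_diff closedin_topspace openin_Union) auto
  then have "compactin M K" by (rule closedin_compact_space[OF compact])
  moreover have "K \<inter> ?Z = {}" using B by (auto simp: K_def)
  ultimately obtain \<kappa> where \<kappa>: "\<kappa> > 0" "\<And>m c. m \<in> K \<Longrightarrow> c \<in> A \<Longrightarrow> m \<in> chart_dom c \<Longrightarrow> \<kappa> \<le> \<omega> c m (v c m)"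
    using lyapunov_lower_bound[OF \<omega>] by metis
  have inK: "fl (\<rho> x) t \<in> K" if x: "x \<in> F" for x t
  proof -
    have r: "\<rho> x \<in> ?U" using \<rho>(2) F(2) x by blast
    then have "fl (\<rho> x) t \<in> topspace M" using UM by (intro flow_in) blast
    moreover have "fl (\<rho> x) t \<notin> B p" if p: "p \<in> ?Z" for p
    proof
      assume "fl (\<rho> x) t \<in> B p"
      then have "riem_dist M A g (fl (\<rho> x) t) p < ereal \<epsilon>" using B[OF p] by blast
      moreover have "riem_dist M A g (fl (\<rho> x) t) p > ereal \<epsilon>" using r p by (simp add: away_set_def)
      ultimately show False by simp
    qed
    ultimately show ?thesis by (simp add: K_def)
  qed
  have movable: "movable M \<theta>' F"
    by (rule movable_from_flow[OF prims rep rep' FM tame \<kappa>(1)]) (rule \<kappa>(2)[OF inK])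
  \<comment> \<open>\<open>cat_cover\<close> indexes its sets by \<open>{1..k}\<close>, so the zeros
    are numbered from 1.\<close>
  obtain z where z: "bij_betw z {1..card ?Z} ?Z" using ex_bij_betw_nat_finite_1[OF True] by blast
  have zZ: "z j \<in> ?Z" if "j \<in> {1..card ?Z}" for j using bij_betwE[OF z] that by blast
  have "topspace M = F \<union> (\<Union>j\<in>{1..card ?Z}. G (z j))"
  proof -
    have "(\<Union>j\<in>{1..card ?Z}. G (z j)) = (\<Union>p\<in>?Z. G p)"
      using bij_betw_imp_surj_on[OF z] by (metis image_image)
    moreover have "(\<Union>p\<in>?Z. G p) \<subseteq> topspace M" using G openin_subset by blast
    ultimately show ?thesis using CF FM by (auto simp: C_def)
  qed
  then have "cat_cover M \<theta>' (card ?Z)"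
    unfolding cat_cover_def using F(1) G zZ movable
    by (intro exI[of _ F] exI[of _ "\<lambda>j. G (z j)"] conjI ballI) auto
  then have "Cat M \<xi> \<le> enat (card ?Z)"
    unfolding Cat_def Let_def \<theta>'_def by (intro Inf_lower) blast
  then show ?thesis using True by (simp add: number_of_elements_def)
qed

end

theorem theorem6p6:
  fixes M :: "'a topology"
    and A :: "('a, 'e::real_normed_vector) chart set"
    and g :: "('a, 'e) metric_tensor"
    and v :: "('a, 'e) vfield"
    and \<xi> :: "'a chain set \<Rightarrow> real"
  assumes manifold: "closed_smooth_manifold M A"
    and metric: "riemannian_metric_on A (topspace M) g"
    and field: "smooth_vector_field A v"
    and enr: "\<forall>\<delta>>0. \<exists>\<epsilon>>0. \<epsilon> < \<delta> \<and> ENR_space (subtopology M (away_set M A g v \<epsilon>))"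
    and lyapunov: "\<exists>\<omega>. lyapunov_one_form M A v \<omega>"
    and isolated: "\<forall>p\<in>zeros M A v.
      openin (subtopology M (chain_recurrent_set M A g v)) {p}"
    and realized: "\<exists>\<omega>. lyapunov_one_form M A v \<omega> \<and> smooth_represents M A \<omega> \<xi>"
  shows "number_of_elements (zeros M A v) \<ge> Cat M \<xi>"
proof -
  have "closed_manifold M A" using manifold by (rule closed_manifold.intro)
  then have "manifold_field M A v" "riemannian_manifold M A g"
    using field metric
    by (simp_all add: manifold_field_def manifold_field_axioms_def riemannian_manifold_def riemannian_manifold_axioms_def)
  then have "riemannian_field M A v g" by (rule riemannian_field.intro)
  then show ?thesis using enr isolated realized by (rule riemannian_field.number_of_zeros_ge_Cat)
qed

end
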